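(* Let $\Phi\subseteq V^*$ be an essential irreducible root system of classical type ($\mathrm A_n$, $\mathrm B_n$, $\mathrm C_n$ or $\mathrm D_n$), let $\Sigma$ be the Euclidean Coxeter complex of type $\Phi$, and $\mathcal V\subseteq V$ its vertex set. For a function $f:\mathcal V\to\mathbb R\cup\{+\infty\}$ with $\operatorname{dom} f\ne\emptyset$, the following are equivalent: (a) $f$ is L-convex of type $\Phi$. (b) The Lovász extension $\overline f$ is convex on $V$. (c) $f$ satisfies the discrete midpoint convexity: for all $x,y\in\mathcal V$, with $z=(x+y)/2$, $$f(x)+f(y)\ \ge\ 2\sum_{v\in\mathcal V(A_z)}\lambda_z(v)f(v).\qquad(\ast)$$ (d) $\operatorname{dom} f$ is an L-convex set of type $\Phi$, and the inequality $(\ast)$ holds for any two adjacent maximal simplices $A_1,A_2$ of $\Sigma[\operatorname{dom} f]$, $x\in\mathcal V(A_1)\setminus\mathcal V(A_2)$ and $y\in\mathcal V(A_2)\setminus\mathcal V(A_1)$.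
   Context: Root systems. $V$ is a finite-dimensional real inner product space with dual $V^*$, $\langle p,x\rangle=p(x)$ for $p\in V^*,x\in V$; $V^*$ carries the induced inner product. For $\alpha\in V^*\setminus\{0\}$, $\alpha^\vee\in V$ is $2/\|\alpha\|^2$ times the vector of $V$ representing $\alpha$, and $s_\alpha(p)=p-\langle p,\alpha^\vee\rangle\alpha$. A root system is a nonempty finite set $\Phi\subseteq V^*\setminus\{0\}$ with $s_\alpha(\beta)\in\Phi$, $\mathbb R\alpha\cap\Phi=\{\alpha,-\alpha\}$ and $\langle\alpha,\beta^\vee\rangle\in\mathbb Z$ for all $\alpha,\beta\in\Phi$. It is essential if $\operatorname{span}\Phi=V^*$, and irreducible if it is not a disjoint union of two nonempty mutually orthogonal subsets. Euclidean Coxeter complex. For $(\alpha,k)\in\Phi\times\mathbb Z$ let $H^0_{\alpha,k},H^+_{\alpha,k},H^-_{\alpha,k}$ be the sets of $x\in V$ with $\langle\alpha,x\rangle=k$, $>k$, $<k$. An (open) cell is a nonempty set $\bigcap_{(\alpha,k)\in\Phi\times\mathbb Z}H^{\sigma_{\alpha,k}}_{\alpha,k}$ with $\sigma_{\alpha,k}\in\{+,0,-\}$. $\Sigma$ is the set of all cells together with $\emptyset$, ordered by $A\preceq B\iff\operatorname{cl}A\subseteq\operatorname{cl}B$; it is a simplicial complex, the cells partition $V$, and each nonempty cell $A$ is the relative interior of a geometric simplex, whose vertex set is denoted $\mathcal V(A)$. $\mathcal V$ is the set of vertices (one-point cells, identified with points of $V$). For $x\in V$, $A_x$ is the cell containing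 $x$ and $\lambda_x$ the unique convex-combination coefficients with support $\mathcal V(A_x)$ such that $x=\sum_v\lambda_x(v)v$. The Lovász extension of $f$ is $\overline f(x)=\sum_{v\in\mathcal V(A_x)}\lambda_x(v)f(v)$, $x\in V$. For $D\subseteq\mathcal V$, $\Sigma[D]=\{A\in\Sigma:\mathcal V(A)\subseteq D\}$. Two maximal simplices $A_1,A_2$ of $\Sigma[D]$ are adjacent if they have a common corank-one face (a common face with exactly one vertex fewer than each of them). $\operatorname{dom} f$ is the set where $f$ is finite. Convexity notions. An integral L-convex polyhedron of type $\Phi$ is a nonempty set $\{x\in V:\langle\alpha,x\rangle\le\gamma(\alpha)\ \forall\alpha\in\Phi\}$ with $\gamma:\Phi\to\mathbb Z\cup\{+\infty\}$. A nonempty set $D\subseteq\mathcal V$ is L-convex of type $\Phi$ if $D=P\cap\mathcal V$ for some integral L-convex polyhedron $P$ of type $\Phi$. A convex set is locally polyhedral if its intersection with every polytope is a polytope; a function is locally polyhedral convex if its epigraph is a locally polyhedral convex set. For a function $h$ on $V$, $\Pi(h)=\{\operatorname{argmin}(h-p): p\in V^*,\ \operatorname{argmin}(h-p)\ne\emptyset\}$, where $(h-p)(x)=h(x)-\langle p,x\rangle$. A primal-integral locally polyhedral L-convex function of type $\Phi$ is a proper locally polyhedral convex function $\hat f:V\to\mathbb R\cup\{+\infty\}$ such that every member of $\Pi(\hat f)$ is an integral L-convex polyhedron of type $\Phi$. A function $f:\mathcal V\to\mathbb R\cup\{+\infty\}$ is L-convex of type $\Phi$ if it is the restriction to $\mathcal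 V$ of some such $\hat f$. *)

theory Defs
  imports "HOL-Analysis.Analysis"
begin

section \<open>Root systems in the dual space\<close>

text \<open>
  V is the type \<^typ>\<open>'a\<close> of class \<^class>\<open>euclidean_space\<close>, its dual V* is
  \<^typ>\<open>'a \<Rightarrow>\<^sub>L real\<close> (every functional is bounded, as V is finite-dimensional), and the
  pairing of p and x is \<^term>\<open>blinfun_apply p x\<close>.
\<close>

definition riesz :: "('a::euclidean_space \<Rightarrow>\<^sub>L real) \<Rightarrow> 'a" where
  "riesz p = (THE v. \<forall>x. blinfun_apply p x = v \<bullet> x)"

definition dual_inner :: "('a::euclidean_space \<Rightarrow>\<^sub>L real) \<Rightarrow> ('a \<Rightarrow>\<^sub>L real) \<Rightarrow> real" where
  "dual_inner p q = riesz p \<bullet> riesz q"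

definition coroot :: "('a::euclidean_space \<Rightarrow>\<^sub>L real) \<Rightarrow> 'a" where
  "coroot \<alpha> = (2 / dual_inner \<alpha> \<alpha>) *\<^sub>R riesz \<alpha>"

definition root_reflection :: "('a::euclidean_space \<Rightarrow>\<^sub>L real) \<Rightarrow> ('a \<Rightarrow>\<^sub>L real) \<Rightarrow> ('a \<Rightarrow>\<^sub>L real)" where
  "root_reflection \<alpha> p = p - blinfun_apply p (coroot \<alpha>) *\<^sub>R \<alpha>"

definition root_system :: "('a::euclidean_space \<Rightarrow>\<^sub>L real) set \<Rightarrow> bool" where
  "root_system \<Phi> \<longleftrightarrow>
     finite \<Phi> \<and> \<Phi> \<noteq> {} \<and> 0 \<notin> \<Phi> \<and>
     (\<forall>\<alpha>\<in>\<Phi>. \<forall>\<beta>\<in>\<Phi>. root_reflection \<alpha> \<beta> \<in> \<Phi>) \<and>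
     (\<forall>\<alpha>\<in>\<Phi>. range (\<lambda>c. c *\<^sub>R \<alpha>) \<inter> \<Phi> = {\<alpha>, - \<alpha>}) \<and>
     (\<forall>\<alpha>\<in>\<Phi>. \<forall>\<beta>\<in>\<Phi>. blinfun_apply \<alpha> (coroot \<beta>) \<in> \<int>)"

definition essential :: "('a::euclidean_space \<Rightarrow>\<^sub>L real) set \<Rightarrow> bool" where
  "essential \<Phi> \<longleftrightarrow> span \<Phi> = UNIV"

definition irreducible_roots :: "('a::euclidean_space \<Rightarrow>\<^sub>L real) set \<Rightarrow> bool" where
  "irreducible_roots \<Phi> \<longleftrightarrow>
     \<not> (\<exists>\<Phi>1 \<Phi>2. \<Phi>1 \<noteq> {} \<and> \<Phi>2 \<noteq> {} \<and> \<Phi>1 \<inter> \<Phi>2 = {} \<and> \<Phi>1 \<union> \<Phi>2 = \<Phi> \<and>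
         (\<forall>\<alpha>\<in>\<Phi>1. \<forall>\<beta>\<in>\<Phi>2. dual_inner \<alpha> \<beta> = 0))"

text \<open>
  The standard root systems of classical type.  As the rank varies, the ambient coordinate space
  of dimension m is represented by functions on the natural numbers, only the coordinates below m
  being relevant: m is n + 1 for type A and n for the other types.
\<close>

definition std_inner :: "nat \<Rightarrow> (nat \<Rightarrow> real) \<Rightarrow> (nat \<Rightarrow> real) \<Rightarrow> real" where
  "std_inner m u v = (\<Sum>i<m. u i * v i)"

definition unit_vec :: "nat \<Rightarrow> nat \<Rightarrow> real" where
  "unit_vec i = (\<lambda>k. if k = i then 1 else 0)"

definition A_roots :: "nat \<Rightarrow> (nat \<Rightarrow> real) set" where
  "A_roots n = {(\<lambda>k. unit_vec i k - unit_vec j k) | i j. i < n + 1 \<and> j < n + 1 \<and> i \<noteq> j}"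

definition D_roots :: "nat \<Rightarrow> (nat \<Rightarrow> real) set" where
  "D_roots n = {(\<lambda>k. s * unit_vec i k + t * unit_vec j k) | i j s t.
     i < n \<and> j < n \<and> i \<noteq> j \<and> s \<in> {- 1, 1} \<and> t \<in> {- 1, 1}}"

definition B_roots :: "nat \<Rightarrow> (nat \<Rightarrow> real) set" where
  "B_roots n = D_roots n \<union> {(\<lambda>k. s * unit_vec i k) | i s. i < n \<and> s \<in> {- 1, 1}}"

definition C_roots :: "nat \<Rightarrow> (nat \<Rightarrow> real) set" where
  "C_roots n = D_roots n \<union> {(\<lambda>k. s * (2 * unit_vec i k)) | i s. i < n \<and> s \<in> {- 1, 1}}"

text \<open>
  Isomorphism of root systems: a linear isomorphism of the spanned spaces that carries the roots
  onto the roots and preserves the Cartan integers.  There is no vector space instance for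
  \<^typ>\<open>nat \<Rightarrow> real\<close>, so linearity is required of each coordinate.
\<close>

definition root_iso :: "nat \<Rightarrow> ('a::euclidean_space \<Rightarrow>\<^sub>L real) set \<Rightarrow> (nat \<Rightarrow> real) set \<Rightarrow> bool" where
  "root_iso m \<Phi> R \<longleftrightarrow>
     (\<exists>\<phi> :: ('a \<Rightarrow>\<^sub>L real) \<Rightarrow> (nat \<Rightarrow> real).
        (\<forall>i. linear (\<lambda>p. \<phi> p i)) \<and> inj_on \<phi> (span \<Phi>) \<and> \<phi> ` \<Phi> = R \<and>
        (\<forall>\<alpha>\<in>\<Phi>. \<forall>\<beta>\<in>\<Phi>. blinfun_apply \<alpha> (coroot \<beta>) =
           2 * std_inner m (\<phi> \<alpha>) (\<phi> \<beta>) / std_inner m (\<phi> \<beta>) (\<phi> \<beta>)))"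

definition classical_type :: "('a::euclidean_space \<Rightarrow>\<^sub>L real) set \<Rightarrow> bool" where
  "classical_type \<Phi> \<longleftrightarrow>
     (\<exists>n\<ge>1. root_iso (n + 1) \<Phi> (A_roots n)) \<or>
     (\<exists>n\<ge>2. root_iso n \<Phi> (B_roots n)) \<or>
     (\<exists>n\<ge>2. root_iso n \<Phi> (C_roots n)) \<or>
     (\<exists>n\<ge>4. root_iso n \<Phi> (D_roots n))"

section \<open>The Euclidean Coxeter complex\<close>

datatype side = Plus | Zero | Minus

fun hside :: "side \<Rightarrow> ('a::euclidean_space \<Rightarrow>\<^sub>L real) \<Rightarrow> int \<Rightarrow> 'a set" where
  "hside Zero \<alpha> k = {x. blinfun_apply \<alpha> x = of_int k}"
| "hside Plus \<alpha> k = {x. blinfun_apply \<alpha> x > of_int k}"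
| "hside Minus \<alpha> k = {x. blinfun_apply \<alpha> x < of_int k}"

definition cells :: "('a::euclidean_space \<Rightarrow>\<^sub>L real) set \<Rightarrow> 'a set set" where
  "cells \<Phi> = {A. A \<noteq> {} \<and>
     (\<exists>\<sigma> :: ('a \<Rightarrow>\<^sub>L real) \<Rightarrow> int \<Rightarrow> side. A = (\<Inter>(\<alpha>, k)\<in>\<Phi> \<times> UNIV. hside (\<sigma> \<alpha> k) \<alpha> k))}"

definition coxeter_complex :: "('a::euclidean_space \<Rightarrow>\<^sub>L real) set \<Rightarrow> 'a set set" where
  "coxeter_complex \<Phi> = insert {} (cells \<Phi>)"

definition cell_le :: "'a::euclidean_space set \<Rightarrow> 'a set \<Rightarrow> bool" where
  "cell_le A B \<longleftrightarrow> closure A \<subseteq> closure B"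

definition cvertices :: "('a::euclidean_space \<Rightarrow>\<^sub>L real) set \<Rightarrow> 'a set" where
  "cvertices \<Phi> = {v. {v} \<in> cells \<Phi>}"

text \<open>
  The vertex set of the simplex whose relative interior is A; this gives the empty set for
  the empty cell.
\<close>

definition verts :: "'a::euclidean_space set \<Rightarrow> 'a set" where
  "verts A = (THE S. finite S \<and> \<not> affine_dependent S \<and> A = rel_interior (convex hull S))"

definition cell_at :: "('a::euclidean_space \<Rightarrow>\<^sub>L real) set \<Rightarrow> 'a \<Rightarrow> 'a set" where
  "cell_at \<Phi> x = (THE A. A \<in> cells \<Phi> \<and> x \<in> A)"

definition bary :: "('a::euclidean_space \<Rightarrow>\<^sub>L real) set \<Rightarrow> 'a \<Rightarrow> 'a \<Rightarrow> real" where
  "bary \<Phi> x = (THE l. (\<forall>v. 0 \<le> l v) \<and> {v. l v \<noteq> 0} = verts (cell_at \<Phi> x) \<and>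
     (\<Sum>v\<in>verts (cell_at \<Phi> x). l v) = 1 \<and>
     (\<Sum>v\<in>verts (cell_at \<Phi> x). l v *\<^sub>R v) = x)"

text \<open>
  Functions on the vertex set are represented by functions on all of \<^typ>\<open>'a\<close>; their values
  at other points are never used.
\<close>

definition lovasz :: "('a::euclidean_space \<Rightarrow>\<^sub>L real) set \<Rightarrow> ('a \<Rightarrow> ereal) \<Rightarrow> 'a \<Rightarrow> ereal" where
  "lovasz \<Phi> f x = (\<Sum>v\<in>verts (cell_at \<Phi> x). ereal (bary \<Phi> x v) * f v)"

definition eff_dom :: "('a::euclidean_space \<Rightarrow>\<^sub>L real) set \<Rightarrow> ('a \<Rightarrow> ereal) \<Rightarrow> 'a set" where
  "eff_dom \<Phi> f = {v \<in> cvertices \<Phi>. \<bar>f v\<bar> \<noteq> \<infinity>}"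

definition subcomplex :: "('a::euclidean_space \<Rightarrow>\<^sub>L real) set \<Rightarrow> 'a set \<Rightarrow> 'a set set" where
  "subcomplex \<Phi> D = {A \<in> coxeter_complex \<Phi>. verts A \<subseteq> D}"

definition max_simplices :: "'a::euclidean_space set set \<Rightarrow> 'a set set" where
  "max_simplices K = {A \<in> K. \<forall>B\<in>K. cell_le A B \<longrightarrow> B = A}"

text \<open>
  The common face may be the empty simplex, which is a corank-one face of every one-point cell.
\<close>

definition adjacent :: "('a::euclidean_space \<Rightarrow>\<^sub>L real) set \<Rightarrow> 'a set \<Rightarrow> 'a set \<Rightarrow> bool" where
  "adjacent \<Phi> A1 A2 \<longleftrightarrow> A1 \<noteq> A2 \<and>
     (\<exists>F\<in>coxeter_complex \<Phi>. cell_le F A1 \<and> cell_le F A2 \<and>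
        card (verts A1) = card (verts F) + 1 \<and> card (verts A2) = card (verts F) + 1)"

section \<open>Convexity notions\<close>

definition int_L_convex_polyhedron :: "('a::euclidean_space \<Rightarrow>\<^sub>L real) set \<Rightarrow> 'a set \<Rightarrow> bool" where
  "int_L_convex_polyhedron \<Phi> P \<longleftrightarrow> P \<noteq> {} \<and>
     (\<exists>\<gamma> :: ('a \<Rightarrow>\<^sub>L real) \<Rightarrow> ereal.
        (\<forall>\<alpha>\<in>\<Phi>. \<gamma> \<alpha> = \<infinity> \<or> (\<exists>k::int. \<gamma> \<alpha> = ereal (of_int k))) \<and>
        P = {x. \<forall>\<alpha>\<in>\<Phi>. ereal (blinfun_apply \<alpha> x) \<le> \<gamma> \<alpha>})"

definition L_convex_set :: "('a::euclidean_space \<Rightarrow>\<^sub>L real) set \<Rightarrow> 'a set \<Rightarrow> bool" where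
  "L_convex_set \<Phi> D \<longleftrightarrow> D \<noteq> {} \<and>
     (\<exists>P. int_L_convex_polyhedron \<Phi> P \<and> D = P \<inter> cvertices \<Phi>)"

definition epi :: "('a \<Rightarrow> ereal) \<Rightarrow> ('a \<times> real) set" where
  "epi h = {(x, t). h x \<le> ereal t}"

definition convex_fun :: "('a::euclidean_space \<Rightarrow> ereal) \<Rightarrow> bool" where
  "convex_fun h \<longleftrightarrow> convex (epi h)"

definition locally_polyhedral :: "'a::euclidean_space set \<Rightarrow> bool" where
  "locally_polyhedral S \<longleftrightarrow> (\<forall>Q. polytope Q \<longrightarrow> polytope (S \<inter> Q))"

definition locally_polyhedral_convex_fun :: "('a::euclidean_space \<Rightarrow> ereal) \<Rightarrow> bool" where
  "locally_polyhedral_convex_fun h \<longleftrightarrow> convex (epi h) \<and> locally_polyhedral (epi h)"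

definition proper_fun :: "('a \<Rightarrow> ereal) \<Rightarrow> bool" where
  "proper_fun h \<longleftrightarrow> (\<forall>x. h x \<noteq> - \<infinity>) \<and> (\<exists>x. h x \<noteq> \<infinity>)"

definition argmin_lin :: "('a::euclidean_space \<Rightarrow> ereal) \<Rightarrow> ('a \<Rightarrow>\<^sub>L real) \<Rightarrow> 'a set" where
  "argmin_lin h p =
     {x. \<forall>y. h x - ereal (blinfun_apply p x) \<le> h y - ereal (blinfun_apply p y)}"

definition Pi_fam :: "('a::euclidean_space \<Rightarrow> ereal) \<Rightarrow> 'a set set" where
  "Pi_fam h = {argmin_lin h p | p. argmin_lin h p \<noteq> {}}"

definition primal_int_L_convex_fun ::
    "('a::euclidean_space \<Rightarrow>\<^sub>L real) set \<Rightarrow> ('a \<Rightarrow> ereal) \<Rightarrow> bool" where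
  "primal_int_L_convex_fun \<Phi> h \<longleftrightarrow> proper_fun h \<and> locally_polyhedral_convex_fun h \<and>
     (\<forall>P\<in>Pi_fam h. int_L_convex_polyhedron \<Phi> P)"

definition L_convex_fun :: "('a::euclidean_space \<Rightarrow>\<^sub>L real) set \<Rightarrow> ('a \<Rightarrow> ereal) \<Rightarrow> bool" where
  "L_convex_fun \<Phi> f \<longleftrightarrow>
     (\<exists>h. primal_int_L_convex_fun \<Phi> h \<and> (\<forall>v\<in>cvertices \<Phi>. f v = h v))"

definition midpoint_ineq ::
    "('a::euclidean_space \<Rightarrow>\<^sub>L real) set \<Rightarrow> ('a \<Rightarrow> ereal) \<Rightarrow> 'a \<Rightarrow> 'a \<Rightarrow> bool" where
  "midpoint_ineq \<Phi> f x y \<longleftrightarrow>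
     (let z = (1/2) *\<^sub>R (x + y) in
        f x + f y \<ge> 2 * (\<Sum>v\<in>verts (cell_at \<Phi> z). ereal (bary \<Phi> z v) * f v))"

end

theory Submission
  imports Defs
begin

text \<open>
  An alcove is cut out by walls whose normals are pairwise non-acute; irreducibility makes their
  linear dependency unique and positive, so closed alcoves, and hence closed cells, are simplices.

  If the midpoint inequality holds, then among the convex combinations of vertices of
  dom f with a given barycentre, restricted to a finite region, one minimises f plus a
  small multiple of a function that is strictly midpoint convex on separated vertices.  Replacing
  two separated vertices by the cell of their midpoint would decrease the value, so the minimiser
  lives on a single cell.  Thus the Lovasz extension is the convex closure of f.

  A convex union of closed cells is cut out by root half-spaces: from a maximal cell one walks
  towards a point through walls, each step removing a separating hyperplane.  The same walk turns
  the local inequality into the statement that each affine piece of the Lovasz extension is a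
  global minorant.  For the local step, the midpoint of the two vertices opposite a common facet
  always lies in one of the two closed cells.
\<close>

section \<open>Root systems\<close>

text \<open>Walls are non-acute because differences of acute roots are roots: the values of such a
  difference on the two facets would not fit into a strip of width one. Irreducibility speaks of
  roots, while a dependency with a zero coefficient splits only the walls; a minimal root that sees
  both parts is the means of passing from one to the other.

  The strictly convex perturbation is there because \<open>f\<close> alone allows ties, so that a
  minimiser could spread over several cells; the inequality for \<open>f\<close> is recovered by
  letting the multiple tend to 0. The finite region is a convex union of closed cells, so exchanges
  do not leave it.

  As dom f may have lower dimension, neighbouring cells are compared only inside the affine hull of
  a maximal cell, maximality being measured by the number of vertices. Two affine pieces agree on
  the common facet, so their difference there is controlled by the sign of the wall.

  An abstractly given L-convex extension must be identified with the Lovasz extension; local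
  polyhedrality supplies the subgradients for this, also at boundary points of the domain.\<close>

lemma riesz_inner: "blinfun_apply p x = riesz p \<bullet> x"
proof -
  let ?v = "\<Sum>b\<in>Basis. blinfun_apply p b *\<^sub>R b"
  have v: "blinfun_apply p x = ?v \<bullet> x" for x
  proof -
    have "blinfun_apply p x = blinfun_apply p (\<Sum>b\<in>Basis. (x \<bullet> b) *\<^sub>R b)"
      by (simp add: euclidean_representation)
    also have "\<dots> = (\<Sum>b\<in>Basis. (x \<bullet> b) * blinfun_apply p b)"
      by (simp add: blinfun.sum_right blinfun.scaleR_right)
    also have "\<dots> = ?v \<bullet> x"
      by (simp add: inner_sum_left inner_commute[of x] mult.commute)
    finally show ?thesis .
  qed
  have "\<forall>x. blinfun_apply p x = riesz p \<bullet> x"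
    unfolding riesz_def
  proof (rule theI[where a = ?v])
    show "\<forall>x. blinfun_apply p x = ?v \<bullet> x" using v by blast
    fix w assume w: "\<forall>x. blinfun_apply p x = w \<bullet> x"
    have "w \<bullet> x = ?v \<bullet> x" for x using w[rule_format, of x] v[of x] by argo
    then show "w = ?v" using vector_eq_rdot[of w ?v] by blast
  qed
  then show ?thesis by blast
qed

lemma riesz_eqI: "(\<And>x. blinfun_apply p x = v \<bullet> x) \<Longrightarrow> riesz p = v"
  using vector_eq_rdot[of "riesz p" v] riesz_inner[of p] by simp

lemma riesz_diff: "riesz (p - q) = riesz p - riesz q"
  by (rule riesz_eqI) (simp add: riesz_inner[symmetric] blinfun.diff_left inner_diff_left)

lemma riesz_minus: "riesz (- p) = - riesz p"
  by (rule riesz_eqI) (simp add: riesz_inner[symmetric] blinfun.minus_left)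

lemma riesz_scaleR: "riesz (c *\<^sub>R p) = c *\<^sub>R riesz p"
  by (rule riesz_eqI) (simp add: riesz_inner[symmetric] blinfun.scaleR_left)

lemma riesz_inject: "riesz p = riesz q \<longleftrightarrow> p = q"
  by (metis blinfun_eqI riesz_inner)

lemma riesz_eq_0: "riesz p = 0 \<longleftrightarrow> p = 0"
  using riesz_inject[of p 0] riesz_scaleR[of 0 p] by simp

lemma apply_coroot:
  "blinfun_apply p (coroot q) = 2 * (riesz p \<bullet> riesz q) / (riesz q \<bullet> riesz q)"
  by (simp add: riesz_inner coroot_def dual_inner_def)

lemma riesz_reflection:
  "riesz (root_reflection \<alpha> p) = riesz p - blinfun_apply p (coroot \<alpha>) *\<^sub>R riesz \<alpha>"
  by (simp add: root_reflection_def riesz_diff riesz_scaleR)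

section \<open>Roots, reflections and generic points\<close>

locale irreducible_root_system =
  fixes \<Phi> :: "('a::euclidean_space \<Rightarrow>\<^sub>L real) set"
  assumes root_system: "root_system \<Phi>" and essential: "essential \<Phi>"
    and irreducible: "irreducible_roots \<Phi>"
begin

lemma finite_roots: "finite \<Phi>" and zero_not_root: "0 \<notin> \<Phi>"
  using root_system unfolding root_system_def by auto

lemma reflection_root: "\<alpha> \<in> \<Phi> \<Longrightarrow> \<beta> \<in> \<Phi> \<Longrightarrow> root_reflection \<alpha> \<beta> \<in> \<Phi>"
  using root_system unfolding root_system_def by auto

lemma cartan_int: "\<alpha> \<in> \<Phi> \<Longrightarrow> \<beta> \<in> \<Phi> \<Longrightarrow> blinfun_apply \<alpha> (coroot \<beta>) \<in> \<int>"
  using root_system unfolding root_system_def by auto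

lemma root_multiples: "\<alpha> \<in> \<Phi> \<Longrightarrow> range (\<lambda>c. c *\<^sub>R \<alpha>) \<inter> \<Phi> = {\<alpha>, - \<alpha>}"
  using root_system unfolding root_system_def by auto

lemma root_minus: "\<alpha> \<in> \<Phi> \<Longrightarrow> - \<alpha> \<in> \<Phi>"
  using root_multiples by blast

lemma root_norm_pos: "\<alpha> \<in> \<Phi> \<Longrightarrow> riesz \<alpha> \<bullet> riesz \<alpha> > 0"
  using zero_not_root riesz_eq_0 by (metis inner_gt_zero_iff)

text \<open>Essentiality puts the functional "inner product with \<open>d\<close>" into the span of
  the roots; if all roots vanish at \<open>d\<close>, so does this functional, whose value there is
  \<open>d \<bullet> d\<close>.\<close>

lemma roots_separate:
  assumes "\<And>\<alpha>. \<alpha> \<in> \<Phi> \<Longrightarrow> blinfun_apply \<alpha> d = 0"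
  shows "d = 0"
proof -
  have "blinfun_inner_left d \<in> span \<Phi>"
    using essential unfolding essential_def by simp
  then have "blinfun_apply (blinfun_inner_left d) d = 0"
    by (induction rule: span_induct_alt)
      (auto simp: blinfun.add_left blinfun.scaleR_left assms)
  then show ?thesis by simp
qed

text \<open>Both Cartan integers are positive and their product is four times a squared cosine below
  1. Hence one of them equals 1, and the corresponding reflection produces the difference up to
  sign.\<close>

lemma root_diff:
  assumes a: "\<alpha> \<in> \<Phi>" and b: "\<beta> \<in> \<Phi>" and ne: "\<alpha> \<noteq> \<beta>" and pos: "riesz \<alpha> \<bullet> riesz \<beta> > 0"
  shows "\<alpha> - \<beta> \<in> \<Phi>"
proof -
  let ?a = "riesz \<alpha>" and ?b = "riesz \<beta>"
  have pa: "?a \<bullet> ?a > 0" and pb: "?b \<bullet> ?b > 0" using a b root_norm_pos by auto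
  obtain m :: int where m: "blinfun_apply \<alpha> (coroot \<beta>) = m"
    using cartan_int[OF a b] by (auto elim: Ints_cases)
  obtain n :: int where n: "blinfun_apply \<beta> (coroot \<alpha>) = n"
    using cartan_int[OF b a] by (auto elim: Ints_cases)
  have m': "m = 2 * (?a \<bullet> ?b) / (?b \<bullet> ?b)" using m apply_coroot by metis
  have n': "n = 2 * (?a \<bullet> ?b) / (?a \<bullet> ?a)" using n apply_coroot inner_commute by metis
  have "real_of_int m > 0" "real_of_int n > 0" using m' n' pa pb pos by auto
  then have mn: "m \<ge> 1" "n \<ge> 1" by linarith+
  \<comment> \<open>Equality in Cauchy-Schwarz would make \<open>\<beta>\<close> a multiple of
    \<open>\<alpha>\<close>; the only proportional roots are \<open>\<alpha>\<close>, excluded by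
    \<open>ne\<close>, and \<open>- \<alpha>\<close>, excluded by the positive product.\<close>
  have strict: "(?a \<bullet> ?b)\<^sup>2 < (?a \<bullet> ?a) * (?b \<bullet> ?b)"
  proof (rule ccontr)
    assume "\<not> ?thesis"
    then have eq: "(?a \<bullet> ?b)\<^sup>2 = (?a \<bullet> ?a) * (?b \<bullet> ?b)"
      using Cauchy_Schwarz_ineq[of ?a ?b] by linarith
    then have "\<bar>?a \<bullet> ?b\<bar> = norm ?a * norm ?b"
      by (metis norm_eq_sqrt_inner real_sqrt_abs real_sqrt_mult)
    then have "norm ?a *\<^sub>R ?b = norm ?b *\<^sub>R ?a"
      using pos norm_cauchy_schwarz_eq by fastforce
    then have "(1 / norm ?a) *\<^sub>R (norm ?a *\<^sub>R ?b) = (1 / norm ?a) *\<^sub>R (norm ?b *\<^sub>R ?a)" by simp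
    then have "?b = (norm ?b / norm ?a) *\<^sub>R ?a" using pa by auto
    then have "\<beta> = (norm ?b / norm ?a) *\<^sub>R \<alpha>"
      by (metis riesz_scaleR riesz_inject)
    then have "\<beta> \<in> {\<alpha>, - \<alpha>}" using root_multiples[OF a] b by blast
    then have "\<beta> = - \<alpha>" using ne by auto
    then show False using pos pa by (simp add: riesz_minus)
  qed
  have "real_of_int (m * n) = 4 * ((?a \<bullet> ?b)\<^sup>2 / ((?a \<bullet> ?a) * (?b \<bullet> ?b)))"
    by (simp add: m' n' power2_eq_square)
  also have "\<dots> < 4" using strict pa pb by (simp add: divide_less_eq)
  finally have "m * n < 4" by linarith
  then have "m = 1 \<or> n = 1"
  proof -
    have "m \<ge> 2 \<Longrightarrow> n \<ge> 2 \<Longrightarrow> m * n \<ge> 2 * 2" by (rule mult_mono) auto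
    then show ?thesis using mn \<open>m * n < 4\<close> by linarith
  qed
  then show ?thesis
  proof
    assume "m = 1"
    then have "root_reflection \<beta> \<alpha> = \<alpha> - \<beta>" using m by (simp add: root_reflection_def)
    then show ?thesis using reflection_root[OF b a] by simp
  next
    assume "n = 1"
    then have "root_reflection \<alpha> \<beta> = \<beta> - \<alpha>" using n by (simp add: root_reflection_def)
    then show ?thesis using root_minus reflection_root[OF a b] by fastforce
  qed
qed

text \<open>A finite union of hyperplanes has measure zero and cannot be the whole space.\<close>

lemma generic_direction: "\<exists>d. \<forall>\<alpha>\<in>\<Phi>. blinfun_apply \<alpha> d \<noteq> 0"
proof (rule ccontr)
  assume "\<not> ?thesis"
  then have "\<exists>\<alpha>\<in>\<Phi>. riesz \<alpha> \<bullet> x = 0" for x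
    using riesz_inner by metis
  then have eq: "(\<Union>\<alpha>\<in>\<Phi>. {x. riesz \<alpha> \<bullet> x = 0}) = UNIV" by blast
  have "negligible (\<Union>\<alpha>\<in>\<Phi>. {x. riesz \<alpha> \<bullet> x = 0})"
  proof (intro negligible_Union finite_imageI finite_roots)
    fix S assume "S \<in> (\<lambda>\<alpha>. {x. riesz \<alpha> \<bullet> x = 0}) ` \<Phi>"
    then obtain \<alpha> where "\<alpha> \<in> \<Phi>" and S: "S = {x. riesz \<alpha> \<bullet> x = 0}" by blast
    then have "riesz \<alpha> \<noteq> 0" using root_norm_pos by force
    then show "negligible S" unfolding S by (intro negligible_hyperplane disjI1)
  qed
  then have "negligible (UNIV :: 'a set)" unfolding eq .
  then show False using open_not_negligible[of "UNIV :: 'a set"] by blast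
qed

text \<open>A small shift of \<open>x\<close> in a generic direction leaves every root hyperplane
  through \<open>x\<close> and reaches no other. Thus \<open>x\<close> lies in the closed alcove of
  the shifted point; the upper bounds of that alcove are the same statement for the negative
  roots.\<close>

lemma generic_near:
  "\<exists>x0. (\<forall>\<alpha>\<in>\<Phi>. blinfun_apply \<alpha> x0 \<notin> \<int>) \<and> (\<forall>\<alpha>\<in>\<Phi>. \<lfloor>blinfun_apply \<alpha> x0\<rfloor> \<le> blinfun_apply \<alpha> x)"
proof -
  obtain d where d: "\<And>\<alpha>. \<alpha> \<in> \<Phi> \<Longrightarrow> blinfun_apply \<alpha> d \<noteq> 0" using generic_direction by blast
  have ev: "\<forall>\<^sub>F e in at_right 0. \<forall>\<alpha>\<in>\<Phi>. blinfun_apply \<alpha> (x + e *\<^sub>R d) < \<lfloor>blinfun_apply \<alpha> x\<rfloor> + 1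
        \<and> blinfun_apply \<alpha> (x + e *\<^sub>R d) > \<lceil>blinfun_apply \<alpha> x\<rceil> - 1"
  proof (intro eventually_ball_finite ballI finite_roots eventually_conj)
    fix \<alpha> assume "\<alpha> \<in> \<Phi>"
    have t: "((\<lambda>e. blinfun_apply \<alpha> (x + e *\<^sub>R d)) \<longlongrightarrow> blinfun_apply \<alpha> (x + 0 *\<^sub>R d)) (at_right 0)"
      by (intro tendsto_intros)
    have "blinfun_apply \<alpha> (x + 0 *\<^sub>R d) < \<lfloor>blinfun_apply \<alpha> x\<rfloor> + 1" by simp
    from order_tendstoD(2)[OF t this]
    show "\<forall>\<^sub>F e in at_right 0. blinfun_apply \<alpha> (x + e *\<^sub>R d) < \<lfloor>blinfun_apply \<alpha> x\<rfloor> + 1" .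
    have "blinfun_apply \<alpha> (x + 0 *\<^sub>R d) > \<lceil>blinfun_apply \<alpha> x\<rceil> - 1" by simp linarith
    from order_tendstoD(1)[OF t this]
    show "\<forall>\<^sub>F e in at_right 0. blinfun_apply \<alpha> (x + e *\<^sub>R d) > \<lceil>blinfun_apply \<alpha> x\<rceil> - 1" .
  qed
  have "\<forall>\<^sub>F e::real in at_right 0. \<forall>\<alpha>\<in>\<Phi>. blinfun_apply \<alpha> (x + e *\<^sub>R d) \<noteq> blinfun_apply \<alpha> x"
    using d by (auto intro!: eventually_mono[OF eventually_at_right_less[of 0]]
        simp: blinfun.add_right blinfun.scaleR_right)
  from eventually_happens'[OF trivial_limit_at_right_real eventually_conj[OF ev this]]
  obtain e where e: "\<And>\<alpha>. \<alpha> \<in> \<Phi> \<Longrightarrow> blinfun_apply \<alpha> (x + e *\<^sub>R d) < \<lfloor>blinfun_apply \<alpha> x\<rfloor> + 1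
        \<and> blinfun_apply \<alpha> (x + e *\<^sub>R d) > \<lceil>blinfun_apply \<alpha> x\<rceil> - 1
        \<and> blinfun_apply \<alpha> (x + e *\<^sub>R d) \<noteq> blinfun_apply \<alpha> x" by blast
  show ?thesis
  proof (intro exI conjI ballI)
    fix \<alpha> assume a: "\<alpha> \<in> \<Phi>"
    show "blinfun_apply \<alpha> (x + e *\<^sub>R d) \<notin> \<int>"
    proof
      assume "blinfun_apply \<alpha> (x + e *\<^sub>R d) \<in> \<int>"
      then obtain k :: int where k: "blinfun_apply \<alpha> (x + e *\<^sub>R d) = k" by (auto elim: Ints_cases)
      then have "k \<le> \<lfloor>blinfun_apply \<alpha> x\<rfloor>" "k \<ge> \<lceil>blinfun_apply \<alpha> x\<rceil>"
        using e[OF a] by linarith+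
      then have "blinfun_apply \<alpha> x = k" by linarith
      then show False using e[OF a] k by simp
    qed
    have "\<lfloor>blinfun_apply \<alpha> (x + e *\<^sub>R d)\<rfloor> \<le> \<lfloor>blinfun_apply \<alpha> x\<rfloor>"
      using e[OF a] floor_less_iff[of "blinfun_apply \<alpha> (x + e *\<^sub>R d)" "\<lfloor>blinfun_apply \<alpha> x\<rfloor> + 1"] by linarith
    then show "\<lfloor>blinfun_apply \<alpha> (x + e *\<^sub>R d)\<rfloor> \<le> blinfun_apply \<alpha> x"
      by linarith
  qed
qed

end

section \<open>Alcoves\<close>

text \<open>\<open>S\<close> stands for the vertex set of a closed alcove and \<open>a w\<close>, at
  level \<open>\<kappa> w\<close>, for the wall opposite \<open>w\<close>. The normalised wall
  functions act as barycentric coordinates of the whole space, and no root hyperplane strictly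
  separates two vertices.\<close>

definition chamber_frame ::
    "('a::euclidean_space \<Rightarrow>\<^sub>L real) set \<Rightarrow> 'a set \<Rightarrow> ('a \<Rightarrow> ('a \<Rightarrow>\<^sub>L real)) \<Rightarrow> ('a \<Rightarrow> int) \<Rightarrow> bool" where
  "chamber_frame \<Phi> S a \<kappa> \<longleftrightarrow> finite S \<and>
     (\<forall>w\<in>S. a w \<in> \<Phi> \<and> blinfun_apply (a w) w > \<kappa> w \<and> (\<forall>v\<in>S - {w}. blinfun_apply (a w) v = \<kappa> w)) \<and>
     (\<forall>y. (\<Sum>w\<in>S. (blinfun_apply (a w) y - \<kappa> w) / (blinfun_apply (a w) w - \<kappa> w)) = 1 \<and>
          (\<Sum>w\<in>S. ((blinfun_apply (a w) y - \<kappa> w) / (blinfun_apply (a w) w - \<kappa> w)) *\<^sub>R w) = y) \<and>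
     (\<forall>\<alpha>\<in>\<Phi>. \<forall>k::int. (\<forall>w\<in>S. blinfun_apply \<alpha> w \<le> k) \<or> (\<forall>w\<in>S. blinfun_apply \<alpha> w \<ge> k))"

text \<open>The open alcove of \<open>x0\<close> is described by lower bounds alone, since an upper
  bound for a root is a lower bound for its negative. \<open>\<Delta>\<close> is an irredundant
  system of such bounds.\<close>

locale alcove = irreducible_root_system \<Phi> for \<Phi> :: "('a::euclidean_space \<Rightarrow>\<^sub>L real) set" +
  fixes x0 :: 'a and \<Delta> :: "('a \<Rightarrow>\<^sub>L real) set" and k :: "('a \<Rightarrow>\<^sub>L real) \<Rightarrow> int"
  assumes k_floor: "\<And>\<alpha>. k \<alpha> = \<lfloor>blinfun_apply \<alpha> x0\<rfloor>"
    and generic: "\<And>\<alpha>. \<alpha> \<in> \<Phi> \<Longrightarrow> blinfun_apply \<alpha> x0 \<notin> \<int>"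
    and walls_subset: "\<Delta> \<subseteq> \<Phi>"
    and walls_determine: "\<And>x \<alpha>. (\<And>\<delta>. \<delta> \<in> \<Delta> \<Longrightarrow> k \<delta> < blinfun_apply \<delta> x) \<Longrightarrow> \<alpha> \<in> \<Phi> \<Longrightarrow> k \<alpha> < blinfun_apply \<alpha> x"
    and walls_minimal: "\<And>\<delta>. \<delta> \<in> \<Delta> \<Longrightarrow>
       \<exists>x. (\<forall>\<epsilon>\<in>\<Delta> - {\<delta>}. k \<epsilon> < blinfun_apply \<epsilon> x) \<and> (\<exists>\<alpha>\<in>\<Phi>. blinfun_apply \<alpha> x \<le> k \<alpha>)"
begin

section \<open>Facets of an alcove and angles between its walls\<close>

lemma wall_root: "\<delta> \<in> \<Delta> \<Longrightarrow> \<delta> \<in> \<Phi>"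
  using walls_subset by blast

lemma finite_walls: "finite \<Delta>"
  using walls_subset finite_roots finite_subset by blast

lemma base_above: "\<alpha> \<in> \<Phi> \<Longrightarrow> k \<alpha> < blinfun_apply \<alpha> x0"
  using generic[of \<alpha>] unfolding k_floor by (metis Ints_of_int floor_correct order_le_less)

text \<open>Consecutive parallel hyperplanes are one unit apart: the lower bound for
  \<open>- \<alpha>\<close> becomes the upper bound \<open>k \<alpha> + 1\<close> for
  \<open>\<alpha>\<close>.\<close>

lemma k_minus: "k (- \<alpha>) \<ge> - k \<alpha> - 1"
  unfolding k_floor by (simp add: blinfun.minus_left) linarith

text \<open>Irredundancy gives a point \<open>p\<close> that fails only the wall
  \<open>\<delta>\<close>. The segment from \<open>p\<close> to \<open>x0\<close> meets this wall at
  parameter \<open>t < 1\<close>, where the other walls are still satisfied strictly.\<close>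

lemma facet_point:
  assumes d: "\<delta> \<in> \<Delta>"
  shows "\<exists>x. blinfun_apply \<delta> x = k \<delta> \<and> (\<forall>\<epsilon>\<in>\<Delta> - {\<delta>}. k \<epsilon> < blinfun_apply \<epsilon> x)"
proof -
  obtain p where p: "\<And>\<epsilon>. \<epsilon> \<in> \<Delta> - {\<delta>} \<Longrightarrow> k \<epsilon> < blinfun_apply \<epsilon> p"
    and np: "\<exists>\<alpha>\<in>\<Phi>. blinfun_apply \<alpha> p \<le> k \<alpha>"
    using walls_minimal[OF d] by blast
  have dp: "blinfun_apply \<delta> p \<le> k \<delta>"
  proof (rule ccontr)
    assume "\<not> ?thesis"
    then have "k \<epsilon> < blinfun_apply \<epsilon> p" if "\<epsilon> \<in> \<Delta>" for \<epsilon>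
      using p that by (cases "\<epsilon> = \<delta>") auto
    then show False using walls_determine[of p] np by force
  qed
  have d0: "k \<delta> < blinfun_apply \<delta> x0" using base_above wall_root d by blast
  define t where "t = (k \<delta> - blinfun_apply \<delta> p) / (blinfun_apply \<delta> x0 - blinfun_apply \<delta> p)"
  have t: "0 \<le> t" "t < 1" unfolding t_def using dp d0 by (auto simp: divide_less_eq)
  have val: "blinfun_apply \<epsilon> (p + t *\<^sub>R (x0 - p)) = (1 - t) * blinfun_apply \<epsilon> p + t * blinfun_apply \<epsilon> x0" for \<epsilon>
    by (simp add: blinfun.add_right blinfun.scaleR_right blinfun.diff_right algebra_simps)
  show ?thesis
  proof (intro exI conjI ballI)
    have "t * (blinfun_apply \<delta> x0 - blinfun_apply \<delta> p) = k \<delta> - blinfun_apply \<delta> p"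
      unfolding t_def using dp d0 by simp
    then show "blinfun_apply \<delta> (p + t *\<^sub>R (x0 - p)) = k \<delta>"
      unfolding val by (simp add: algebra_simps)
    fix \<epsilon> assume e: "\<epsilon> \<in> \<Delta> - {\<delta>}"
    have "(1 - t) * (blinfun_apply \<epsilon> p - k \<epsilon>) > 0" using p[OF e] t by simp
    moreover have "t * (blinfun_apply \<epsilon> x0 - k \<epsilon>) \<ge> 0" using base_above[of \<epsilon>] wall_root e t by simp
    ultimately show "k \<epsilon> < blinfun_apply \<epsilon> (p + t *\<^sub>R (x0 - p))"
      unfolding val by (simp add: algebra_simps)
  qed
qed

text \<open>The interior point \<open>x0\<close> mediates between weak and strict inequalities: all
  points of the segment from \<open>x\<close> to \<open>x0\<close>, except possibly
  \<open>x\<close>, satisfy the walls strictly, so none of them can lie on the hyperplane of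
  \<open>\<alpha>\<close>.\<close>

lemma closed_alcove:
  assumes x: "\<And>\<delta>. \<delta> \<in> \<Delta> \<Longrightarrow> k \<delta> \<le> blinfun_apply \<delta> x" and a: "\<alpha> \<in> \<Phi>"
  shows "k \<alpha> \<le> blinfun_apply \<alpha> x"
proof (rule ccontr)
  assume "\<not> ?thesis"
  then have lt: "blinfun_apply \<alpha> x < k \<alpha>" by simp
  have gt: "k \<alpha> < blinfun_apply \<alpha> x0" using base_above a by blast
  define t where "t = (k \<alpha> - blinfun_apply \<alpha> x) / (blinfun_apply \<alpha> x0 - blinfun_apply \<alpha> x)"
  have t: "0 < t" "t < 1" unfolding t_def using lt gt by (auto simp: divide_less_eq)
  have val: "blinfun_apply \<epsilon> (x + t *\<^sub>R (x0 - x)) = (1 - t) * blinfun_apply \<epsilon> x + t * blinfun_apply \<epsilon> x0" for \<epsilon>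
    by (simp add: blinfun.add_right blinfun.scaleR_right blinfun.diff_right algebra_simps)
  have "k \<alpha> < blinfun_apply \<alpha> (x + t *\<^sub>R (x0 - x))"
  proof (rule walls_determine[OF _ a])
    fix \<epsilon> assume e: "\<epsilon> \<in> \<Delta>"
    have "(1 - t) * (blinfun_apply \<epsilon> x - k \<epsilon>) \<ge> 0" using x[OF e] t by simp
    moreover have "t * (blinfun_apply \<epsilon> x0 - k \<epsilon>) > 0" using base_above[of \<epsilon>] wall_root e t by simp
    ultimately show "k \<epsilon> < blinfun_apply \<epsilon> (x + t *\<^sub>R (x0 - x))"
      unfolding val by (simp add: algebra_simps)
  qed
  moreover have "t * (blinfun_apply \<alpha> x0 - blinfun_apply \<alpha> x) = k \<alpha> - blinfun_apply \<alpha> x"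
    unfolding t_def using lt gt by simp
  ultimately show False unfolding val by (simp add: algebra_simps)
qed

text \<open>An acute angle would make \<open>\<delta> - \<epsilon>\<close> a root. A point inside
  the facet of \<open>\<delta>\<close> and one inside that of \<open>\<epsilon>\<close> bound the
  levels of this root and of its negative strictly, by opposite integers.\<close>

lemma walls_obtuse:
  assumes d: "\<delta> \<in> \<Delta>" and e: "\<epsilon> \<in> \<Delta>" and ne: "\<delta> \<noteq> \<epsilon>"
  shows "riesz \<delta> \<bullet> riesz \<epsilon> \<le> 0"
proof (rule ccontr)
  assume "\<not> ?thesis"
  then have g: "\<delta> - \<epsilon> \<in> \<Phi>" using root_diff d e ne wall_root by auto
  obtain p where p: "blinfun_apply \<delta> p = k \<delta>" "\<forall>\<eta>\<in>\<Delta> - {\<delta>}. k \<eta> < blinfun_apply \<eta> p"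
    using facet_point[OF d] by blast
  obtain q where q: "blinfun_apply \<epsilon> q = k \<epsilon>" "\<forall>\<eta>\<in>\<Delta> - {\<epsilon>}. k \<eta> < blinfun_apply \<eta> q"
    using facet_point[OF e] by blast
  have "k (\<delta> - \<epsilon>) \<le> blinfun_apply (\<delta> - \<epsilon>) p"
  proof (rule closed_alcove[OF _ g])
    fix \<eta> assume "\<eta> \<in> \<Delta>"
    then show "k \<eta> \<le> blinfun_apply \<eta> p" using p by (cases "\<eta> = \<delta>") (auto intro: less_imp_le)
  qed
  moreover have "k \<epsilon> < blinfun_apply \<epsilon> p" using p e ne by auto
  moreover have "k (- (\<delta> - \<epsilon>)) \<le> blinfun_apply (- (\<delta> - \<epsilon>)) q"
  proof (rule closed_alcove[OF _ root_minus[OF g]])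
    fix \<eta> assume "\<eta> \<in> \<Delta>"
    then show "k \<eta> \<le> blinfun_apply \<eta> q" using q by (cases "\<eta> = \<epsilon>") (auto intro: less_imp_le)
  qed
  moreover have "k \<delta> < blinfun_apply \<delta> q" using q d ne by auto
  \<comment> \<open>Strictness between integers costs 1 twice, so the two levels add up to at most
    -2, whereas \<open>k_minus\<close> gives at least -1.\<close>
  ultimately have "k (\<delta> - \<epsilon>) + k \<epsilon> < k \<delta>" "k (- (\<delta> - \<epsilon>)) + k \<delta> < k \<epsilon>"
    using p q by (simp_all add: blinfun.diff_left blinfun.minus_left)
  then show False using k_minus[of "\<delta> - \<epsilon>"] by linarith
qed

text \<open>This expresses that the alcove is bounded: a ray from \<open>x0\<close> along which no
  wall descends would stay inside, yet some root, up to sign, decreases along it down to its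
  level.\<close>

lemma descending_wall:
  assumes "d \<noteq> 0"
  shows "\<exists>\<delta>\<in>\<Delta>. blinfun_apply \<delta> d < 0"
proof (rule ccontr)
  assume neg: "\<not> ?thesis"
  obtain \<alpha> where a: "\<alpha> \<in> \<Phi>" "blinfun_apply \<alpha> d < 0"
  proof -
    obtain \<beta> where b: "\<beta> \<in> \<Phi>" "blinfun_apply \<beta> d \<noteq> 0" using roots_separate assms by blast
    then consider "blinfun_apply \<beta> d < 0" | "blinfun_apply (- \<beta>) d < 0"
      by (auto simp: blinfun.minus_left) linarith
    then show ?thesis using that b root_minus by cases blast+
  qed
  define t where "t = (k \<alpha> - blinfun_apply \<alpha> x0) / blinfun_apply \<alpha> d"
  have t: "t > 0" unfolding t_def using a base_above by (simp add: divide_neg_neg)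
  have "k \<alpha> < blinfun_apply \<alpha> (x0 + t *\<^sub>R d)"
  proof (rule walls_determine[OF _ a(1)])
    fix \<delta> assume d: "\<delta> \<in> \<Delta>"
    then have "t * blinfun_apply \<delta> d \<ge> 0" using neg t by force
    then show "k \<delta> < blinfun_apply \<delta> (x0 + t *\<^sub>R d)"
      using base_above[of \<delta>] wall_root d by (simp add: blinfun.add_right blinfun.scaleR_right)
  qed
  moreover have "t * blinfun_apply \<alpha> d = k \<alpha> - blinfun_apply \<alpha> x0" unfolding t_def using a by simp
  ultimately show False by (simp add: blinfun.add_right blinfun.scaleR_right)
qed

text \<open>Gordan's alternative: if 0 were outside the hull of the normals, a separating hyperplane
  would give a direction along which all walls ascend.\<close>

lemma wall_dependency:
  "\<exists>c. (\<forall>\<delta>\<in>\<Delta>. 0 \<le> c \<delta>) \<and> (\<exists>\<delta>\<in>\<Delta>. c \<delta> \<noteq> 0) \<and> (\<Sum>\<delta>\<in>\<Delta>. c \<delta> *\<^sub>R riesz \<delta>) = 0"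
proof -
  have "0 \<in> convex hull (riesz ` \<Delta>)"
  proof (rule ccontr)
    assume "\<not> ?thesis"
    moreover have "closed (convex hull (riesz ` \<Delta>))"
      using finite_walls by (intro compact_imp_closed compact_convex_hull finite_imp_compact) simp
    ultimately obtain d b where "d \<noteq> 0" "0 < b" and b: "\<forall>x\<in>convex hull (riesz ` \<Delta>). d \<bullet> x > b"
      using separating_hyperplane_closed_0[of "convex hull (riesz ` \<Delta>)"] convex_convex_hull by metis
    obtain \<delta> where "\<delta> \<in> \<Delta>" "blinfun_apply \<delta> d < 0" using descending_wall[OF \<open>d \<noteq> 0\<close>] by blast
    moreover from this have "d \<bullet> riesz \<delta> > b" using b by (simp add: hull_inc)
    ultimately show False using \<open>0 < b\<close> by (simp add: riesz_inner inner_commute)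
  qed
  then obtain u where u: "\<forall>x\<in>riesz ` \<Delta>. 0 \<le> u x" "sum u (riesz ` \<Delta>) = 1"
      "(\<Sum>x\<in>riesz ` \<Delta>. u x *\<^sub>R x) = 0"
    using finite_walls by (auto simp: convex_hull_finite)
  have inj: "inj_on riesz \<Delta>" by (simp add: inj_on_def riesz_inject)
  show ?thesis
  proof (intro exI conjI)
    show "\<forall>\<delta>\<in>\<Delta>. 0 \<le> (u \<circ> riesz) \<delta>" using u by simp
    show "(\<Sum>\<delta>\<in>\<Delta>. (u \<circ> riesz) \<delta> *\<^sub>R riesz \<delta>) = 0" using u(3) by (simp add: sum.reindex[OF inj])
    have "sum (u \<circ> riesz) \<Delta> = 1" using u(2) by (simp add: sum.reindex[OF inj])
    then show "\<exists>\<delta>\<in>\<Delta>. (u \<circ> riesz) \<delta> \<noteq> 0" by (metis sum.neutral zero_neq_one)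
  qed
qed


section \<open>Irreducibility and linear relations between the walls\<close>

definition mixed :: "('a \<Rightarrow>\<^sub>L real) set \<Rightarrow> ('a \<Rightarrow>\<^sub>L real) \<Rightarrow> bool" where
  "mixed I \<beta> \<longleftrightarrow> \<beta> \<in> \<Phi> \<and> (\<exists>i\<in>I. riesz \<beta> \<bullet> riesz i \<noteq> 0) \<and> (\<exists>j\<in>\<Delta> - I. riesz \<beta> \<bullet> riesz j \<noteq> 0)"

text \<open>
  A mixed root with minimal fractional part at the base point could be reflected in a wall at
  which it is not obtuse; minimality then makes it constant on that wall, although the wall
  extends in the directions of the walls of the other part.
\<close>

lemma no_mixed_root:
  assumes I: "I \<subseteq> \<Delta>" and orth: "\<And>i j. i \<in> I \<Longrightarrow> j \<in> \<Delta> - I \<Longrightarrow> riesz i \<bullet> riesz j = 0"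
  shows "\<not> mixed I \<beta>"
proof
  assume "mixed I \<beta>"
  define h where "h = (\<lambda>\<beta>. blinfun_apply \<beta> x0 - k \<beta>)"
  have fin: "finite {\<beta>. mixed I \<beta>}"
    by (rule finite_subset[OF _ finite_roots]) (auto simp: mixed_def)
  define b where "b = arg_min_on h {\<beta>. mixed I \<beta>}"
  have "b \<in> {\<beta>. mixed I \<beta>}" unfolding b_def
    using \<open>mixed I \<beta>\<close> by (intro arg_min_if_finite fin) auto
  then have b: "mixed I b" by simp
  have bmin: "h b \<le> h \<gamma>" if "mixed I \<gamma>" for \<gamma>
    unfolding b_def using that arg_min_least[OF fin, of \<gamma> h] by blast
  have broot: "b \<in> \<Phi>" using b by (simp add: mixed_def)
  \<comment> \<open>Some wall descends along \<open>- riesz b\<close>, which means that it makes an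
    acute angle with \<open>b\<close>.\<close>
  obtain \<delta> where d: "\<delta> \<in> \<Delta>" and pos: "riesz b \<bullet> riesz \<delta> > 0"
  proof -
    have "riesz b \<noteq> 0" using root_norm_pos[OF broot] by force
    then have "- riesz b \<noteq> 0" by simp
    then obtain \<delta> where "\<delta> \<in> \<Delta>" "blinfun_apply \<delta> (- riesz b) < 0" using descending_wall by blast
    then show ?thesis using that by (simp add: riesz_inner inner_commute)
  qed
  obtain m :: int where m: "blinfun_apply b (coroot \<delta>) = m"
    using cartan_int[OF broot wall_root[OF d]] by (auto elim: Ints_cases)
  have dd: "riesz \<delta> \<bullet> riesz \<delta> > 0" using root_norm_pos wall_root d by blast
  have m': "m = 2 * (riesz b \<bullet> riesz \<delta>) / (riesz \<delta> \<bullet> riesz \<delta>)" using m by (simp add: apply_coroot)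
  have "real_of_int m > 0" using m' pos dd by simp
  define b' where "b' = root_reflection \<delta> b"
  have b'root: "b' \<in> \<Phi>" unfolding b'_def using reflection_root broot wall_root d by blast
  have rb': "riesz b' = riesz b - m *\<^sub>R riesz \<delta>" unfolding b'_def riesz_reflection m ..
  have ab': "blinfun_apply b' x = blinfun_apply b x - m * blinfun_apply \<delta> x" for x
    unfolding b'_def root_reflection_def m by (simp add: blinfun.diff_left blinfun.scaleR_left)
  have b'd: "riesz b' \<bullet> riesz \<delta> < 0"
    unfolding rb' inner_diff_left using m' pos dd by simp
  \<comment> \<open>The wall \<open>j\<close> is taken from the part not containing
    \<open>\<delta>\<close>. It is orthogonal to \<open>\<delta>\<close>, so its product with
    \<open>b\<close> survives the reflection, and \<open>b'\<close> is again mixed.\<close>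
  obtain j where j: "j \<in> \<Delta>" "riesz b \<bullet> riesz j \<noteq> 0" "riesz \<delta> \<bullet> riesz j = 0" and b'mixed: "mixed I b'"
  proof (cases "\<delta> \<in> I")
    case True
    obtain j where j: "j \<in> \<Delta> - I" "riesz b \<bullet> riesz j \<noteq> 0" using b unfolding mixed_def by blast
    have "riesz \<delta> \<bullet> riesz j = 0" using orth[OF True j(1)] .
    moreover from this have "riesz b' \<bullet> riesz j \<noteq> 0" using j by (simp add: rb' inner_diff_left)
    ultimately have "mixed I b'" unfolding mixed_def
      using b'root b'd True j by (intro conjI bexI[of _ \<delta>] bexI[of _ j]) auto
    then show ?thesis using that[of j] j \<open>riesz \<delta> \<bullet> riesz j = 0\<close> by blast
  next
    case False
    obtain j where j: "j \<in> I" "riesz b \<bullet> riesz j \<noteq> 0" using b unfolding mixed_def by blast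
    have "riesz \<delta> \<bullet> riesz j = 0" using orth[OF j(1)] False d by (simp add: inner_commute)
    moreover from this have "riesz b' \<bullet> riesz j \<noteq> 0" using j by (simp add: rb' inner_diff_left)
    ultimately have "mixed I b'" unfolding mixed_def
      using b'root b'd False d j by (intro conjI bexI[of _ \<delta>] bexI[of _ j]) auto
    then show ?thesis using that[of j] j I \<open>riesz \<delta> \<bullet> riesz j = 0\<close> by blast
  qed
  \<comment> \<open>Otherwise the fractional part at \<open>x0\<close> would drop by at least
    \<open>m\<close> times the height of \<open>x0\<close> over the wall \<open>\<delta>\<close>,
    against the choice of \<open>b\<close>.\<close>
  have low: "k b' < k b - m * k \<delta>"
  proof (rule ccontr)
    assume "\<not> ?thesis"
    then have "real_of_int (k b') \<ge> real_of_int (k b - m * k \<delta>)" by linarith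
    then have "h b' \<le> h b - m * (blinfun_apply \<delta> x0 - k \<delta>)"
      unfolding h_def ab' by (simp add: algebra_simps)
    moreover have "m * (blinfun_apply \<delta> x0 - k \<delta>) > 0"
      using \<open>real_of_int m > 0\<close> base_above wall_root d by simp
    ultimately show False using bmin[OF b'mixed] by linarith
  qed
  \<comment> \<open>On the facet of \<open>\<delta>\<close> the functionals \<open>b\<close> and
    \<open>b'\<close> differ by the constant \<open>m * k \<delta>\<close>; the lower bound for
    \<open>b\<close> and the upper bound for \<open>b'\<close> then leave a single value.\<close>
  have zero: "blinfun_apply b x = k b"
    if x: "blinfun_apply \<delta> x = k \<delta>" "\<forall>\<epsilon>\<in>\<Delta> - {\<delta>}. k \<epsilon> < blinfun_apply \<epsilon> x" for x
  proof -
    have cl: "k \<eta> \<le> blinfun_apply \<eta> x" if "\<eta> \<in> \<Delta>" for \<eta>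
      using x that by (cases "\<eta> = \<delta>") (auto intro: less_imp_le)
    have "k b \<le> blinfun_apply b x" using closed_alcove[OF cl broot] .
    moreover have "k (- b') \<le> blinfun_apply (- b') x" using closed_alcove[OF cl root_minus[OF b'root]] .
    then have "blinfun_apply b' x \<le> real_of_int (k b' + 1)"
      using k_minus[of b'] by (simp add: blinfun.minus_left)
    then have "blinfun_apply b' x \<le> real_of_int (k b - m * k \<delta>)" using low by linarith
    then have "blinfun_apply b x \<le> k b" unfolding ab' x by simp
    ultimately show ?thesis by simp
  qed
  \<comment> \<open>Moving along \<open>riesz j\<close> keeps the value of \<open>\<delta>\<close>
    and, for a short way, the strict inequalities of the other walls, but it changes
    \<open>b\<close>, which was just shown to be constant on the facet.\<close>
  obtain p where p: "blinfun_apply \<delta> p = k \<delta>" "\<forall>\<eta>\<in>\<Delta> - {\<delta>}. k \<eta> < blinfun_apply \<eta> p"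
    using facet_point[OF d] by blast
  have "\<forall>\<^sub>F t in at_right 0. \<forall>\<eta>\<in>\<Delta> - {\<delta>}. k \<eta> < blinfun_apply \<eta> (p + t *\<^sub>R riesz j)"
  proof (intro eventually_ball_finite ballI)
    show "finite (\<Delta> - {\<delta>})" using finite_walls by simp
    fix \<eta> assume "\<eta> \<in> \<Delta> - {\<delta>}"
    then have "k \<eta> < blinfun_apply \<eta> (p + 0 *\<^sub>R riesz j)" using p by simp
    moreover have "((\<lambda>t. blinfun_apply \<eta> (p + t *\<^sub>R riesz j)) \<longlongrightarrow> blinfun_apply \<eta> (p + 0 *\<^sub>R riesz j)) (at_right 0)"
      by (intro tendsto_intros)
    ultimately show "\<forall>\<^sub>F t in at_right 0. k \<eta> < blinfun_apply \<eta> (p + t *\<^sub>R riesz j)"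
      using order_tendstoD(1) by blast
  qed
  then have "\<forall>\<^sub>F t in at_right 0. (\<forall>\<eta>\<in>\<Delta> - {\<delta>}. k \<eta> < blinfun_apply \<eta> (p + t *\<^sub>R riesz j)) \<and> (0::real) < t"
    using eventually_at_right_less by (rule eventually_conj)
  then obtain t :: real where t: "\<forall>\<eta>\<in>\<Delta> - {\<delta>}. k \<eta> < blinfun_apply \<eta> (p + t *\<^sub>R riesz j)" "0 < t"
    using eventually_happens'[OF trivial_limit_at_right_real] by blast
  have "blinfun_apply \<delta> (p + t *\<^sub>R riesz j) = k \<delta>"
    using p j by (simp add: riesz_inner inner_add_right)
  from zero[OF this t(1)] zero[OF p] have "t * (riesz b \<bullet> riesz j) = 0"
    by (simp add: riesz_inner inner_add_right)
  then show False using t j by simp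
qed

lemma walls_span: "span (riesz ` \<Delta>) = UNIV"
proof (rule ccontr)
  assume "\<not> ?thesis"
  then obtain d where "d \<noteq> 0" "\<forall>x\<in>span (riesz ` \<Delta>). d \<bullet> x = 0"
    using span_not_univ_subset_hyperplane[of "riesz ` \<Delta>"] by blast
  then show False using descending_wall[of d]
    by (metis image_eqI inner_commute order_less_irrefl riesz_inner span_base)
qed

text \<open>Pairing the relation with a wall of coefficient zero gives a vanishing sum of
  nonpositive terms, so such a wall is orthogonal to all walls of positive coefficient. The roots
  then split accordingly, against irreducibility.\<close>

lemma dependency_positive:
  assumes c: "\<And>\<delta>. \<delta> \<in> \<Delta> \<Longrightarrow> 0 \<le> c \<delta>" and nz: "\<delta>0 \<in> \<Delta>" "c \<delta>0 \<noteq> 0"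
    and dep: "(\<Sum>\<delta>\<in>\<Delta>. c \<delta> *\<^sub>R riesz \<delta>) = 0" and "\<delta> \<in> \<Delta>"
  shows "0 < c \<delta>"
proof (rule ccontr)
  assume not: "\<not> ?thesis"
  define I where "I = {\<delta>\<in>\<Delta>. c \<delta> > 0}"
  have I: "I \<subseteq> \<Delta>" "\<delta>0 \<in> I" "\<delta> \<in> \<Delta> - I" unfolding I_def using assms not less_le by fastforce+
  have orth: "riesz i \<bullet> riesz j = 0" if i: "i \<in> I" and j: "j \<in> \<Delta> - I" for i j
  proof -
    have nonpos: "c \<epsilon> * (riesz \<epsilon> \<bullet> riesz j) \<le> 0" if "\<epsilon> \<in> \<Delta>" for \<epsilon>
    proof (cases "\<epsilon> = j")
      case True then show ?thesis using j c[of j] unfolding I_def by auto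
    next
      case False then show ?thesis using walls_obtuse[of \<epsilon> j] that j c[of \<epsilon>]
        by (simp add: mult_nonneg_nonpos)
    qed
    have "(\<Sum>\<epsilon>\<in>\<Delta>. c \<epsilon> * (riesz \<epsilon> \<bullet> riesz j)) = (\<Sum>\<epsilon>\<in>\<Delta>. c \<epsilon> *\<^sub>R riesz \<epsilon>) \<bullet> riesz j"
      by (simp add: inner_sum_left)
    then have "(\<Sum>\<epsilon>\<in>\<Delta>. - (c \<epsilon> * (riesz \<epsilon> \<bullet> riesz j))) = 0" by (simp add: dep sum_negf)
    then have "\<forall>\<epsilon>\<in>\<Delta>. - (c \<epsilon> * (riesz \<epsilon> \<bullet> riesz j)) = 0"
      using nonpos by (subst (asm) sum_nonneg_eq_0_iff) (auto simp: finite_walls)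
    then show ?thesis using i I unfolding I_def by auto
  qed
  define \<Phi>1 where "\<Phi>1 = {\<beta>\<in>\<Phi>. \<forall>j\<in>\<Delta> - I. riesz \<beta> \<bullet> riesz j = 0}"
  define \<Phi>2 where "\<Phi>2 = {\<beta>\<in>\<Phi>. \<forall>i\<in>I. riesz \<beta> \<bullet> riesz i = 0}"
  have "\<delta>0 \<in> \<Phi>1" unfolding \<Phi>1_def using I orth wall_root nz by blast
  moreover have "\<delta> \<in> \<Phi>2" unfolding \<Phi>2_def using I orth wall_root inner_commute[of "riesz \<delta>"] by auto
  moreover have "\<Phi>1 \<union> \<Phi>2 = \<Phi>" using no_mixed_root[OF I(1) orth] unfolding mixed_def \<Phi>1_def \<Phi>2_def by blast
  moreover have "\<Phi>1 \<inter> \<Phi>2 = {}"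
  proof (rule ccontr)
    assume "\<not> ?thesis"
    then obtain \<beta> where b: "\<beta> \<in> \<Phi>" "\<forall>i\<in>\<Delta>. riesz \<beta> \<bullet> riesz i = 0" unfolding \<Phi>1_def \<Phi>2_def by blast
    then have "riesz \<beta> \<noteq> 0" using root_norm_pos by force
    then show False using descending_wall[of "riesz \<beta>"] b by (auto simp: riesz_inner inner_commute)
  qed
  moreover have "dual_inner \<beta> \<gamma> = 0" if b: "\<beta> \<in> \<Phi>1" and g: "\<gamma> \<in> \<Phi>2" for \<beta> \<gamma>
  proof -
    \<comment> \<open>A root orthogonal to the walls outside \<open>I\<close> has no component in
      their span, hence lies in the span of the walls in \<open>I\<close>.\<close>
    have "riesz \<beta> \<in> span (riesz ` I \<union> riesz ` (\<Delta> - I))"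
      using walls_span I by (metis Diff_partition UNIV_I image_Un)
    then obtain u v where uv: "riesz \<beta> = u + v" "u \<in> span (riesz ` I)" "v \<in> span (riesz ` (\<Delta> - I))"
      unfolding span_Un by auto
    have ortho_span: "x \<bullet> y = 0" if "x \<in> span A" "\<And>z. z \<in> A \<Longrightarrow> z \<bullet> y = 0" for x y and A :: "'a set"
      using that by (induction rule: span_induct_alt) (auto simp: inner_add_left)
    have uJ: "z \<bullet> u = 0" if "z \<in> riesz ` (\<Delta> - I)" for z
      using ortho_span[OF uv(2), of z] that orth by (auto simp: inner_commute)
    have "z \<bullet> v = 0" if "z \<in> riesz ` (\<Delta> - I)" for z
    proof -
      have "riesz \<beta> \<bullet> z = 0" using b that unfolding \<Phi>1_def by auto
      then show ?thesis using uJ[OF that] uv(1) by (simp add: inner_commute[of z] inner_add_left)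
    qed
    then have "v \<bullet> v = 0" using ortho_span[OF uv(3)] by blast
    then have "riesz \<beta> = u" using uv by simp
    then show ?thesis unfolding dual_inner_def
      using ortho_span[OF uv(2), of "riesz \<gamma>"] g unfolding \<Phi>2_def by (auto simp: inner_commute)
  qed
  ultimately have "\<Phi>1 \<noteq> {}" "\<Phi>2 \<noteq> {}" "\<Phi>1 \<inter> \<Phi>2 = {}" "\<Phi>1 \<union> \<Phi>2 = \<Phi>"
      "\<forall>\<alpha>\<in>\<Phi>1. \<forall>\<beta>\<in>\<Phi>2. dual_inner \<alpha> \<beta> = 0"
    by auto
  then show False
    using irreducible[unfolded irreducible_roots_def] by (metis (no_types, lifting))
qed

text \<open>Subtracting from \<open>b\<close> the largest multiple of \<open>c\<close> that leaves
  it nonnegative produces a relation with a zero coefficient; by positivity such a relation is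
  trivial.\<close>

lemma dependency_unique:
  assumes c: "\<And>\<delta>. \<delta> \<in> \<Delta> \<Longrightarrow> 0 < c \<delta>" and dep: "(\<Sum>\<delta>\<in>\<Delta>. c \<delta> *\<^sub>R riesz \<delta>) = 0"
    and b: "(\<Sum>\<delta>\<in>\<Delta>. b \<delta> *\<^sub>R riesz \<delta>) = 0" and ne: "\<Delta> \<noteq> {}"
  shows "\<exists>t. \<forall>\<delta>\<in>\<Delta>. b \<delta> = t * c \<delta>"
proof -
  define t where "t = Min ((\<lambda>\<delta>. b \<delta> / c \<delta>) ` \<Delta>)"
  have "t \<in> (\<lambda>\<delta>. b \<delta> / c \<delta>) ` \<Delta>" unfolding t_def using finite_walls ne by (intro Min_in) auto
  then obtain \<delta>1 where d1: "\<delta>1 \<in> \<Delta>" "t = b \<delta>1 / c \<delta>1" by blast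
  have ge: "b \<delta> - t * c \<delta> \<ge> 0" if "\<delta> \<in> \<Delta>" for \<delta>
  proof -
    have "t \<le> b \<delta> / c \<delta>" unfolding t_def using that finite_walls by simp
    then show ?thesis using c[OF that] by (simp add: field_simps)
  qed
  have "(\<Sum>\<delta>\<in>\<Delta>. (b \<delta> - t * c \<delta>) *\<^sub>R riesz \<delta>)
      = (\<Sum>\<delta>\<in>\<Delta>. b \<delta> *\<^sub>R riesz \<delta>) - t *\<^sub>R (\<Sum>\<delta>\<in>\<Delta>. c \<delta> *\<^sub>R riesz \<delta>)"
    by (simp add: scaleR_diff_left sum_subtractf scaleR_sum_right)
  then have dep': "(\<Sum>\<delta>\<in>\<Delta>. (b \<delta> - t * c \<delta>) *\<^sub>R riesz \<delta>) = 0" using b dep by simp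
  have "b \<delta> - t * c \<delta> = 0" if "\<delta> \<in> \<Delta>" for \<delta>
  proof (rule ccontr)
    assume "b \<delta> - t * c \<delta> \<noteq> 0"
    from dependency_positive[where c="\<lambda>\<delta>. b \<delta> - t * c \<delta>", OF ge that this dep' d1(1)]
    show False using d1 c[OF d1(1)] by simp
  qed
  then show ?thesis by (intro exI[of _ t]) simp
qed

text \<open>The walls satisfy exactly one relation up to scaling. Hence omitting any wall leaves
  independent normals, whose hyperplanes have a common point, the opposite vertex; the relation
  itself makes the rescaled wall functions sum to 1.\<close>

lemma walls_form_simplex:
  "\<exists>S a \<kappa>. chamber_frame \<Phi> S a \<kappa> \<and> (\<forall>x. (\<forall>\<alpha>\<in>\<Phi>. k \<alpha> \<le> blinfun_apply \<alpha> x) \<longrightarrow> (\<forall>w\<in>S. \<kappa> w \<le> blinfun_apply (a w) x))"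
proof -
  obtain c \<delta>0 where c0: "\<forall>\<delta>\<in>\<Delta>. 0 \<le> c \<delta>" "\<delta>0 \<in> \<Delta>" "c \<delta>0 \<noteq> 0" and dep: "(\<Sum>\<delta>\<in>\<Delta>. c \<delta> *\<^sub>R riesz \<delta>) = 0"
    using wall_dependency by blast
  have c: "0 < c \<delta>" if "\<delta> \<in> \<Delta>" for \<delta> using dependency_positive[of c \<delta>0 \<delta>] c0 dep that by blast
  have ne: "\<Delta> \<noteq> {}" using c0 by blast
  have inj: "inj_on riesz A" for A :: "('a \<Rightarrow>\<^sub>L real) set" by (simp add: inj_on_def riesz_inject)
  have "\<exists>v. \<forall>\<epsilon>\<in>\<Delta> - {\<delta>}. blinfun_apply \<epsilon> v = k \<epsilon>" if d: "\<delta> \<in> \<Delta>" for \<delta>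
  proof -
    have "independent (riesz ` (\<Delta> - {\<delta>}))"
    proof
      assume "dependent (riesz ` (\<Delta> - {\<delta>}))"
      then obtain u where u: "\<exists>v\<in>riesz ` (\<Delta> - {\<delta>}). u v \<noteq> 0" "(\<Sum>v\<in>riesz ` (\<Delta> - {\<delta>}). u v *\<^sub>R v) = 0"
        using finite_walls by (subst (asm) dependent_finite) auto
      define b where "b = (\<lambda>\<epsilon>. if \<epsilon> = \<delta> then 0 else u (riesz \<epsilon>))"
      have "(\<Sum>\<epsilon>\<in>\<Delta>. b \<epsilon> *\<^sub>R riesz \<epsilon>) = (\<Sum>\<epsilon>\<in>\<Delta> - {\<delta>}. u (riesz \<epsilon>) *\<^sub>R riesz \<epsilon>)"
        using finite_walls d by (simp add: sum.remove[of _ \<delta>] b_def)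
      also have "\<dots> = 0" using u(2) by (simp add: sum.reindex[OF inj])
      finally obtain t where t: "\<forall>\<epsilon>\<in>\<Delta>. b \<epsilon> = t * c \<epsilon>" using dependency_unique[OF c dep _ ne] by blast
      then have "t * c \<delta> = 0" using d unfolding b_def by metis
      then have "t = 0" using c[OF d] by simp
      then have "u (riesz \<epsilon>) = 0" if "\<epsilon> \<in> \<Delta> - {\<delta>}" for \<epsilon>
        using t that unfolding b_def by (metis DiffD1 DiffD2 mult_zero_left singletonI)
      then show False using u(1) by blast
    qed
    \<comment> \<open>The prescribed levels extend to a linear functional on the normals, and its
      representing vector \<open>adjoint g 1\<close> is the common point. \<open>inv_into\<close>
      recovers a wall from its normal.\<close>
    from linear_independent_extend[OF this, of "\<lambda>v. real_of_int (k (inv_into \<Phi> riesz v))"]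
    obtain g where g: "linear g" and gv: "\<And>v. v \<in> riesz ` (\<Delta> - {\<delta>}) \<Longrightarrow> g v = real_of_int (k (inv_into \<Phi> riesz v))"
      by blast
    show ?thesis
    proof (intro exI ballI)
      fix \<epsilon> assume e: "\<epsilon> \<in> \<Delta> - {\<delta>}"
      have "inv_into \<Phi> riesz (riesz \<epsilon>) = \<epsilon>" using e wall_root by (intro inv_into_f_f inj) auto
      moreover have "blinfun_apply \<epsilon> (adjoint g 1) = g (riesz \<epsilon>)"
        using adjoint_works[OF g, of "riesz \<epsilon>" 1] by (simp add: riesz_inner)
      ultimately show "blinfun_apply \<epsilon> (adjoint g 1) = k \<epsilon>" using gv[of "riesz \<epsilon>"] e by simp
    qed
  qed
  then obtain v where v: "\<And>\<delta> \<epsilon>. \<delta> \<in> \<Delta> \<Longrightarrow> \<epsilon> \<in> \<Delta> - {\<delta>} \<Longrightarrow> blinfun_apply \<epsilon> (v \<delta>) = k \<epsilon>" by metis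
  \<comment> \<open>By the relation, the weighted sum of heights over the walls is the same at every
    point. Its value at \<open>x0\<close> shows that it is positive, its value at a vertex gives the
    height over the opposite wall.\<close>
  define \<kappa>0 where "\<kappa>0 = - (\<Sum>\<delta>\<in>\<Delta>. c \<delta> * k \<delta>)"
  have total: "(\<Sum>\<delta>\<in>\<Delta>. c \<delta> * (blinfun_apply \<delta> y - k \<delta>)) = \<kappa>0" for y
  proof -
    have "(\<Sum>\<delta>\<in>\<Delta>. c \<delta> * blinfun_apply \<delta> y) = (\<Sum>\<delta>\<in>\<Delta>. c \<delta> *\<^sub>R riesz \<delta>) \<bullet> y"
      by (simp add: inner_sum_left riesz_inner)
    then show ?thesis unfolding \<kappa>0_def using dep by (simp add: right_diff_distrib sum_subtractf)
  qed
  have "\<kappa>0 > 0" unfolding total[of x0, symmetric] using finite_walls ne c base_above wall_root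
    by (intro sum_pos) auto
  have top: "c \<delta> * (blinfun_apply \<delta> (v \<delta>) - k \<delta>) = \<kappa>0" if "\<delta> \<in> \<Delta>" for \<delta>
    using total[of "v \<delta>"] that finite_walls v[OF that] by (simp add: sum.remove[of _ \<delta>])
  have above: "blinfun_apply \<delta> (v \<delta>) > k \<delta>" if "\<delta> \<in> \<Delta>" for \<delta>
    using top[OF that] \<open>\<kappa>0 > 0\<close> c[OF that] by (metis diff_gt_0_iff_gt zero_less_mult_pos)
  have vinj: "inj_on v \<Delta>"
  proof (rule inj_onI, rule ccontr)
    fix \<delta> \<epsilon> assume "\<delta> \<in> \<Delta>" "\<epsilon> \<in> \<Delta>" "v \<delta> = v \<epsilon>" "\<delta> \<noteq> \<epsilon>"
    then show False using above[of \<delta>] v[of \<epsilon> \<delta>] by simp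
  qed
  define a where "a = the_inv_into \<Delta> v"
  have av: "a (v \<delta>) = \<delta>" if "\<delta> \<in> \<Delta>" for \<delta> unfolding a_def using that vinj by (simp add: the_inv_into_f_f)
  define l where "l = (\<lambda>\<delta> y. (blinfun_apply \<delta> y - k \<delta>) / (blinfun_apply \<delta> (v \<delta>) - k \<delta>))"
  have l: "l \<delta> y = c \<delta> * (blinfun_apply \<delta> y - k \<delta>) / \<kappa>0" if "\<delta> \<in> \<Delta>" for \<delta> y
    unfolding l_def top[OF that, symmetric] using c[OF that] by simp
  have lsum: "(\<Sum>\<delta>\<in>\<Delta>. l \<delta> y) = 1" for y
    using total[of y] \<open>\<kappa>0 > 0\<close> by (simp add: l sum_divide_distrib[symmetric])
  \<comment> \<open>Every wall takes the same value at both points, whereas a nonzero difference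
    would have a descending wall.\<close>
  have lrep: "(\<Sum>\<delta>\<in>\<Delta>. l \<delta> y *\<^sub>R v \<delta>) = y" for y
  proof (rule ccontr)
    assume "\<not> ?thesis"
    then have "(\<Sum>\<delta>\<in>\<Delta>. l \<delta> y *\<^sub>R v \<delta>) - y \<noteq> 0" by simp
    then obtain \<epsilon> where e: "\<epsilon> \<in> \<Delta>" "blinfun_apply \<epsilon> ((\<Sum>\<delta>\<in>\<Delta>. l \<delta> y *\<^sub>R v \<delta>) - y) < 0"
      using descending_wall by blast
    have "blinfun_apply \<epsilon> (\<Sum>\<delta>\<in>\<Delta>. l \<delta> y *\<^sub>R v \<delta>) = (\<Sum>\<delta>\<in>\<Delta>. l \<delta> y * blinfun_apply \<epsilon> (v \<delta>))"
      by (simp add: blinfun.sum_right blinfun.scaleR_right)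
    also have "\<dots> = (\<Sum>\<delta>\<in>\<Delta>. l \<delta> y * (blinfun_apply \<epsilon> (v \<delta>) - k \<epsilon>)) + k \<epsilon>"
      using lsum[of y] by (simp add: right_diff_distrib sum_subtractf sum_distrib_right[symmetric])
    also have "(\<Sum>\<delta>\<in>\<Delta>. l \<delta> y * (blinfun_apply \<epsilon> (v \<delta>) - k \<epsilon>)) = l \<epsilon> y * (blinfun_apply \<epsilon> (v \<epsilon>) - k \<epsilon>)"
    proof -
      have "(\<Sum>\<delta>\<in>\<Delta> - {\<epsilon>}. l \<delta> y * (blinfun_apply \<epsilon> (v \<delta>) - k \<epsilon>)) = 0"
        using e(1) v by (intro sum.neutral ballI) auto
      then show ?thesis using e(1) finite_walls by (simp add: sum.remove[of _ \<epsilon>])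
    qed
    also have "\<dots> = blinfun_apply \<epsilon> y - k \<epsilon>" unfolding l_def using above[OF e(1)] by simp
    finally show False using e(2) by (simp add: blinfun.diff_right)
  qed
  have frame: "chamber_frame \<Phi> (v ` \<Delta>) a (k \<circ> a)"
    unfolding chamber_frame_def
  proof (intro conjI ballI allI)
    show "finite (v ` \<Delta>)" using finite_walls by simp
    fix w assume "w \<in> v ` \<Delta>"
    then obtain \<delta> where d: "\<delta> \<in> \<Delta>" "w = v \<delta>" by blast
    show "a w \<in> \<Phi>" "(k \<circ> a) w < blinfun_apply (a w) w"
      using d av above wall_root by simp_all
    fix w' assume "w' \<in> v ` \<Delta> - {w}"
    then show "blinfun_apply (a w) w' = (k \<circ> a) w" using d av v by auto
  next
    fix y
    show "(\<Sum>w\<in>v ` \<Delta>. (blinfun_apply (a w) y - (k \<circ> a) w) / (blinfun_apply (a w) w - (k \<circ> a) w)) = 1"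
      unfolding sum.reindex[OF vinj] using lsum[of y] by (simp add: av l_def)
    show "(\<Sum>w\<in>v ` \<Delta>. ((blinfun_apply (a w) y - (k \<circ> a) w) / (blinfun_apply (a w) w - (k \<circ> a) w)) *\<^sub>R w) = y"
      unfolding sum.reindex[OF vinj] using lrep[of y] by (simp add: av l_def)
  next
    fix \<alpha> and n :: int assume a: "\<alpha> \<in> \<Phi>"
    have cl: "k \<beta> \<le> blinfun_apply \<beta> w" if "\<beta> \<in> \<Phi>" and w: "w \<in> v ` \<Delta>" for \<beta> w
    proof (rule closed_alcove[OF _ that(1)])
      fix \<epsilon> assume "\<epsilon> \<in> \<Delta>"
      then show "k \<epsilon> \<le> blinfun_apply \<epsilon> w"
      proof -
        obtain \<delta> where "\<delta> \<in> \<Delta>" "w = v \<delta>" using w by blast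
        then show ?thesis using above[of \<delta>] v[of \<delta> \<epsilon>] \<open>\<epsilon> \<in> \<Delta>\<close> by (cases "\<epsilon> = \<delta>") auto
      qed
    qed
    \<comment> \<open>An integer is at most \<open>k \<alpha>\<close> or at least
      \<open>k \<alpha> + 1\<close>, and all vertices lie in the closed strip between these two
      levels.\<close>
    show "(\<forall>w\<in>v ` \<Delta>. blinfun_apply \<alpha> w \<le> n) \<or> (\<forall>w\<in>v ` \<Delta>. n \<le> blinfun_apply \<alpha> w)"
    proof (cases "n \<le> k \<alpha>")
      case True
      then have "n \<le> blinfun_apply \<alpha> w" if "w \<in> v ` \<Delta>" for w
        using cl[OF a that] by linarith
      then show ?thesis by blast
    next
      case False
      have "blinfun_apply \<alpha> w \<le> n" if "w \<in> v ` \<Delta>" for w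
      proof -
        have "real_of_int (k (- \<alpha>)) \<le> - blinfun_apply \<alpha> w"
          using cl[OF root_minus[OF a] that] by (simp add: blinfun.minus_left)
        then show ?thesis using k_minus[of \<alpha>] False by linarith
      qed
      then show ?thesis by blast
    qed
  qed
  show ?thesis
  proof (intro exI conjI allI impI ballI)
    show "chamber_frame \<Phi> (v ` \<Delta>) a (k \<circ> a)" by (rule frame)
    fix x w assume "\<forall>\<alpha>\<in>\<Phi>. k \<alpha> \<le> blinfun_apply \<alpha> x" "w \<in> v ` \<Delta>"
    then show "(k \<circ> a) w \<le> blinfun_apply (a w) x" using av wall_root by auto
  qed
qed

end

context irreducible_root_system
begin

text \<open>The walls are chosen as a set of roots of least cardinality that still cuts out the open
  alcove; minimality of the cardinality yields irredundancy.\<close>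

lemma chamber_frame_exists:
  "\<exists>S a \<kappa>. chamber_frame \<Phi> S a \<kappa> \<and> (\<forall>w\<in>S. \<kappa> w \<le> blinfun_apply (a w) x)"
proof -
  obtain x0 where gen: "\<And>\<alpha>. \<alpha> \<in> \<Phi> \<Longrightarrow> blinfun_apply \<alpha> x0 \<notin> \<int>"
    and near: "\<And>\<alpha>. \<alpha> \<in> \<Phi> \<Longrightarrow> \<lfloor>blinfun_apply \<alpha> x0\<rfloor> \<le> blinfun_apply \<alpha> x"
    using generic_near by blast
  define k where "k = (\<lambda>\<alpha>::'a \<Rightarrow>\<^sub>L real. \<lfloor>blinfun_apply \<alpha> x0\<rfloor>)"
  define det where "det = (\<lambda>\<Delta>. \<Delta> \<subseteq> \<Phi> \<and> (\<forall>x. (\<forall>\<delta>\<in>\<Delta>. k \<delta> < blinfun_apply \<delta> x) \<longrightarrow> (\<forall>\<alpha>\<in>\<Phi>. k \<alpha> < blinfun_apply \<alpha> x)))"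
  have "det \<Phi>" unfolding det_def by blast
  then obtain \<Delta> where D: "det \<Delta>" and min: "\<And>\<Delta>'. det \<Delta>' \<Longrightarrow> card \<Delta> \<le> card \<Delta>'"
    using ex_has_least_nat[of det \<Phi> card] by blast
  interpret alcove \<Phi> x0 \<Delta> k
  proof unfold_locales
    show "k \<alpha> = \<lfloor>blinfun_apply \<alpha> x0\<rfloor>" for \<alpha> unfolding k_def ..
    show "\<Delta> \<subseteq> \<Phi>" using D unfolding det_def by blast
    show "k \<alpha> < blinfun_apply \<alpha> x" if "\<And>\<delta>. \<delta> \<in> \<Delta> \<Longrightarrow> k \<delta> < blinfun_apply \<delta> x" "\<alpha> \<in> \<Phi>" for x \<alpha>
      using D that unfolding det_def by blast
    show "\<exists>x. (\<forall>\<epsilon>\<in>\<Delta> - {\<delta>}. k \<epsilon> < blinfun_apply \<epsilon> x) \<and> (\<exists>\<alpha>\<in>\<Phi>. blinfun_apply \<alpha> x \<le> k \<alpha>)" if d: "\<delta> \<in> \<Delta>" for \<delta>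
    proof (rule ccontr)
      assume not: "\<not> ?thesis"
      have sub: "\<Delta> \<subseteq> \<Phi>" using D unfolding det_def by blast
      then have "det (\<Delta> - {\<delta>})" using not unfolding det_def by (meson Diff_subset linorder_not_less subset_trans)
      then have "card \<Delta> \<le> card (\<Delta> - {\<delta>})" by (rule min)
      then show False using d finite_subset[OF sub finite_roots] by (meson card_Diff1_less linorder_not_less)
    qed
  qed (use gen in auto)
  show ?thesis using walls_form_simplex near unfolding k_def by blast
qed

end

section \<open>Cells and barycentric coordinates\<close>

lemma affine_coords_unique:
  fixes T :: "'a::real_vector set"
  assumes T: "finite T" "\<not> affine_dependent T"
    and s: "sum u T = sum u' T" and v: "(\<Sum>w\<in>T. u w *\<^sub>R w) = (\<Sum>w\<in>T. u' w *\<^sub>R w)" and "w \<in> T"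
  shows "u w = u' w"
proof (rule ccontr)
  assume ne: "u w \<noteq> u' w"
  have "\<exists>U. sum U T = 0 \<and> (\<exists>v\<in>T. U v \<noteq> 0) \<and> (\<Sum>v\<in>T. U v *\<^sub>R v) = 0"
    using s v ne \<open>w \<in> T\<close>
    by (intro exI[of _ "\<lambda>w. u w - u' w"]) (auto simp: sum_subtractf scaleR_diff_left)
  then show False using T affine_dependent_explicit_finite[OF T(1)] by blast
qed

text \<open>Makes the definite description in \<open>verts\<close> usable: taking closures recovers
  the hull, and the vertices are its extreme points.\<close>

lemma verts_rel_interior:
  fixes T :: "'a::euclidean_space set"
  assumes T: "finite T" "\<not> affine_dependent T"
  shows "verts (rel_interior (convex hull T)) = T"
  unfolding verts_def
proof (rule the_equality)
  show "finite T \<and> \<not> affine_dependent T \<and> rel_interior (convex hull T) = rel_interior (convex hull T)"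
    using T by simp
  fix S :: "'a set"
  assume S: "finite S \<and> \<not> affine_dependent S \<and> rel_interior (convex hull T) = rel_interior (convex hull S)"
  have cl: "closure (rel_interior (convex hull U)) = convex hull U" if "finite U" for U :: "'a set"
    using that by (simp add: convex_closure_rel_interior closure_closed compact_imp_closed
        compact_convex_hull finite_imp_compact)
  have "convex hull S = convex hull T" using cl[of S] cl[of T] S T by simp
  then have "x \<in> S \<longleftrightarrow> x \<in> T" for x
    using S T extreme_point_of_convex_hull_affine_independent by metis
  then show "S = T" by blast
qed

context irreducible_root_system
begin

text \<open>The closure of the cell of \<open>x\<close>. Upper bounds suffice because negatives of
  roots are roots, and this inequality form is easier to handle than sign patterns.\<close>

definition closed_cell :: "'a \<Rightarrow> 'a set" where
  "closed_cell x = {y. \<forall>\<alpha>\<in>\<Phi>. \<forall>k::int. blinfun_apply \<alpha> x \<le> k \<longrightarrow> blinfun_apply \<alpha> y \<le> k}"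

abbreviation cverts :: "'a \<Rightarrow> 'a set" where
  "cverts x \<equiv> verts (cell_at \<Phi> x)"

definition same_side :: "'a \<Rightarrow> 'a \<Rightarrow> bool" where
  "same_side x y \<longleftrightarrow> (\<forall>\<alpha>\<in>\<Phi>. \<forall>k::int.
     (blinfun_apply \<alpha> y < k \<longleftrightarrow> blinfun_apply \<alpha> x < k) \<and> (blinfun_apply \<alpha> y > k \<longleftrightarrow> blinfun_apply \<alpha> x > k))"

text \<open>The three sides of a hyperplane are disjoint, so any single point of a cell fixes its
  whole sign pattern.\<close>

lemma cell_eq_same_side:
  assumes "A \<in> cells \<Phi>" "x \<in> A"
  shows "A = {y. same_side x y}"
proof -
  obtain \<sigma> where A: "A = (\<Inter>(\<alpha>, k)\<in>\<Phi> \<times> UNIV. hside (\<sigma> \<alpha> k) \<alpha> k)"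
    using assms unfolding cells_def by blast
  have side: "y \<in> hside s \<alpha> k \<longleftrightarrow>
      (blinfun_apply \<alpha> y < k \<longleftrightarrow> blinfun_apply \<alpha> x < k) \<and> (blinfun_apply \<alpha> y > k \<longleftrightarrow> blinfun_apply \<alpha> x > k)"
    if "x \<in> hside s \<alpha> k" for y s \<alpha> k
    using that by (cases s) auto
  have "y \<in> A \<longleftrightarrow> same_side x y" for y
  proof -
    have "y \<in> A \<longleftrightarrow> (\<forall>\<alpha>\<in>\<Phi>. \<forall>k. y \<in> hside (\<sigma> \<alpha> k) \<alpha> k)" unfolding A by auto
    moreover have "\<forall>\<alpha>\<in>\<Phi>. \<forall>k. x \<in> hside (\<sigma> \<alpha> k) \<alpha> k" using assms(2) unfolding A by auto
    ultimately show ?thesis unfolding same_side_def by (simp add: side)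
  qed
  then show ?thesis by blast
qed

lemma same_side_cell: "{y. same_side x y} \<in> cells \<Phi>"
proof -
  define \<sigma> where "\<sigma> = (\<lambda>\<alpha> (k::int). if blinfun_apply \<alpha> x < k then Minus else if blinfun_apply \<alpha> x > k then Plus else Zero)"
  have side: "y \<in> hside (\<sigma> \<alpha> k) \<alpha> k \<longleftrightarrow>
      (blinfun_apply \<alpha> y < k \<longleftrightarrow> blinfun_apply \<alpha> x < k) \<and> (blinfun_apply \<alpha> y > k \<longleftrightarrow> blinfun_apply \<alpha> x > k)" for y \<alpha> k
    unfolding \<sigma>_def by auto
  have "{y. same_side x y} = (\<Inter>(\<alpha>, k)\<in>\<Phi> \<times> UNIV. hside (\<sigma> \<alpha> k) \<alpha> k)"
    unfolding same_side_def by (auto simp: side)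
  moreover have "x \<in> {y. same_side x y}" by (simp add: same_side_def)
  ultimately show ?thesis unfolding cells_def by blast
qed

lemma cell_at_eq: "cell_at \<Phi> x = {y. same_side x y}"
  unfolding cell_at_def
proof (rule the_equality)
  show "{y. same_side x y} \<in> cells \<Phi> \<and> x \<in> {y. same_side x y}"
    using same_side_cell by (simp add: same_side_def)
qed (use cell_eq_same_side in blast)

lemma cell_at_cell: "cell_at \<Phi> x \<in> cells \<Phi>"
  unfolding cell_at_eq by (rule same_side_cell)

lemma in_cell_at: "x \<in> cell_at \<Phi> x"
  unfolding cell_at_eq by (simp add: same_side_def)

lemma cells_eq_cell_at: "A \<in> cells \<Phi> \<Longrightarrow> x \<in> A \<Longrightarrow> A = cell_at \<Phi> x"
  unfolding cell_at_eq by (rule cell_eq_same_side)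

lemma closed_cellD: "y \<in> closed_cell x \<Longrightarrow> \<alpha> \<in> \<Phi> \<Longrightarrow> blinfun_apply \<alpha> x \<le> of_int k \<Longrightarrow> blinfun_apply \<alpha> y \<le> of_int k"
  unfolding closed_cell_def by blast

lemma closed_cellD_ge:
  assumes "y \<in> closed_cell x" "\<alpha> \<in> \<Phi>" "of_int k \<le> blinfun_apply \<alpha> x"
  shows "of_int k \<le> blinfun_apply \<alpha> y"
  using closed_cellD[OF assms(1) root_minus[OF assms(2)], of "- k"] assms(3)
  by (simp add: blinfun.minus_left)

lemma closed_cell_refl: "x \<in> closed_cell x"
  by (simp add: closed_cell_def)

lemma closed_cell_trans: "y \<in> closed_cell x \<Longrightarrow> z \<in> closed_cell y \<Longrightarrow> z \<in> closed_cell x"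
  by (simp add: closed_cell_def)

lemma closed_cell_subset: "y \<in> closed_cell x \<Longrightarrow> closed_cell y \<subseteq> closed_cell x"
  using closed_cell_trans by blast

lemma cell_at_eq_iff: "cell_at \<Phi> x = cell_at \<Phi> y \<longleftrightarrow> x \<in> closed_cell y \<and> y \<in> closed_cell x"
proof
  assume "cell_at \<Phi> x = cell_at \<Phi> y"
  then have "same_side x y" using in_cell_at[of y] unfolding cell_at_eq by auto
  then show "x \<in> closed_cell y \<and> y \<in> closed_cell x"
    unfolding same_side_def closed_cell_def by (auto simp: not_less[symmetric])
next
  assume h: "x \<in> closed_cell y \<and> y \<in> closed_cell x"
  then have "same_side x y" unfolding same_side_def
    using closed_cellD closed_cellD_ge by (metis linorder_not_less)
  then show "cell_at \<Phi> x = cell_at \<Phi> y" unfolding cell_at_eq same_side_def by auto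
qed

lemma closed_cell_convex: "convex (closed_cell x)"
proof -
  have "closed_cell x = (\<Inter>\<alpha>\<in>\<Phi>. \<Inter>k\<in>{k::int. blinfun_apply \<alpha> x \<le> k}. {y. riesz \<alpha> \<bullet> y \<le> k})"
    unfolding closed_cell_def by (auto simp: riesz_inner)
  then show ?thesis by (auto intro!: convex_INT simp: convex_halfspace_le)
qed

end

section \<open>Cells as open faces of an alcove\<close>

locale chamber = irreducible_root_system \<Phi> for \<Phi> :: "('a::euclidean_space \<Rightarrow>\<^sub>L real) set" +
  fixes S :: "'a set" and a :: "'a \<Rightarrow> ('a \<Rightarrow>\<^sub>L real)" and \<kappa> :: "'a \<Rightarrow> int"
  assumes frame: "chamber_frame \<Phi> S a \<kappa>"
begin

lemma finite_S: "finite S"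
  and wall_root: "w \<in> S \<Longrightarrow> a w \<in> \<Phi>"
  and wall_above: "w \<in> S \<Longrightarrow> \<kappa> w < blinfun_apply (a w) w"
  and wall_on: "w \<in> S \<Longrightarrow> v \<in> S \<Longrightarrow> v \<noteq> w \<Longrightarrow> blinfun_apply (a w) v = \<kappa> w"
  and one_side: "\<alpha> \<in> \<Phi> \<Longrightarrow> (\<forall>w\<in>S. blinfun_apply \<alpha> w \<le> of_int k) \<or> (\<forall>w\<in>S. blinfun_apply \<alpha> w \<ge> of_int k)"
  using frame unfolding chamber_frame_def by blast+

definition coord :: "'a \<Rightarrow> 'a \<Rightarrow> real" where
  "coord w y = (blinfun_apply (a w) y - \<kappa> w) / (blinfun_apply (a w) w - \<kappa> w)"

lemma coord_sum: "(\<Sum>w\<in>S. coord w y) = 1"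
  and coord_rep: "(\<Sum>w\<in>S. coord w y *\<^sub>R w) = y"
  using frame unfolding chamber_frame_def coord_def by blast+

lemma coord_sign:
  assumes "w \<in> S"
  shows "0 < coord w y \<longleftrightarrow> \<kappa> w < blinfun_apply (a w) y" "coord w y = 0 \<longleftrightarrow> blinfun_apply (a w) y = \<kappa> w"
    "0 \<le> coord w y \<longleftrightarrow> \<kappa> w \<le> blinfun_apply (a w) y"
  using wall_above[OF assms] unfolding coord_def by (auto simp: zero_less_divide_iff zero_le_divide_iff)

text \<open>The wall \<open>a w\<close>, shifted by its level, vanishes at all vertices except
  \<open>w\<close> and therefore reads off the coefficient of \<open>w\<close>.\<close>

lemma affine_independent: "T \<subseteq> S \<Longrightarrow> \<not> affine_dependent T"
proof -
  have "\<not> affine_dependent S"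
  proof
    assume "affine_dependent S"
    then obtain U where U: "sum U S = 0" "\<exists>v\<in>S. U v \<noteq> 0" "(\<Sum>v\<in>S. U v *\<^sub>R v) = 0"
      using affine_dependent_explicit_finite[OF finite_S] by blast
    then obtain w where w: "w \<in> S" "U w \<noteq> 0" by blast
    have "(\<Sum>v\<in>S. U v * blinfun_apply (a w) v) = blinfun_apply (a w) (\<Sum>v\<in>S. U v *\<^sub>R v)"
      by (simp add: blinfun.sum_right blinfun.scaleR_right)
    then have "(\<Sum>v\<in>S. U v * (blinfun_apply (a w) v - \<kappa> w)) = 0"
      using U by (simp add: right_diff_distrib sum_subtractf sum_distrib_right[symmetric])
    moreover have "(\<Sum>v\<in>S. U v * (blinfun_apply (a w) v - \<kappa> w))
        = (\<Sum>v\<in>S. if v = w then U w * (blinfun_apply (a w) w - \<kappa> w) else 0)"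
      using wall_on[OF w(1)] by (intro sum.cong) auto
    ultimately have "U w * (blinfun_apply (a w) w - \<kappa> w) = 0"
      using w finite_S by (simp add: sum.delta)
    then show False using w wall_above[OF w(1)] by simp
  qed
  then show "T \<subseteq> S \<Longrightarrow> \<not> affine_dependent T" using affine_independent_subset by blast
qed

context
  fixes x assumes x: "\<forall>w\<in>S. \<kappa> w \<le> blinfun_apply (a w) x"
begin

text \<open>The vertices whose opposite wall misses \<open>x\<close>; they span the smallest face of
  the alcove that contains \<open>x\<close>.\<close>

definition supp :: "'a set" where "supp = {w\<in>S. \<kappa> w < blinfun_apply (a w) x}"

lemma supp_rep: "(\<Sum>w\<in>supp. coord w y) = 1 \<and> (\<Sum>w\<in>supp. coord w y *\<^sub>R w) = y"
  if "\<And>w. w \<in> S - supp \<Longrightarrow> blinfun_apply (a w) y = \<kappa> w"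
proof -
  have sub: "supp \<subseteq> S" unfolding supp_def by blast
  have z: "\<forall>w\<in>S - supp. coord w y = 0" using that coord_sign by blast
  have "(\<Sum>w\<in>supp. coord w y) = (\<Sum>w\<in>S. coord w y)"
    using z by (intro sum.mono_neutral_left finite_S sub) auto
  moreover have "(\<Sum>w\<in>supp. coord w y *\<^sub>R w) = (\<Sum>w\<in>S. coord w y *\<^sub>R w)"
    using z by (intro sum.mono_neutral_left finite_S sub) auto
  ultimately show ?thesis using coord_sum coord_rep by simp
qed

lemma supp_facts: "supp \<subseteq> S" "finite supp" "\<not> affine_dependent supp"
    "w \<in> S - supp \<Longrightarrow> blinfun_apply (a w) x = \<kappa> w"
proof -
  show sub: "supp \<subseteq> S" unfolding supp_def by blast
  then show "finite supp" "\<not> affine_dependent supp"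
    using finite_S finite_subset affine_independent by blast+
  show "blinfun_apply (a w) x = \<kappa> w" if "w \<in> S - supp"
    using bspec[OF x, of w] that unfolding supp_def by auto
qed

text \<open>If a vertex in \<open>supp\<close> exceeded an integer bound valid at \<open>x\<close>,
  all vertices would lie on the upper side of it, and the positive weight at that vertex would push
  \<open>x\<close> above the bound. Conversely, a point of the closed cell stays on each wall
  through \<open>x\<close>, since both inequalities persist.\<close>

lemma closed_cell_eq: "closed_cell x = convex hull supp"
proof
  show "convex hull supp \<subseteq> closed_cell x"
  proof (intro hull_minimal closed_cell_convex subsetI)
    fix v assume v: "v \<in> supp"
    show "v \<in> closed_cell x" unfolding closed_cell_def
    proof (intro CollectI ballI allI impI, rule ccontr)
      fix \<alpha> and n :: int assume al: "\<alpha> \<in> \<Phi>" "blinfun_apply \<alpha> x \<le> n" "\<not> blinfun_apply \<alpha> v \<le> n"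
      then have all: "\<forall>w\<in>S. n \<le> blinfun_apply \<alpha> w" using one_side[of \<alpha> n] v supp_facts by blast
      have "blinfun_apply \<alpha> x = blinfun_apply \<alpha> (\<Sum>w\<in>S. coord w x *\<^sub>R w)" by (simp add: coord_rep)
      also have "\<dots> - n = (\<Sum>w\<in>S. coord w x * (blinfun_apply \<alpha> w - n))"
        using coord_sum[of x] by (simp add: blinfun.sum_right blinfun.scaleR_right right_diff_distrib
            sum_subtractf sum_distrib_right[symmetric])
      also have "\<dots> > 0"
      proof (rule sum_pos2[OF finite_S])
        show "v \<in> S" using v supp_facts by blast
        show "0 < coord v x * (blinfun_apply \<alpha> v - n)"
          using v al coord_sign(1)[of v x] unfolding supp_def by auto
        show "0 \<le> coord w x * (blinfun_apply \<alpha> w - n)" if "w \<in> S" for w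
          using all that x coord_sign(3)[of w x] by auto
      qed
      finally show False using al by simp
    qed
  qed
  show "closed_cell x \<subseteq> convex hull supp"
  proof
    fix y assume y: "y \<in> closed_cell x"
    have "blinfun_apply (a w) y = \<kappa> w" if "w \<in> S - supp" for w
      using closed_cellD[OF y, of "a w" "\<kappa> w"] closed_cellD_ge[OF y, of "a w" "\<kappa> w"] supp_facts(4)[OF that]
        that wall_root by force
    from supp_rep[OF this] have "(\<Sum>w\<in>supp. coord w y) = 1 \<and> (\<Sum>w\<in>supp. coord w y *\<^sub>R w) = y" by blast
    moreover have "0 \<le> coord w y" if "w \<in> supp" for w
      using closed_cellD_ge[OF y wall_root bspec[OF x]] that coord_sign(3)[of w y] supp_facts by blast
    ultimately show "y \<in> convex hull supp"
      unfolding convex_hull_finite[OF supp_facts(2)]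
      by (intro CollectI exI[of _ "\<lambda>w. coord w y"] conjI ballI) simp_all
  qed
qed

lemma cell_at_supp: "cell_at \<Phi> x = rel_interior (convex hull supp)"
proof -
  have "cell_at \<Phi> x = {y. \<exists>u. (\<forall>w\<in>supp. 0 < u w) \<and> sum u supp = 1 \<and> (\<Sum>w\<in>supp. u w *\<^sub>R w) = y}"
  proof (intro equalityI subsetI)
    fix y assume "y \<in> cell_at \<Phi> x"
    then have y: "same_side x y" by (simp add: cell_at_eq)
    have eq: "blinfun_apply (a w) y = \<kappa> w" if "w \<in> S - supp" for w
    proof -
      have "a w \<in> \<Phi>" using that wall_root by blast
      then have "\<not> blinfun_apply (a w) y < \<kappa> w" "\<not> blinfun_apply (a w) y > \<kappa> w"
        using y supp_facts(4)[OF that] unfolding same_side_def by auto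
      then show ?thesis by linarith
    qed
    have "0 < coord w y" if "w \<in> supp" for w
      using y that wall_root[of w] coord_sign(1)[of w y] unfolding same_side_def supp_def by blast
    with supp_rep[OF eq] show "y \<in> {y. \<exists>u. (\<forall>w\<in>supp. 0 < u w) \<and> sum u supp = 1 \<and> (\<Sum>w\<in>supp. u w *\<^sub>R w) = y}"
      by (intro CollectI exI[of _ "\<lambda>w. coord w y"] conjI ballI) simp_all
  next
    fix y assume "y \<in> {y. \<exists>u. (\<forall>w\<in>supp. 0 < u w) \<and> sum u supp = 1 \<and> (\<Sum>w\<in>supp. u w *\<^sub>R w) = y}"
    then obtain u where u: "\<forall>w\<in>supp. 0 < u w" "sum u supp = 1" "(\<Sum>w\<in>supp. u w *\<^sub>R w) = y" by blast
    have val: "blinfun_apply \<alpha> y - n = (\<Sum>w\<in>supp. u w * (blinfun_apply \<alpha> w - n))" for \<alpha> and n :: int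
      using u(2) unfolding u(3)[symmetric] by (simp add: blinfun.sum_right blinfun.scaleR_right right_diff_distrib
            sum_subtractf sum_distrib_right[symmetric])
    have "y \<in> closed_cell x" unfolding closed_cell_eq convex_hull_finite[OF supp_facts(2)]
      using u by (intro CollectI exI[of _ u] conjI ballI) (simp_all add: less_imp_le)
    \<comment> \<open>If \<open>y\<close> satisfies a bound that \<open>x\<close> violates, the
      vertices in \<open>supp\<close> lie weakly above it. Positive weights then put all of them on
      the hyperplane, and \<open>x\<close> with them.\<close>
    moreover have "x \<in> closed_cell y"
      unfolding closed_cell_def
    proof (intro CollectI ballI allI impI, rule ccontr)
      fix \<alpha> and n :: int assume al: "\<alpha> \<in> \<Phi>" "blinfun_apply \<alpha> y \<le> n" "\<not> blinfun_apply \<alpha> x \<le> n"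
      then have n: "n \<le> blinfun_apply \<alpha> w" if "w \<in> supp" for w
        using that closed_cellD_ge[of w x \<alpha> n] closed_cell_eq hull_inc[OF that] by fastforce
      have "blinfun_apply \<alpha> w - n = 0" if "w \<in> supp" for w
      proof (rule ccontr)
        assume "blinfun_apply \<alpha> w - n \<noteq> 0"
        then have "0 < (\<Sum>w\<in>supp. u w * (blinfun_apply \<alpha> w - n))"
          using n u that by (intro sum_pos2[OF supp_facts(2), of w]) (auto simp: less_le)
        then show False using al(2) unfolding val[symmetric] by linarith
      qed
      moreover have "blinfun_apply \<alpha> x - n = (\<Sum>w\<in>supp. coord w x * (blinfun_apply \<alpha> w - n))"
      proof -
        have r: "(\<Sum>w\<in>supp. coord w x) = 1" "(\<Sum>w\<in>supp. coord w x *\<^sub>R w) = x"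
          using supp_rep[OF supp_facts(4)] by auto
        have "blinfun_apply \<alpha> x = (\<Sum>w\<in>supp. coord w x * blinfun_apply \<alpha> w)"
          by (subst r(2)[symmetric]) (simp add: blinfun.sum_right blinfun.scaleR_right)
        then show ?thesis using r(1) by (simp add: right_diff_distrib sum_subtractf sum_distrib_right[symmetric])
      qed
      ultimately show False using al by simp
    qed
    ultimately have "cell_at \<Phi> x = cell_at \<Phi> y" using cell_at_eq_iff by blast
    then show "y \<in> cell_at \<Phi> x" using in_cell_at by simp
  qed
  then show ?thesis using rel_interior_convex_hull_explicit[OF supp_facts(3)] by simp
qed

lemma cverts_eq_supp: "cverts x = supp"
  unfolding cell_at_supp by (rule verts_rel_interior[OF supp_facts(2,3)])

end

end

context irreducible_root_system
begin

lemma chamber_at: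
  obtains S a \<kappa> where "chamber \<Phi> S a \<kappa>" "\<forall>w\<in>S. \<kappa> w \<le> blinfun_apply (a w) x"
    "cverts x = {w\<in>S. \<kappa> w < blinfun_apply (a w) x}"
proof -
  obtain S a \<kappa> where f: "chamber_frame \<Phi> S a \<kappa>" and x: "\<forall>w\<in>S. \<kappa> w \<le> blinfun_apply (a w) x"
    using chamber_frame_exists by blast
  interpret C: chamber \<Phi> S a \<kappa> by unfold_locales (rule f)
  show ?thesis using that[OF C.chamber_axioms x] C.cverts_eq_supp[OF x] C.supp_def[OF x] by simp
qed

lemma cverts_facts: "finite (cverts x)" "\<not> affine_dependent (cverts x)"
    "closed_cell x = convex hull (cverts x)" "cell_at \<Phi> x = rel_interior (convex hull (cverts x))"
proof -
  obtain S a \<kappa> where C: "chamber \<Phi> S a \<kappa>" and x: "\<forall>w\<in>S. \<kappa> w \<le> blinfun_apply (a w) x"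
    and vx: "cverts x = {w\<in>S. \<kappa> w < blinfun_apply (a w) x}"
    by (rule chamber_at[of x])
  interpret C: chamber \<Phi> S a \<kappa> by (rule C)
  have e: "cverts x = C.supp x" using C.cverts_eq_supp[OF x] .
  show "finite (cverts x)" "\<not> affine_dependent (cverts x)" "closed_cell x = convex hull (cverts x)"
    "cell_at \<Phi> x = rel_interior (convex hull (cverts x))"
    unfolding e using C.supp_facts[OF x] C.closed_cell_eq[OF x] C.cell_at_supp[OF x] by auto
qed

lemma cverts_nonempty: "cverts x \<noteq> {}"
  using cverts_facts(3)[of x] closed_cell_refl[of x] by auto

lemma closed_cell_closed: "closed (closed_cell x)"
  unfolding cverts_facts(3) by (intro compact_imp_closed compact_convex_hull finite_imp_compact cverts_facts)

lemma closure_cell_at: "closure (cell_at \<Phi> x) = closed_cell x"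
  using closed_cell_closed[of x]
  by (subst cverts_facts(4)) (simp add: convex_closure_rel_interior closure_closed cverts_facts(3))

lemma cverts_in_closed_cell: "v \<in> cverts x \<Longrightarrow> v \<in> closed_cell x"
  unfolding cverts_facts(3) by (rule hull_inc)

text \<open>One alcove serves all points of a closed cell, so their vertex sets can be compared
  inside the same \<open>S\<close>.\<close>

lemma chamber_closed_cell:
  assumes C: "chamber \<Phi> S a \<kappa>" and x: "\<forall>w\<in>S. \<kappa> w \<le> blinfun_apply (a w) x" and y: "y \<in> closed_cell x"
  shows "\<forall>w\<in>S. \<kappa> w \<le> blinfun_apply (a w) y" "cverts y = {w\<in>S. \<kappa> w < blinfun_apply (a w) y}"
proof -
  interpret C: chamber \<Phi> S a \<kappa> by (rule C)
  show *: "\<forall>w\<in>S. \<kappa> w \<le> blinfun_apply (a w) y"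
    using closed_cellD_ge[OF y C.wall_root bspec[OF x]] by blast
  show "cverts y = {w\<in>S. \<kappa> w < blinfun_apply (a w) y}"
    unfolding C.cverts_eq_supp[OF *] C.supp_def[OF *] ..
qed

lemma cverts_mono:
  assumes y: "y \<in> closed_cell x"
  shows "cverts y \<subseteq> cverts x"
proof -
  obtain S a \<kappa> where C: "chamber \<Phi> S a \<kappa>" and x: "\<forall>w\<in>S. \<kappa> w \<le> blinfun_apply (a w) x"
    and vx: "cverts x = {w\<in>S. \<kappa> w < blinfun_apply (a w) x}" by (rule chamber_at[of x])
  interpret C: chamber \<Phi> S a \<kappa> by (rule C)
  have "\<kappa> w < blinfun_apply (a w) x" if "w \<in> S" "\<kappa> w < blinfun_apply (a w) y" for w
    using closed_cellD[OF y C.wall_root[OF that(1)], of "\<kappa> w"] that by linarith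
  then show ?thesis unfolding vx chamber_closed_cell(2)[OF C x y] by blast
qed

lemma cverts_vertex:
  assumes v: "v \<in> cverts x"
  shows "cell_at \<Phi> v = {v}" "cverts v = {v}" "v \<in> cvertices \<Phi>"
proof -
  obtain S a \<kappa> where C: "chamber \<Phi> S a \<kappa>" and x: "\<forall>w\<in>S. \<kappa> w \<le> blinfun_apply (a w) x"
    and vx: "cverts x = {w\<in>S. \<kappa> w < blinfun_apply (a w) x}" by (rule chamber_at[of x])
  interpret C: chamber \<Phi> S a \<kappa> by (rule C)
  have "v \<in> S" using v vx by blast
  show vv: "cverts v = {v}"
    unfolding chamber_closed_cell(2)[OF C x cverts_in_closed_cell[OF v]]
    using \<open>v \<in> S\<close> C.wall_above[of v] C.wall_on[of _ v] by force
  show "cell_at \<Phi> v = {v}" using vv by (subst cverts_facts(4)[of v]) simp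
  then show "v \<in> cvertices \<Phi>" unfolding cvertices_def using cell_at_cell[of v] by simp
qed

lemma cvertices_cverts: "v \<in> cvertices \<Phi> \<Longrightarrow> cverts v = {v}"
proof -
  assume "v \<in> cvertices \<Phi>"
  then have "cell_at \<Phi> v = {v}" unfolding cvertices_def using cells_eq_cell_at[of "{v}" v] by simp
  then show ?thesis using verts_rel_interior[of "{v}"] by simp
qed

lemma cverts_iff: "v \<in> cverts x \<longleftrightarrow> v \<in> cvertices \<Phi> \<and> v \<in> closed_cell x"
  using cverts_vertex(3) cverts_in_closed_cell cvertices_cverts cverts_mono by blast

lemma cvertices_inject:
  assumes "v \<in> cvertices \<Phi>" "w \<in> closed_cell v"
  shows "w = v"
  using assms cvertices_cverts[of v] cverts_facts(3)[of v] by simp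

lemma facet_wall:
  assumes v: "v \<in> cverts x"
  obtains \<alpha> k where "\<alpha> \<in> \<Phi>" "\<And>f. f \<in> cverts x - {v} \<Longrightarrow> blinfun_apply \<alpha> f = of_int k" "blinfun_apply \<alpha> v > of_int k"
proof -
  obtain S a \<kappa> where C: "chamber \<Phi> S a \<kappa>" and x: "\<forall>w\<in>S. \<kappa> w \<le> blinfun_apply (a w) x"
    and vx: "cverts x = {w\<in>S. \<kappa> w < blinfun_apply (a w) x}"
    by (rule chamber_at[of x])
  interpret C: chamber \<Phi> S a \<kappa> by (rule C)
  have "v \<in> S" "cverts x \<subseteq> S" using v vx by auto
  then show ?thesis using that[of "a v" "\<kappa> v"] C.wall_root C.wall_on C.wall_above by (metis DiffD1 DiffD2 singletonI subsetD)
qed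

text \<open>Among the alcove walls containing the cell one must miss \<open>y\<close>, since
  otherwise the coordinates of \<open>y\<close> would be supported on \<open>cverts x\<close>. This
  deals with cells that are not of full dimension.\<close>

lemma flat_wall:
  assumes y: "y \<notin> affine hull (cverts x)"
  obtains \<alpha> k where "\<alpha> \<in> \<Phi>" "\<And>f. f \<in> cverts x \<Longrightarrow> blinfun_apply \<alpha> f = of_int k" "blinfun_apply \<alpha> y \<noteq> of_int k"
proof -
  obtain S a \<kappa> where C: "chamber \<Phi> S a \<kappa>" and x: "\<forall>w\<in>S. \<kappa> w \<le> blinfun_apply (a w) x"
    and vx: "cverts x = {w\<in>S. \<kappa> w < blinfun_apply (a w) x}" by (rule chamber_at[of x])
  interpret C: chamber \<Phi> S a \<kappa> by (rule C)
  have sub: "cverts x \<subseteq> S" using vx by auto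
  have "\<exists>w\<in>S - cverts x. blinfun_apply (a w) y \<noteq> \<kappa> w"
  proof (rule ccontr)
    assume "\<not> ?thesis"
    then have z: "\<forall>w\<in>S - cverts x. C.coord w y = 0" using C.coord_sign by blast
    have "(\<Sum>w\<in>cverts x. C.coord w y) = (\<Sum>w\<in>S. C.coord w y)"
      using z by (intro sum.mono_neutral_left C.finite_S sub) auto
    moreover have "(\<Sum>w\<in>cverts x. C.coord w y *\<^sub>R w) = (\<Sum>w\<in>S. C.coord w y *\<^sub>R w)"
      using z by (intro sum.mono_neutral_left C.finite_S sub) auto
    ultimately have "y \<in> affine hull (cverts x)"
      unfolding affine_hull_finite[OF cverts_facts(1)]
      by (intro CollectI exI[of _ "\<lambda>w. C.coord w y"]) (simp add: C.coord_sum C.coord_rep)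
    then show False using y by blast
  qed
  then obtain w where w: "w \<in> S - cverts x" "blinfun_apply (a w) y \<noteq> \<kappa> w" by blast
  show ?thesis
  proof (rule that[of "a w" "\<kappa> w"])
    show "a w \<in> \<Phi>" "blinfun_apply (a w) y \<noteq> of_int (\<kappa> w)" using w C.wall_root by auto
    fix f assume "f \<in> cverts x"
    then show "blinfun_apply (a w) f = of_int (\<kappa> w)" using C.wall_on[of w f] w sub by blast
  qed
qed

section \<open>Barycentric coordinates and values of the Lovasz extension\<close>

lemma bary_ex1: "\<exists>!l. (\<forall>v. 0 \<le> l v) \<and> {v. l v \<noteq> 0} = cverts x \<and> (\<Sum>v\<in>cverts x. l v) = (1::real) \<and> (\<Sum>v\<in>cverts x. l v *\<^sub>R v) = x"
proof -
  have "x \<in> rel_interior (convex hull (cverts x))"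
    using in_cell_at[of x] cverts_facts(4)[of x] by argo
  then obtain u where u: "\<And>w. w \<in> cverts x \<Longrightarrow> 0 < u w" "sum u (cverts x) = 1" "(\<Sum>w\<in>cverts x. u w *\<^sub>R w) = x"
    unfolding rel_interior_convex_hull_explicit[OF cverts_facts(2)] by blast
  define l where "l = (\<lambda>v. if v \<in> cverts x then u v else 0)"
  have s1: "sum l (cverts x) = sum u (cverts x)" unfolding l_def by (intro sum.cong) auto
  have s2: "(\<Sum>w\<in>cverts x. l w *\<^sub>R w) = (\<Sum>w\<in>cverts x. u w *\<^sub>R w)" unfolding l_def by (intro sum.cong) auto
  show ?thesis
  proof (rule ex1I[of _ l])
    show "(\<forall>v. 0 \<le> l v) \<and> {v. l v \<noteq> 0} = cverts x \<and> sum l (cverts x) = 1 \<and> (\<Sum>v\<in>cverts x. l v *\<^sub>R v) = x"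
    proof (intro conjI allI)
      show "0 \<le> l v" for v unfolding l_def using u(1)[of v] by auto
      show "{v. l v \<noteq> 0} = cverts x" unfolding l_def using u(1) by force
    qed (use s1 s2 u in auto)
    fix m assume m: "(\<forall>v. 0 \<le> m v) \<and> {v. m v \<noteq> 0} = cverts x \<and> sum m (cverts x) = 1 \<and> (\<Sum>v\<in>cverts x. m v *\<^sub>R v) = x"
    show "m = l"
    proof
      fix v show "m v = l v"
      proof (cases "v \<in> cverts x")
        case True
        then show ?thesis
          using affine_coords_unique[OF cverts_facts(1,2), of m x l v] m s1 s2 u by simp
      next
        case False then show ?thesis using m by (auto simp: l_def)
      qed
    qed
  qed
qed

lemma bary_facts: "0 \<le> bary \<Phi> x v" "bary \<Phi> x v \<noteq> 0 \<longleftrightarrow> v \<in> cverts x"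
    "(\<Sum>v\<in>cverts x. bary \<Phi> x v) = 1" "(\<Sum>v\<in>cverts x. bary \<Phi> x v *\<^sub>R v) = x"
  using theI'[OF bary_ex1[of x]] unfolding bary_def[symmetric] by blast+

lemma bary_pos: "v \<in> cverts x \<Longrightarrow> 0 < bary \<Phi> x v"
  using bary_facts(1,2)[of x v] by linarith

lemma bary_apply: "(\<Sum>v\<in>cverts x. bary \<Phi> x v * blinfun_apply p v) = blinfun_apply p x"
  using arg_cong[OF bary_facts(4)[of x], of "blinfun_apply p"]
  by (simp add: blinfun.sum_right blinfun.scaleR_right)

lemma bary_unique:
  assumes W: "W \<subseteq> cverts y" and l: "\<And>w. w \<in> W \<Longrightarrow> 0 \<le> l w" "sum l W = 1" "(\<Sum>w\<in>W. l w *\<^sub>R w) = x"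
  shows "(\<Sum>v\<in>cverts x. bary \<Phi> x v * g v) = (\<Sum>w\<in>W. l w * g w)" "cverts x \<subseteq> W" "x \<in> closed_cell y"
proof -
  let ?V = "cverts y"
  have fW: "finite W" using W finite_subset cverts_facts(1) by blast
  have xW: "x \<in> convex hull W" unfolding convex_hull_finite[OF fW]
    using l by (intro CollectI exI[of _ l]) simp
  then show xy: "x \<in> closed_cell y" unfolding cverts_facts(3) using hull_mono[OF W] by blast
  have sub: "cverts x \<subseteq> ?V" by (rule cverts_mono[OF xy])
  define m where "m = (\<lambda>w. if w \<in> W then l w else 0)"
  have ext: "(\<Sum>w\<in>W. l w *\<^sub>R h w) = (\<Sum>w\<in>?V. m w *\<^sub>R h w)" for h :: "'a \<Rightarrow> 'b::real_vector"
    unfolding m_def using W by (intro sum.mono_neutral_cong_left cverts_facts) auto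
  have ext': "(\<Sum>w\<in>cverts x. bary \<Phi> x w *\<^sub>R h w) = (\<Sum>w\<in>?V. bary \<Phi> x w *\<^sub>R h w)" for h :: "'a \<Rightarrow> 'b::real_vector"
    using sub bary_facts(2)[of x] by (intro sum.mono_neutral_cong_left cverts_facts) auto
  have eq: "bary \<Phi> x w = m w" if "w \<in> ?V" for w
  proof (rule affine_coords_unique[OF cverts_facts(1,2) _ _ that])
    show "sum (bary \<Phi> x) ?V = sum m ?V"
      using ext[of "\<lambda>_. 1::real"] ext'[of "\<lambda>_. 1::real"] l(2) bary_facts(3)[of x] by simp
    show "(\<Sum>w\<in>?V. bary \<Phi> x w *\<^sub>R w) = (\<Sum>w\<in>?V. m w *\<^sub>R w)"
      using ext[of "\<lambda>w. w"] ext'[of "\<lambda>w. w"] l(3) bary_facts(4)[of x] by simp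
  qed
  show "cverts x \<subseteq> W"
  proof
    fix v assume v: "v \<in> cverts x"
    then have "m v \<noteq> 0" using eq[of v] sub bary_facts(2)[of x v] by auto
    then show "v \<in> W" unfolding m_def by (auto split: if_splits)
  qed
  show "(\<Sum>v\<in>cverts x. bary \<Phi> x v * g v) = (\<Sum>w\<in>W. l w * g w)"
    using ext[of g] ext'[of g] eq by simp
qed

lemma lovasz_finite:
  assumes "\<And>v. v \<in> cverts x \<Longrightarrow> f v = ereal (g v)"
  shows "lovasz \<Phi> f x = ereal (\<Sum>v\<in>cverts x. bary \<Phi> x v * g v)"
  unfolding lovasz_def sum_ereal[symmetric] using assms by (intro sum.cong) auto

lemma lovasz_infinite:
  assumes "v \<in> cverts x" "f v = \<infinity>" "\<And>w. w \<in> cverts x \<Longrightarrow> f w \<noteq> -\<infinity>"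
  shows "lovasz \<Phi> f x = \<infinity>"
proof -
  have "ereal (bary \<Phi> x v) * f v = \<infinity>" using bary_pos[OF assms(1)] assms(2) by simp
  then show ?thesis unfolding lovasz_def using assms(1) cverts_facts(1)[of x]
    by (subst sum_Pinfty) blast
qed

lemma lovasz_vertex: "v \<in> cvertices \<Phi> \<Longrightarrow> lovasz \<Phi> f v = f v"
  unfolding lovasz_def cvertices_cverts using bary_facts(3)[of v]
  by (simp add: cvertices_cverts one_ereal_def[symmetric])

end

section \<open>Convex unions of cells\<close>

context irreducible_root_system
begin

section \<open>Root hulls, maximal cells and separating hyperplanes\<close>

definition cell_closed :: "'a set \<Rightarrow> bool" where
  "cell_closed K \<longleftrightarrow> (\<forall>x\<in>K. closed_cell x \<subseteq> K)"

definition root_hull :: "'a set \<Rightarrow> 'a set" where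
  "root_hull K = {y. \<forall>\<alpha>\<in>\<Phi>. \<forall>k::int. (\<forall>x\<in>K. blinfun_apply \<alpha> x \<le> k) \<longrightarrow> blinfun_apply \<alpha> y \<le> k}"

text \<open>Maximality by the number of vertices, that is, by dimension: it makes existence
  immediate and bounds the cells met on a walk.\<close>

definition maximal_in :: "'a set \<Rightarrow> 'a \<Rightarrow> bool" where
  "maximal_in K x \<longleftrightarrow> x \<in> K \<and> (\<forall>y\<in>K. card (cverts y) \<le> card (cverts x))"

text \<open>Only the orientation with \<open>x\<close> on the lower side is listed; the other one
  occurs through \<open>- \<alpha>\<close>. The size of this set is the measure that decreases on a
  walk towards \<open>y\<close>.\<close>

definition sep :: "'a \<Rightarrow> 'a \<Rightarrow> (('a \<Rightarrow>\<^sub>L real) \<times> int) set" where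
  "sep x y = {(\<alpha>, k). \<alpha> \<in> \<Phi> \<and> blinfun_apply \<alpha> x < k \<and> k < blinfun_apply \<alpha> y}"

lemma finite_sep: "finite (sep x y)"
proof -
  have "sep x y \<subseteq> (SIGMA \<alpha>:\<Phi>. {\<lfloor>blinfun_apply \<alpha> x\<rfloor>..\<lceil>blinfun_apply \<alpha> y\<rceil>})"
    unfolding sep_def by (auto simp: floor_le_iff le_ceiling_iff)
  then show ?thesis using finite_roots by (auto intro: finite_subset)
qed

lemma subset_root_hull: "K \<subseteq> root_hull K"
  unfolding root_hull_def by blast

lemma card_cverts_le: "card (cverts x) \<le> DIM('a) + 1"
  using aff_dim_affine_independent[OF cverts_facts(2)[of x]] aff_dim_le_DIM[of "cverts x"] by linarith

lemma maximal_exists: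
  assumes "K \<noteq> {}"
  shows "\<exists>x. maximal_in K x"
proof -
  obtain x0 where "x0 \<in> K" using assms by blast
  then show ?thesis
    using ex_has_greatest_nat[of "\<lambda>x. x \<in> K" x0 "\<lambda>x. card (cverts x)" "DIM('a) + 2"] card_cverts_le
    unfolding maximal_in_def by (metis add_2_eq_Suc' le_imp_less_Suc add.commute plus_1_eq_Suc add_Suc_right)
qed

text \<open>After a short move a root value still exceeds the largest integer strictly below its
  value at \<open>x\<close>, so every integer upper bound valid after the move was already valid at
  \<open>x\<close>.\<close>

lemma germ: "\<exists>e. 0 < e \<and> e < 1 \<and> x \<in> closed_cell (x + e *\<^sub>R (w - x))"
proof -
  have ev: "\<forall>\<^sub>F e in at_right 0. \<forall>\<alpha>\<in>\<Phi>. blinfun_apply \<alpha> (x + e *\<^sub>R (w - x)) > \<lceil>blinfun_apply \<alpha> x\<rceil> - 1"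
  proof (intro eventually_ball_finite ballI finite_roots)
    fix \<alpha> assume "\<alpha> \<in> \<Phi>"
    have t: "((\<lambda>e. blinfun_apply \<alpha> (x + e *\<^sub>R (w - x))) \<longlongrightarrow> blinfun_apply \<alpha> (x + 0 *\<^sub>R (w - x))) (at_right 0)"
      by (intro tendsto_intros)
    have "blinfun_apply \<alpha> (x + 0 *\<^sub>R (w - x)) > \<lceil>blinfun_apply \<alpha> x\<rceil> - 1" by simp linarith
    from order_tendstoD(1)[OF t this]
    show "\<forall>\<^sub>F e in at_right 0. blinfun_apply \<alpha> (x + e *\<^sub>R (w - x)) > \<lceil>blinfun_apply \<alpha> x\<rceil> - 1" .
  qed
  have "\<forall>\<^sub>F e in at_right 0. (\<forall>\<alpha>\<in>\<Phi>. blinfun_apply \<alpha> (x + e *\<^sub>R (w - x)) > \<lceil>blinfun_apply \<alpha> x\<rceil> - 1) \<and> (0::real) < e \<and> e < 1"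
    by (intro eventually_conj ev eventually_at_right_less eventually_at_right_real[of 0 1, THEN eventually_mono]) auto
  then obtain e :: real where e: "\<forall>\<alpha>\<in>\<Phi>. blinfun_apply \<alpha> (x + e *\<^sub>R (w - x)) > \<lceil>blinfun_apply \<alpha> x\<rceil> - 1" "0 < e" "e < 1"
    using eventually_happens'[OF trivial_limit_at_right_real] by blast
  have "x \<in> closed_cell (x + e *\<^sub>R (w - x))" unfolding closed_cell_def
  proof (intro CollectI ballI allI impI)
    fix \<alpha> and k :: int assume "\<alpha> \<in> \<Phi>" "blinfun_apply \<alpha> (x + e *\<^sub>R (w - x)) \<le> k"
    then have "\<lceil>blinfun_apply \<alpha> x\<rceil> - 1 < k" using e(1) by force
    then show "blinfun_apply \<alpha> x \<le> k" by linarith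
  qed
  then show ?thesis using e by blast
qed

lemma segment_in_convex:
  assumes "convex K" "x \<in> K" "w \<in> K" "0 \<le> e" "e \<le> (1::real)"
  shows "x + e *\<^sub>R (w - x) \<in> K"
  using convexD_alt[OF assms] by (simp add: algebra_simps)

text \<open>Near \<open>x\<close>, the segment to \<open>w\<close> meets a cell of \<open>K\<close>
  that has the cell of \<open>x\<close> as a face. Maximality makes the two vertex sets equal, and
  the line through both points contains \<open>w\<close>.\<close>

lemma maximal_affine_hull:
  assumes K: "convex K" and x: "maximal_in K x" and w: "w \<in> K"
  shows "w \<in> affine hull (cverts x)"
proof -
  obtain e where e: "0 < e" "e < 1" "x \<in> closed_cell (x + e *\<^sub>R (w - x))" using germ by blast
  let ?y = "x + e *\<^sub>R (w - x)"
  have "?y \<in> K" using segment_in_convex[OF K _ w] x e unfolding maximal_in_def by auto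
  then have "card (cverts ?y) \<le> card (cverts x)" using x unfolding maximal_in_def by blast
  then have eq: "cverts x = cverts ?y"
    using cverts_mono[OF e(3)] cverts_facts(1) card_seteq by metis
  have in_hull: "z \<in> affine hull (cverts z)" for z
    using closed_cell_refl[of z] cverts_facts(3)[of z] convex_hull_subset_affine_hull by blast
  have "(1 - 1/e) *\<^sub>R x + (1/e) *\<^sub>R ?y \<in> affine hull (cverts x)"
    using in_hull[of ?y] unfolding eq[symmetric]
    by (intro mem_affine affine_affine_hull in_hull) auto
  also have "(1 - 1/e) *\<^sub>R x + (1/e) *\<^sub>R ?y = w" using e by (simp add: algebra_simps)
  finally show ?thesis .
qed

text \<open>A functional constant on the facet opposite \<open>v\<close> sees only the coordinate of
  \<open>v\<close>. The weights may be negative, so signs of wall values translate into signs of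
  coordinates outside the simplex.\<close>

lemma affine_eval:
  assumes "finite A" "sum \<mu> A = 1" "v \<in> A" "\<And>f. f \<in> A - {v} \<Longrightarrow> blinfun_apply \<beta> f = l"
  shows "blinfun_apply \<beta> (\<Sum>f\<in>A. \<mu> f *\<^sub>R f) - l = \<mu> v * (blinfun_apply \<beta> v - l)"
proof -
  have "blinfun_apply \<beta> (\<Sum>f\<in>A. \<mu> f *\<^sub>R f) - l = (\<Sum>f\<in>A. \<mu> f * (blinfun_apply \<beta> f - l))"
    using assms(2) by (simp add: blinfun.sum_right blinfun.scaleR_right right_diff_distrib sum_subtractf
        sum_distrib_right[symmetric])
  also have "\<dots> = \<mu> v * (blinfun_apply \<beta> v - l) + (\<Sum>f\<in>A - {v}. \<mu> f * (blinfun_apply \<beta> f - l))"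
    using assms by (simp add: sum.remove)
  also have "(\<Sum>f\<in>A - {v}. \<mu> f * (blinfun_apply \<beta> f - l)) = 0"
    using assms(4) by (intro sum.neutral) auto
  finally show ?thesis by simp
qed

text \<open>The averages in \<open>bary_unique\<close> are tested against the indicator of
  \<open>w\<close>.\<close>

lemma bary_unique_pos:
  assumes W: "W \<subseteq> cverts y" and l: "\<And>w. w \<in> W \<Longrightarrow> 0 \<le> l w" "sum l W = 1" "(\<Sum>w\<in>W. l w *\<^sub>R w) = x"
    and w: "w \<in> W" "0 < l w"
  shows "w \<in> cverts x"
proof (rule ccontr)
  assume "w \<notin> cverts x"
  have fW: "finite W" using W finite_subset cverts_facts(1) by blast
  have "(\<Sum>v\<in>cverts x. bary \<Phi> x v * of_bool (v = w)) = (\<Sum>v\<in>W. l v * of_bool (v = w))"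
    using bary_unique(1)[OF W l] .
  moreover have "(\<Sum>v\<in>cverts x. bary \<Phi> x v * of_bool (v = w)) = 0"
    using \<open>w \<notin> cverts x\<close> by (intro sum.neutral) auto
  moreover have "(\<Sum>v\<in>W. l v * of_bool (v = w)) = l w"
    using fW w(1) by (simp add: of_bool_def if_distrib sum.delta cong: if_cong)
  ultimately show False using w(2) by simp
qed

lemma face_point:
  assumes F: "F \<subseteq> cverts x" "F \<noteq> {}"
  obtains b where "b \<in> closed_cell x" "cverts b = F"
proof -
  have fin: "finite F" using F finite_subset cverts_facts(1) by blast
  define l where "l = (\<lambda>w::'a. 1 / real (card F))"
  have c: "card F > 0" using fin F by (simp add: card_gt_0_iff)
  have s: "sum l F = 1" unfolding l_def using c by simp
  have p: "0 < l w" for w unfolding l_def using c by simp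
  note u = bary_unique[OF F(1) less_imp_le[OF p] s refl] bary_unique_pos[OF F(1) less_imp_le[OF p] s refl _ p]
  show ?thesis by (rule that[OF u(3)]) (use u in blast)
qed

text \<open>A negative coordinate of \<open>y\<close> selects a facet whose wall separates the cell
  from \<open>y\<close>. As \<open>y\<close> is in the root hull, \<open>K\<close> itself reaches
  beyond this wall, and pushing from the facet into \<open>K\<close> yields the neighbouring
  cell.\<close>

lemma gallery_step:
  assumes K: "convex K" "cell_closed K" and x: "maximal_in K x" and y: "y \<in> root_hull K" "y \<notin> closed_cell x"
  obtains v v' x' \<alpha> k where "\<alpha> \<in> \<Phi>" "v \<in> cverts x" "\<And>f. f \<in> cverts x - {v} \<Longrightarrow> blinfun_apply \<alpha> f = of_int k"
    "blinfun_apply \<alpha> v > of_int k" "blinfun_apply \<alpha> y < of_int k" "blinfun_apply \<alpha> v' < of_int k"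
    "maximal_in K x'" "cverts x' = insert v' (cverts x - {v})" "card (sep x' y) < card (sep x y)"
    "y \<in> affine hull (cverts x)" "cverts x - {v} \<noteq> {}"
proof -
  let ?A = "cverts x"
  have fA: "finite ?A" by (rule cverts_facts)
  have xK: "x \<in> K" using x unfolding maximal_in_def by blast
  have hull_K: "w \<in> affine hull ?A" if "w \<in> K" for w by (rule maximal_affine_hull[OF K(1) x that])
  \<comment> \<open>A root hyperplane containing the cell contains \<open>K\<close>; both
    half-spaces that it bounds then belong to those defining the root hull, so it contains
    \<open>y\<close>.\<close>
  have yaff: "y \<in> affine hull ?A"
  proof (rule ccontr)
    assume "y \<notin> affine hull ?A"
    then obtain \<alpha> k where a: "\<alpha> \<in> \<Phi>" "\<And>f. f \<in> ?A \<Longrightarrow> blinfun_apply \<alpha> f = of_int k" "blinfun_apply \<alpha> y \<noteq> of_int k"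
      by (rule flat_wall) blast
    have "blinfun_apply \<alpha> w = k" if "w \<in> affine hull ?A" for w
    proof -
      obtain \<mu> where m: "sum \<mu> ?A = 1" "(\<Sum>f\<in>?A. \<mu> f *\<^sub>R f) = w"
        using \<open>w \<in> affine hull ?A\<close> unfolding affine_hull_finite[OF fA] by blast
      obtain v where v: "v \<in> ?A" using cverts_nonempty by blast
      have "blinfun_apply \<alpha> w - k = \<mu> v * (blinfun_apply \<alpha> v - k)"
        unfolding m(2)[symmetric] using a(2) by (intro affine_eval fA m v) auto
      then show ?thesis using a(2)[OF v] by simp
    qed
    then have "\<forall>w\<in>K. blinfun_apply \<alpha> w = k" using hull_K by blast
    then have "\<forall>w\<in>K. blinfun_apply \<alpha> w \<le> k" "\<forall>w\<in>K. blinfun_apply (- \<alpha>) w \<le> of_int (- k)"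
      by (simp_all add: blinfun.minus_left)
    then have "blinfun_apply \<alpha> y \<le> k" "blinfun_apply (- \<alpha>) y \<le> of_int (- k)"
      using y(1) a(1) root_minus[OF a(1)] unfolding root_hull_def by blast+
    then show False using a(3) by (simp add: blinfun.minus_left)
  qed
  then obtain \<mu> where m: "sum \<mu> ?A = 1" "(\<Sum>f\<in>?A. \<mu> f *\<^sub>R f) = y"
    unfolding affine_hull_finite[OF fA] by blast
  have "\<exists>v\<in>?A. \<mu> v < 0"
  proof (rule ccontr)
    assume "\<not> ?thesis"
    then have "y \<in> closed_cell x" unfolding cverts_facts(3) convex_hull_finite[OF fA]
      using m by (intro CollectI exI[of _ \<mu>]) (simp add: not_less)
    then show False using y by blast
  qed
  then obtain v where v: "v \<in> ?A" "\<mu> v < 0" by blast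
  obtain \<alpha> k where a: "\<alpha> \<in> \<Phi>" "\<And>f. f \<in> ?A - {v} \<Longrightarrow> blinfun_apply \<alpha> f = of_int k" "blinfun_apply \<alpha> v > of_int k"
    using facet_wall[OF v(1)] by blast
  have "blinfun_apply \<alpha> y - k = \<mu> v * (blinfun_apply \<alpha> v - k)"
    unfolding m(2)[symmetric] using a(2) by (intro affine_eval fA m v(1)) auto
  moreover have "\<mu> v * (blinfun_apply \<alpha> v - k) < 0" using v a by (simp add: mult_neg_pos)
  ultimately have ay: "blinfun_apply \<alpha> y < k" by linarith
  have Fne: "?A - {v} \<noteq> {}"
  proof
    assume "?A - {v} = {}"
    then have "?A = {v}" using v by blast
    then show False using m(1) v by simp
  qed
  have "\<exists>w\<in>K. blinfun_apply \<alpha> w < k"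
  proof (rule ccontr)
    assume "\<not> ?thesis"
    then have "\<forall>w\<in>K. blinfun_apply (- \<alpha>) w \<le> of_int (- k)" by (auto simp: blinfun.minus_left not_less)
    then have "blinfun_apply (- \<alpha>) y \<le> of_int (- k)"
      using y(1) root_minus[OF a(1)] unfolding root_hull_def by blast
    then show False using ay by (simp add: blinfun.minus_left)
  qed
  then obtain w where w: "w \<in> K" "blinfun_apply \<alpha> w < k" by blast
  obtain b where b: "b \<in> closed_cell x" "cverts b = ?A - {v}"
    using face_point[of "?A - {v}" x] Fne by blast
  have bk: "blinfun_apply \<alpha> b = k"
  proof -
    have r: "(\<Sum>f\<in>?A - {v}. bary \<Phi> b f) = 1" "(\<Sum>f\<in>?A - {v}. bary \<Phi> b f *\<^sub>R f) = b"
      using bary_facts(3,4)[of b] unfolding b(2) by auto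
    obtain f0 where f0: "f0 \<in> ?A - {v}" using Fne by blast
    have "blinfun_apply \<alpha> b - k = bary \<Phi> b f0 * (blinfun_apply \<alpha> f0 - k)"
      by (subst r(2)[symmetric]) (use a(2) r(1) f0 fA in \<open>intro affine_eval; auto\<close>)
    then show ?thesis using a(2)[OF f0] by simp
  qed
  \<comment> \<open>The barycentre \<open>b\<close> of the facet is moved towards \<open>w\<close>:
    the new point lies beyond the wall, while its cell keeps the whole facet as a face.\<close>
  obtain e where e: "0 < e" "e < 1" "b \<in> closed_cell (b + e *\<^sub>R (w - b))" using germ by blast
  define x' where "x' = b + e *\<^sub>R (w - b)"
  have bK: "b \<in> K" using b(1) xK K(2) unfolding cell_closed_def by blast
  have x'K: "x' \<in> K" unfolding x'_def using segment_in_convex[OF K(1) bK w(1)] e by simp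
  have "blinfun_apply \<alpha> x' = k + e * (blinfun_apply \<alpha> w - k)"
    unfolding x'_def by (simp add: blinfun.add_right blinfun.scaleR_right blinfun.diff_right bk)
  moreover have "e * (blinfun_apply \<alpha> w - k) < 0" using w(2) e by (simp add: mult_pos_neg)
  ultimately have ax': "blinfun_apply \<alpha> x' < k" by linarith
  have Fsub: "?A - {v} \<subseteq> cverts x'" using cverts_mono[OF e(3)] b(2) unfolding x'_def by simp
  have "\<exists>v'\<in>cverts x'. blinfun_apply \<alpha> v' < k"
  proof (rule ccontr)
    assume "\<not> ?thesis"
    then have "(\<Sum>f\<in>cverts x'. bary \<Phi> x' f * k) \<le> (\<Sum>f\<in>cverts x'. bary \<Phi> x' f * blinfun_apply \<alpha> f)"
      using bary_facts(1) by (intro sum_mono mult_left_mono) (auto simp: not_less)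
    then show False using ax' bary_facts(3)[of x'] bary_apply[of x' \<alpha>]
      by (simp add: sum_distrib_right[symmetric])
  qed
  then obtain v' where v': "v' \<in> cverts x'" "blinfun_apply \<alpha> v' < k" by blast
  have v'F: "v' \<notin> ?A - {v}" using v'(2) a(2)[of v'] by force
  have cardA: "card (insert v' (?A - {v})) = card ?A"
    using fA v'F card_Suc_Diff1[OF fA v(1)] by simp
  \<comment> \<open>The facet together with \<open>v'\<close> already has the greatest possible
    number of vertices in \<open>K\<close>, so there is no further vertex.\<close>
  have cvx': "cverts x' = insert v' (?A - {v})"
  proof (rule sym, rule card_seteq)
    show "card (cverts x') \<le> card (insert v' (?A - {v}))"
      unfolding cardA using x x'K unfolding maximal_in_def by blast
  qed (use cverts_facts(1) Fsub v'(1) in auto)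
  have max': "maximal_in K x'" using x x'K cardA cvx' unfolding maximal_in_def by simp
  have ax: "blinfun_apply \<alpha> x > k"
  proof -
    have "blinfun_apply \<alpha> x - k = bary \<Phi> x v * (blinfun_apply \<alpha> v - k)"
      by (subst bary_facts(4)[of x, symmetric])
        (rule affine_eval[OF fA bary_facts(3) v(1)], use a(2) in auto)
    moreover have "bary \<Phi> x v * (blinfun_apply \<alpha> v - k) > 0" using bary_pos[OF v(1)] a(3) by simp
    ultimately show ?thesis by linarith
  qed
  obtain \<mu>' where m': "sum \<mu>' ?A = 1" "(\<Sum>f\<in>?A. \<mu>' f *\<^sub>R f) = x'"
    using hull_K[OF x'K] unfolding affine_hull_finite[OF fA] by blast
  have "\<mu>' v < 0"
  proof -
    have "blinfun_apply \<alpha> x' - k = \<mu>' v * (blinfun_apply \<alpha> v - k)"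
      unfolding m'(2)[symmetric] using a(2) by (intro affine_eval fA m' v(1)) auto
    then have "\<mu>' v * (blinfun_apply \<alpha> v - k) < 0" using ax' by linarith
    then show ?thesis using a(3) by (simp add: mult_less_0_iff)
  qed
  \<comment> \<open>A hyperplane separating \<open>y\<close> from \<open>x'\<close> but not from
    \<open>x\<close> would contain the facet. In the affine hull its values are then proportional to
    the coordinate of \<open>v\<close>, which is negative for both \<open>x'\<close> and
    \<open>y\<close>, so these two would lie on the same side.\<close>
  have "sep x' y \<subseteq> sep x y"
  proof
    fix p assume "p \<in> sep x' y"
    then obtain \<beta> l where p: "p = (\<beta>, l)" "\<beta> \<in> \<Phi>" "blinfun_apply \<beta> x' < l" "l < blinfun_apply \<beta> y"
      unfolding sep_def by auto
    have "blinfun_apply \<beta> x < l"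
    proof (rule ccontr)
      assume not: "\<not> ?thesis"
      have on: "blinfun_apply \<beta> f = l" if f: "f \<in> ?A - {v}" for f
      proof (rule antisym)
        have "f \<in> closed_cell x'" "f \<in> closed_cell x"
          using f Fsub cverts_in_closed_cell by blast+
        then show "blinfun_apply \<beta> f \<le> l" "l \<le> blinfun_apply \<beta> f"
          using p(2,3) not closed_cellD[of f x' \<beta> l] closed_cellD_ge[of f x \<beta> l] by auto
      qed
      have "blinfun_apply \<beta> x' - l = \<mu>' v * (blinfun_apply \<beta> v - l)"
        unfolding m'(2)[symmetric] using on by (intro affine_eval fA m' v(1)) auto
      then have "\<mu>' v * (blinfun_apply \<beta> v - l) < 0" using p(3) by linarith
      then have "blinfun_apply \<beta> v - l > 0" using \<open>\<mu>' v < 0\<close> by (simp add: mult_less_0_iff)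
      moreover have "blinfun_apply \<beta> y - l = \<mu> v * (blinfun_apply \<beta> v - l)"
        unfolding m(2)[symmetric] using on by (intro affine_eval fA m v(1)) auto
      ultimately have "blinfun_apply \<beta> y - l < 0" using v(2) by (simp add: mult_neg_pos)
      then show False using p(4) by linarith
    qed
    then show "p \<in> sep x y" unfolding sep_def using p by simp
  qed
  \<comment> \<open>The crossed wall drops out; the signs match the orientation used in
    \<open>sep\<close>.\<close>
  moreover have "(- \<alpha>, - k) \<in> sep x y - sep x' y"
    unfolding sep_def using root_minus[OF a(1)] ax ay ax' by (simp add: blinfun.minus_left)
  ultimately have "card (sep x' y) < card (sep x y)"
    using finite_sep by (intro psubset_card_mono) auto
  then show ?thesis using that[of \<alpha> v k v' x'] a v(1) ay v'(2) max' cvx' yaff Fne by blast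
qed

text \<open>Induction on the number of separating hyperplanes: every cell of the walk is maximal in
  \<open>K\<close>, and the walk can stop only when \<open>y\<close> is in the closed cell.\<close>

lemma maximal_cover:
  assumes K: "convex K" "cell_closed K" "K \<noteq> {}" and y: "y \<in> root_hull K"
  shows "\<exists>x. maximal_in K x \<and> y \<in> closed_cell x"
proof -
  have "\<exists>x. maximal_in K x \<and> y \<in> closed_cell x" if "maximal_in K x" for x
    using that
  proof (induction "card (sep x y)" arbitrary: x rule: less_induct)
    case less
    show ?case
    proof (cases "y \<in> closed_cell x")
      case False
      obtain x' where "maximal_in K x'" "card (sep x' y) < card (sep x y)"
        using gallery_step[OF K(1,2) less.prems y False] by metis
      then show ?thesis using less.hyps by blast
    qed (use less.prems in blast)
  qed
  then show ?thesis using maximal_exists[OF K(3)] by blast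
qed

lemma root_hull_cell_closed:
  assumes K: "convex K" "cell_closed K" "K \<noteq> {}"
  shows "root_hull K = K"
  using subset_root_hull maximal_cover[OF K] K(2) unfolding maximal_in_def cell_closed_def by blast

lemma polyhedron_of_cell_closed:
  assumes K: "convex K" "cell_closed K" "K \<noteq> {}"
  shows "int_L_convex_polyhedron \<Phi> K"
proof -
  \<comment> \<open>The least integral upper bound of the root on \<open>K\<close>. Where there is
    none, the root imposes no condition, so the supremum is formed only of bounded sets.\<close>
  define \<gamma> where "\<gamma> = (\<lambda>\<alpha>. if \<exists>k::int. \<forall>x\<in>K. blinfun_apply \<alpha> x \<le> k
      then ereal (of_int \<lceil>Sup (blinfun_apply \<alpha> ` K)\<rceil>) else \<infinity>)"
  have bdd: "bdd_above (blinfun_apply \<alpha> ` K)" if "\<forall>x\<in>K. blinfun_apply \<alpha> x \<le> real_of_int k" for \<alpha> k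
    using that by (auto intro!: bdd_aboveI2)
  have sup: "(\<forall>x\<in>K. blinfun_apply \<alpha> x \<le> \<lceil>Sup (blinfun_apply \<alpha> ` K)\<rceil>)" "\<lceil>Sup (blinfun_apply \<alpha> ` K)\<rceil> \<le> k"
    if h: "\<forall>x\<in>K. blinfun_apply \<alpha> x \<le> real_of_int k" for \<alpha> k
  proof -
    show "\<forall>x\<in>K. blinfun_apply \<alpha> x \<le> \<lceil>Sup (blinfun_apply \<alpha> ` K)\<rceil>"
      using cSUP_upper[OF _ bdd[OF h]] le_of_int_ceiling order_trans by blast
    show "\<lceil>Sup (blinfun_apply \<alpha> ` K)\<rceil> \<le> k"
      using cSUP_least[OF K(3), of "blinfun_apply \<alpha>" k] h by (simp add: ceiling_le_iff)
  qed
  have "ereal (blinfun_apply \<alpha> y) \<le> \<gamma> \<alpha> \<longleftrightarrow> (\<forall>k::int. (\<forall>x\<in>K. blinfun_apply \<alpha> x \<le> k) \<longrightarrow> blinfun_apply \<alpha> y \<le> k)" for \<alpha> y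
  proof (cases "\<exists>k::int. \<forall>x\<in>K. blinfun_apply \<alpha> x \<le> k")
    case True
    then obtain k0 :: int where k0: "\<forall>x\<in>K. blinfun_apply \<alpha> x \<le> k0" by blast
    show ?thesis
    proof
      assume "ereal (blinfun_apply \<alpha> y) \<le> \<gamma> \<alpha>"
      then have "blinfun_apply \<alpha> y \<le> \<lceil>Sup (blinfun_apply \<alpha> ` K)\<rceil>" unfolding \<gamma>_def using True by simp
      then show "\<forall>k::int. (\<forall>x\<in>K. blinfun_apply \<alpha> x \<le> k) \<longrightarrow> blinfun_apply \<alpha> y \<le> k"
        using sup(2) by (meson of_int_le_iff order_trans)
    next
      assume "\<forall>k::int. (\<forall>x\<in>K. blinfun_apply \<alpha> x \<le> k) \<longrightarrow> blinfun_apply \<alpha> y \<le> k"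
      then show "ereal (blinfun_apply \<alpha> y) \<le> \<gamma> \<alpha>" unfolding \<gamma>_def using True sup(1)[OF k0] by simp
    qed
  next
    case False then show ?thesis unfolding \<gamma>_def by auto
  qed
  then have "K = {x. \<forall>\<alpha>\<in>\<Phi>. ereal (blinfun_apply \<alpha> x) \<le> \<gamma> \<alpha>}"
    using root_hull_cell_closed[OF K] unfolding root_hull_def by auto
  moreover have "\<forall>\<alpha>\<in>\<Phi>. \<gamma> \<alpha> = \<infinity> \<or> (\<exists>k::int. \<gamma> \<alpha> = ereal (of_int k))" unfolding \<gamma>_def by auto
  ultimately show ?thesis unfolding int_L_convex_polyhedron_def using K(3) by blast
qed

lemma int_polyhedron_facts:
  assumes "int_L_convex_polyhedron \<Phi> P"
  shows "convex P" "cell_closed P" "P \<noteq> {}"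
proof -
  obtain \<gamma> where g: "\<forall>\<alpha>\<in>\<Phi>. \<gamma> \<alpha> = \<infinity> \<or> (\<exists>k::int. \<gamma> \<alpha> = ereal (of_int k))"
    and P: "P = {x. \<forall>\<alpha>\<in>\<Phi>. ereal (blinfun_apply \<alpha> x) \<le> \<gamma> \<alpha>}" and "P \<noteq> {}"
    using assms unfolding int_L_convex_polyhedron_def by blast
  show "P \<noteq> {}" by fact
  have "convex {x. ereal (blinfun_apply \<alpha> x) \<le> \<gamma> \<alpha>}" if "\<alpha> \<in> \<Phi>" for \<alpha>
    using bspec[OF g that]
  proof
    assume "\<exists>k::int. \<gamma> \<alpha> = ereal (of_int k)"
    then obtain k :: int where "\<gamma> \<alpha> = ereal (of_int k)" by blast
    then show ?thesis using convex_halfspace_le[of "riesz \<alpha>" "of_int k"] by (simp add: riesz_inner)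
  qed simp
  moreover have "P = (\<Inter>\<alpha>\<in>\<Phi>. {x. ereal (blinfun_apply \<alpha> x) \<le> \<gamma> \<alpha>})" unfolding P by blast
  ultimately show "convex P" by (auto intro: convex_INT)
  show "cell_closed P" unfolding cell_closed_def
  proof (intro ballI subsetI)
    fix x y assume x: "x \<in> P" and y: "y \<in> closed_cell x"
    have "ereal (blinfun_apply \<alpha> y) \<le> \<gamma> \<alpha>" if a: "\<alpha> \<in> \<Phi>" for \<alpha>
      using bspec[OF g a]
    proof
      assume "\<exists>k::int. \<gamma> \<alpha> = ereal (of_int k)"
      then obtain k :: int where k: "\<gamma> \<alpha> = ereal (of_int k)" by blast
      then have "blinfun_apply \<alpha> x \<le> k" using x a unfolding P by force
      then show ?thesis using closed_cellD[OF y a] k by simp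
    qed simp
    then show "y \<in> P" unfolding P by blast
  qed
qed

end

section \<open>Discrete midpoint convexity\<close>

definition chord :: "int \<Rightarrow> real \<Rightarrow> real" where
  "chord n t = (2 * n + 1) * t - n * (n + 1)"

text \<open>\<open>chord n\<close> is the secant of the square function between \<open>n\<close> and
  \<open>n + 1\<close>, so \<open>pl_square\<close> interpolates the square linearly between
  consecutive integers.\<close>

definition pl_square :: "real \<Rightarrow> real" where
  "pl_square t = chord \<lfloor>t\<rfloor> t"

text \<open>Outside the strip from \<open>m\<close> to \<open>m + 1\<close> the two factors have the
  same sign, inside it their product vanishes; hence the interpolant lies above each of its
  chords.\<close>

lemma pl_square_diff:
  fixes t :: real and m :: int
  shows "pl_square t -  chord m t = (\<lfloor>t\<rfloor> - m) * (2 * t - (\<lfloor>t\<rfloor> + m + 1))"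
  by (simp add: pl_square_def chord_def algebra_simps)

lemma pl_square_eq_chord:
  fixes t :: real and m :: int
  assumes "m \<le> t" "t \<le> m + 1"
  shows "pl_square t = chord m t"
proof -
  have "\<lfloor>t\<rfloor> = m \<or> (\<lfloor>t\<rfloor> = m + 1 \<and> t = m + 1)" using assms by linarith
  then have "real_of_int (\<lfloor>t\<rfloor> - m) * (2 * t - (\<lfloor>t\<rfloor> + m + 1)) = 0" by auto
  then have "pl_square t - chord m t = 0" using pl_square_diff[of t m] by metis
  then show ?thesis by simp
qed

lemma chord_less_pl_square:
  fixes t :: real and m :: int
  assumes "t < m \<or> m + 1 < t"
  shows "chord m t < pl_square t"
proof -
  have "0 < (real_of_int (\<lfloor>t\<rfloor> - m)) * (2 * t - (\<lfloor>t\<rfloor> + m + 1))"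
    using assms
  proof
    assume "t < m"
    then show ?thesis by (intro mult_neg_neg) linarith+
  next
    assume "m + 1 < t"
    then show ?thesis by (intro mult_pos_pos) linarith+
  qed
  then show ?thesis using pl_square_diff[of t m] by simp
qed

lemma chord_le_pl_square:
  fixes t :: real and m :: int
  shows "chord m t \<le> pl_square t"
  using pl_square_eq_chord[where m=m and t=t] chord_less_pl_square[where m=m and t=t] by linarith

lemma chord_combination:
  fixes l h :: "'b \<Rightarrow> real" and m :: int
  assumes "sum l A = 1"
  shows "(\<Sum>v\<in>A. l v * chord m (h v)) = chord m (\<Sum>v\<in>A. l v * h v)"
proof -
  have "(\<Sum>v\<in>A. l v * chord m (h v)) = (\<Sum>v\<in>A. (2 * m + 1) * (l v * h v) - l v * (m * (m + 1)))"
    unfolding chord_def by (intro sum.cong refl) (simp add: algebra_simps)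
  also have "\<dots> = chord m (\<Sum>v\<in>A. l v * h v)"
    using assms by (simp add: sum_subtractf sum_distrib_left[symmetric] sum_distrib_right[symmetric] chord_def)
  finally show ?thesis .
qed

text \<open>The attainable values over \<open>z\<close> form a slice of the convex hull of the
  finite graph of \<open>F\<close>; this hull is compact, so a lowest value is attained.\<close>

lemma minimal_combination:
  fixes S :: "'a::euclidean_space set" and F :: "'a \<Rightarrow> real"
  assumes S: "finite S" and l: "\<And>w. w \<in> S \<Longrightarrow> 0 \<le> l w" "sum l S = 1" "(\<Sum>w\<in>S. l w *\<^sub>R w) = z"
  shows "\<exists>\<mu>. (\<forall>w\<in>S. 0 \<le> \<mu> w) \<and> sum \<mu> S = 1 \<and> (\<Sum>w\<in>S. \<mu> w *\<^sub>R w) = z \<and>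
    (\<forall>m. (\<forall>w\<in>S. 0 \<le> m w) \<and> sum m S = 1 \<and> (\<Sum>w\<in>S. m w *\<^sub>R w) = z \<longrightarrow>
       (\<Sum>w\<in>S. \<mu> w * F w) \<le> (\<Sum>w\<in>S. m w * F w))"
proof -
  define T where "T = convex hull ((\<lambda>w. (w, F w)) ` S)"
  have inj: "inj_on (\<lambda>w. (w, F w)) S" by (simp add: inj_on_def)
  have T: "p \<in> T \<longleftrightarrow> (\<exists>m. (\<forall>w\<in>S. 0 \<le> m w) \<and> sum m S = 1 \<and> (\<Sum>w\<in>S. m w *\<^sub>R w) = fst p \<and> (\<Sum>w\<in>S. m w * F w) = snd p)" for p
  proof
    assume "p \<in> T"
    then obtain u where u: "\<forall>x\<in>(\<lambda>w. (w, F w)) ` S. 0 \<le> u x" "sum u ((\<lambda>w. (w, F w)) ` S) = 1"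
        "(\<Sum>x\<in>(\<lambda>w. (w, F w)) ` S. u x *\<^sub>R x) = p"
      unfolding T_def using S by (subst (asm) convex_hull_finite) auto
    let ?m = "\<lambda>w. u (w, F w)"
    have "(\<Sum>w\<in>S. ?m w *\<^sub>R (w, F w)) = p" using u(3) by (simp add: sum.reindex[OF inj])
    then have "(\<Sum>w\<in>S. ?m w *\<^sub>R w) = fst p" "(\<Sum>w\<in>S. ?m w * F w) = snd p"
      by (auto simp: fst_sum snd_sum)
    moreover have "sum ?m S = 1" using u(2) by (simp add: sum.reindex[OF inj])
    ultimately show "\<exists>m. (\<forall>w\<in>S. 0 \<le> m w) \<and> sum m S = 1 \<and> (\<Sum>w\<in>S. m w *\<^sub>R w) = fst p \<and> (\<Sum>w\<in>S. m w * F w) = snd p"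
      using u(1) by (intro exI[of _ ?m]) simp
  next
    assume "\<exists>m. (\<forall>w\<in>S. 0 \<le> m w) \<and> sum m S = 1 \<and> (\<Sum>w\<in>S. m w *\<^sub>R w) = fst p \<and> (\<Sum>w\<in>S. m w * F w) = snd p"
    then obtain m where m: "\<forall>w\<in>S. 0 \<le> m w" "sum m S = 1" "(\<Sum>w\<in>S. m w *\<^sub>R w) = fst p" "(\<Sum>w\<in>S. m w * F w) = snd p"
      by blast
    have "p = (\<Sum>w\<in>S. m w *\<^sub>R (w, F w))"
      using m(3,4) by (simp add: prod_eq_iff fst_sum snd_sum)
    then have "p = (\<Sum>x\<in>(\<lambda>w. (w, F w)) ` S. m (fst x) *\<^sub>R x)" by (simp add: sum.reindex[OF inj])
    moreover have "sum (\<lambda>x. m (fst x)) ((\<lambda>w. (w, F w)) ` S) = 1" using m(2) by (simp add: sum.reindex[OF inj])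
    ultimately show "p \<in> T" unfolding T_def using S m(1)
      by (subst convex_hull_finite) (auto intro!: exI[of _ "\<lambda>x. m (fst x)"])
  qed
  have "compact T" unfolding T_def using S by (intro compact_convex_hull finite_imp_compact) simp
  then have "compact (T \<inter> ({z} \<times> UNIV))" by (intro compact_Int_closed closed_Times) auto
  then have "compact (snd ` (T \<inter> ({z} \<times> UNIV)))" by (intro compact_continuous_image continuous_intros)
  moreover have "(z, \<Sum>w\<in>S. l w * F w) \<in> T" unfolding T using l by (intro exI[of _ l]) simp
  then have "snd ` (T \<inter> ({z} \<times> UNIV)) \<noteq> {}" by blast
  ultimately obtain t where t: "t \<in> snd ` (T \<inter> ({z} \<times> UNIV))" "\<And>s. s \<in> snd ` (T \<inter> ({z} \<times> UNIV)) \<Longrightarrow> t \<le> s"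
    using compact_attains_inf[of "snd ` (T \<inter> ({z} \<times> UNIV))"] by metis
  from t(1) have "(z, t) \<in> T" by auto
  then obtain \<mu> where m: "\<forall>w\<in>S. 0 \<le> \<mu> w" "sum \<mu> S = 1" "(\<Sum>w\<in>S. \<mu> w *\<^sub>R w) = z" "(\<Sum>w\<in>S. \<mu> w * F w) = t"
    unfolding T by auto
  show ?thesis
  proof (intro exI[of _ \<mu>] conjI allI impI)
    fix m assume "(\<forall>w\<in>S. 0 \<le> m w) \<and> sum m S = 1 \<and> (\<Sum>w\<in>S. m w *\<^sub>R w) = z"
    then have "(z, \<Sum>w\<in>S. m w * F w) \<in> T" unfolding T by (intro exI[of _ m]) simp
    then have "(\<Sum>w\<in>S. m w * F w) \<in> snd ` (T \<inter> ({z} \<times> UNIV))" by force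
    then show "(\<Sum>w\<in>S. \<mu> w * F w) \<le> (\<Sum>w\<in>S. m w * F w)" using t(2) m(4) by blast
  qed (use m in auto)
qed

text \<open>Mass \<open>m\<close> is taken from each of \<open>x\<close> and \<open>y\<close> and
  redistributed over \<open>V\<close> with the weights \<open>b\<close>. The general
  \<open>h\<close> covers total mass, barycentre and objective at once.\<close>

lemma sum_exchange:
  fixes h :: "'a \<Rightarrow> 'b::real_vector"
  assumes S: "finite S" "x \<in> S" "y \<in> S" "V \<subseteq> S" and b: "\<And>w. w \<notin> V \<Longrightarrow> b w = 0"
  shows "(\<Sum>w\<in>S. (\<mu> w - m * (of_bool (w = x) + of_bool (w = y)) + 2 * m * b w) *\<^sub>R h w)
    = (\<Sum>w\<in>S. \<mu> w *\<^sub>R h w) - m *\<^sub>R (h x + h y) + (2 * m) *\<^sub>R (\<Sum>w\<in>V. b w *\<^sub>R h w)"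
proof -
  have e: "(\<Sum>w\<in>S. of_bool (w = u) *\<^sub>R h w) = h u" if "u \<in> S" for u
    using S(1) that by (simp add: of_bool_def if_distrib[of "\<lambda>c. c *\<^sub>R _"] sum.delta cong: if_cong)
  have v: "(\<Sum>w\<in>S. b w *\<^sub>R h w) = (\<Sum>w\<in>V. b w *\<^sub>R h w)"
    using S b by (intro sum.mono_neutral_right) auto
  have "(\<Sum>w\<in>S. (\<mu> w - m * (of_bool (w = x) + of_bool (w = y)) + 2 * m * b w) *\<^sub>R h w)
     = (\<Sum>w\<in>S. \<mu> w *\<^sub>R h w - (m *\<^sub>R (of_bool (w = x) *\<^sub>R h w) + m *\<^sub>R (of_bool (w = y) *\<^sub>R h w)) + (2 * m) *\<^sub>R (b w *\<^sub>R h w))"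
    by (intro sum.cong refl) (simp add: scaleR_left_distrib scaleR_left_diff_distrib distrib_left)
  also have "\<dots> = (\<Sum>w\<in>S. \<mu> w *\<^sub>R h w) - (m *\<^sub>R h x + m *\<^sub>R h y) + (2 * m) *\<^sub>R (\<Sum>w\<in>V. b w *\<^sub>R h w)"
    unfolding sum.distrib sum_subtractf scaleR_sum_right[symmetric] e[OF S(2)] e[OF S(3)] v ..
  finally show ?thesis by (simp add: scaleR_right_distrib)
qed

context irreducible_root_system
begin

section \<open>Finite boxes and a strictly convex height\<close>

definition root_box :: "int \<Rightarrow> 'a set" where
  "root_box N = {x. \<forall>\<alpha>\<in>\<Phi>. blinfun_apply \<alpha> x \<le> N}"

lemma root_box_abs: "x \<in> root_box N \<Longrightarrow> \<alpha> \<in> \<Phi> \<Longrightarrow> \<bar>blinfun_apply \<alpha> x\<bar> \<le> N"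
  unfolding root_box_def using root_minus[of \<alpha>] by (auto simp: abs_le_iff blinfun.minus_left)

lemma root_box_closed_cell: "x \<in> root_box N \<Longrightarrow> y \<in> closed_cell x \<Longrightarrow> y \<in> root_box N"
  unfolding root_box_def using closed_cellD by blast

lemma convex_root_box: "convex (root_box N)"
proof -
  have "root_box N = (\<Inter>\<alpha>\<in>\<Phi>. {x. riesz \<alpha> \<bullet> x \<le> N})" unfolding root_box_def riesz_inner by blast
  then show ?thesis by (auto intro!: convex_INT simp: convex_halfspace_le)
qed

lemma bounded_subset_root_box:
  assumes "bounded A"
  shows "\<exists>N. A \<subseteq> root_box N"
proof -
  obtain B where B: "\<And>x. x \<in> A \<Longrightarrow> norm x \<le> B" using assms unfolding bounded_iff by blast
  define M where "M = Max (norm ` \<Phi>)"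
  have M: "norm \<alpha> \<le> M" if "\<alpha> \<in> \<Phi>" for \<alpha> unfolding M_def using finite_roots that by simp
  have "x \<in> root_box \<lceil>M * B\<rceil>" if "x \<in> A" for x
    unfolding root_box_def
  proof (intro CollectI ballI)
    fix \<alpha> assume a: "\<alpha> \<in> \<Phi>"
    have "blinfun_apply \<alpha> x \<le> norm \<alpha> * norm x"
      using norm_blinfun[of \<alpha> x] by (simp add: abs_le_iff)
    also have "\<dots> \<le> M * B" using M[OF a] B[OF that] order_trans[OF norm_ge_zero M[OF a]] by (intro mult_mono) auto
    finally show "blinfun_apply \<alpha> x \<le> \<lceil>M * B\<rceil>" by linarith
  qed
  then show ?thesis by blast
qed

text \<open>The ceilings of its root values determine the closed cell of a vertex, which is a single
  point; in a box only finitely many ceilings occur.\<close>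

lemma finite_vertices_root_box: "finite (cvertices \<Phi> \<inter> root_box N)"
proof (rule inj_on_finite)
  let ?h = "\<lambda>v::'a. restrict (\<lambda>\<alpha>. \<lceil>blinfun_apply \<alpha> v\<rceil>) \<Phi>"
  show "inj_on ?h (cvertices \<Phi> \<inter> root_box N)"
  proof (rule inj_onI)
    fix v w assume v: "v \<in> cvertices \<Phi> \<inter> root_box N" and w: "w \<in> cvertices \<Phi> \<inter> root_box N" and eq: "?h v = ?h w"
    have "\<lceil>blinfun_apply \<alpha> v\<rceil> = \<lceil>blinfun_apply \<alpha> w\<rceil>" if "\<alpha> \<in> \<Phi>" for \<alpha>
      using fun_cong[OF eq, of \<alpha>] that by simp
    then have "v \<in> closed_cell w"
      unfolding closed_cell_def ceiling_le_iff[symmetric] by simp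
    then show "v = w" using cvertices_inject w by blast
  qed
  show "?h ` (cvertices \<Phi> \<inter> root_box N) \<subseteq> (\<Pi>\<^sub>E \<alpha>\<in>\<Phi>. {-N..N})"
  proof
    fix q assume "q \<in> ?h ` (cvertices \<Phi> \<inter> root_box N)"
    then obtain v where v: "v \<in> root_box N" "q = ?h v" by blast
    have "- N \<le> \<lceil>blinfun_apply \<alpha> v\<rceil> \<and> \<lceil>blinfun_apply \<alpha> v\<rceil> \<le> N" if "\<alpha> \<in> \<Phi>" for \<alpha>
      using root_box_abs[OF v(1) that] by linarith
    then show "q \<in> (\<Pi>\<^sub>E \<alpha>\<in>\<Phi>. {-N..N})" unfolding v(2) by (intro restrict_PiE_iff[THEN iffD2]) simp
  qed
  show "finite (\<Pi>\<^sub>E \<alpha>\<in>\<Phi>. {-N..N})" using finite_roots by (intro finite_PiE) auto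
qed

text \<open>
  A piecewise linear analogue of the squared norm: it is affine on every cell and strictly
  midpoint convex on separated vertices.
\<close>

definition height :: "'a \<Rightarrow> real" where
  "height v = (\<Sum>\<alpha>\<in>\<Phi>. pl_square (blinfun_apply \<alpha> v))"

text \<open>For each root, \<open>pl_square\<close> is compared with the chord of the strip
  containing \<open>z\<close>: they agree on the cell of \<open>z\<close>, the chord is affine, and
  it lies below \<open>pl_square\<close> at \<open>x\<close> and \<open>y\<close>.\<close>

lemma height_midpoint:
  assumes z: "z = (1/2) *\<^sub>R (x + y)" and a: "\<alpha> \<in> \<Phi>" "blinfun_apply \<alpha> x < of_int k" "of_int k < blinfun_apply \<alpha> y"
  shows "2 * (\<Sum>v\<in>cverts z. bary \<Phi> z v * height v) < height x + height y"
proof -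
  define c where "c = (\<lambda>\<beta>::'a \<Rightarrow>\<^sub>L real. chord \<lfloor>blinfun_apply \<beta> z\<rfloor>)"
  have cell: "(\<Sum>v\<in>cverts z. bary \<Phi> z v * pl_square (blinfun_apply \<beta> v)) = c \<beta> (blinfun_apply \<beta> z)" if b: "\<beta> \<in> \<Phi>" for \<beta>
  proof -
    have "pl_square (blinfun_apply \<beta> v) = c \<beta> (blinfun_apply \<beta> v)" if "v \<in> cverts z" for v
      unfolding c_def
    proof (rule pl_square_eq_chord)
      show "\<lfloor>blinfun_apply \<beta> z\<rfloor> \<le> blinfun_apply \<beta> v"
        using closed_cellD_ge[OF cverts_in_closed_cell[OF that] b] by simp
      show "blinfun_apply \<beta> v \<le> \<lfloor>blinfun_apply \<beta> z\<rfloor> + 1"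
        using closed_cellD[OF cverts_in_closed_cell[OF that] b, of "\<lfloor>blinfun_apply \<beta> z\<rfloor> + 1"] by simp
    qed
    then have "(\<Sum>v\<in>cverts z. bary \<Phi> z v * pl_square (blinfun_apply \<beta> v)) = (\<Sum>v\<in>cverts z. bary \<Phi> z v * c \<beta> (blinfun_apply \<beta> v))"
      by simp
    then show ?thesis unfolding c_def chord_combination[OF bary_facts(3)] bary_apply .
  qed
  have mid: "2 * c \<beta> (blinfun_apply \<beta> z) = c \<beta> (blinfun_apply \<beta> x) + c \<beta> (blinfun_apply \<beta> y)" for \<beta>
    unfolding c_def chord_def z by (simp add: blinfun.scaleR_right blinfun.add_right algebra_simps)
  have "2 * (\<Sum>v\<in>cverts z. bary \<Phi> z v * height v) = 2 * (\<Sum>\<beta>\<in>\<Phi>. \<Sum>v\<in>cverts z. bary \<Phi> z v * pl_square (blinfun_apply \<beta> v))"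
    unfolding height_def sum_distrib_left by (subst sum.swap) simp
  also have "\<dots> = (\<Sum>\<beta>\<in>\<Phi>. 2 * c \<beta> (blinfun_apply \<beta> z))" using cell by (simp add: sum_distrib_left)
  also have "\<dots> = (\<Sum>\<beta>\<in>\<Phi>. c \<beta> (blinfun_apply \<beta> x) + c \<beta> (blinfun_apply \<beta> y))" unfolding mid ..
  also have "\<dots> < (\<Sum>\<beta>\<in>\<Phi>. pl_square (blinfun_apply \<beta> x) + pl_square (blinfun_apply \<beta> y))"
  proof (rule sum_strict_mono_ex1[OF finite_roots])
    show "\<forall>\<beta>\<in>\<Phi>. c \<beta> (blinfun_apply \<beta> x) + c \<beta> (blinfun_apply \<beta> y) \<le> pl_square (blinfun_apply \<beta> x) + pl_square (blinfun_apply \<beta> y)"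
      unfolding c_def by (intro ballI add_mono chord_le_pl_square)
    let ?m = "\<lfloor>blinfun_apply \<alpha> z\<rfloor>"
    \<comment> \<open>The strip of \<open>z\<close> has width one and no integer in its interior, so
      \<open>x\<close> lies strictly below it or \<open>y\<close> strictly above it.\<close>
    consider "?m < k" | "k \<le> ?m" by linarith
    then have "blinfun_apply \<alpha> x < ?m \<or> ?m + 1 < blinfun_apply \<alpha> y"
      using a(2,3) by cases linarith+
    then have "c \<alpha> (blinfun_apply \<alpha> x) + c \<alpha> (blinfun_apply \<alpha> y) < pl_square (blinfun_apply \<alpha> x) + pl_square (blinfun_apply \<alpha> y)"
      unfolding c_def using chord_le_pl_square chord_less_pl_square by (metis add_less_le_mono add_le_less_mono)
    then show "\<exists>\<beta>\<in>\<Phi>. c \<beta> (blinfun_apply \<beta> x) + c \<beta> (blinfun_apply \<beta> y) < pl_square (blinfun_apply \<beta> x) + pl_square (blinfun_apply \<beta> y)"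
      using a(1) by blast
  qed
  finally show ?thesis unfolding height_def by (simp add: sum.distrib)
qed

end

section \<open>Extended-real functions on the vertices\<close>

locale vertex_function = irreducible_root_system \<Phi> for \<Phi> :: "('a::euclidean_space \<Rightarrow>\<^sub>L real) set" +
  fixes f :: "'a \<Rightarrow> ereal"
  assumes not_minf: "v \<in> cvertices \<Phi> \<Longrightarrow> f v \<noteq> -\<infinity>" and dom_nonempty: "eff_dom \<Phi> f \<noteq> {}"
begin

abbreviation D :: "'a set" where "D \<equiv> eff_dom \<Phi> f"

text \<open>\<open>real_of_ereal\<close> turns infinite values into 0, so \<open>fval\<close> is
  meaningful only on \<open>D\<close>, and \<open>lovasz_val x\<close> only when
  \<open>cverts x \<subseteq> D\<close>.\<close>

definition fval :: "'a \<Rightarrow> real" where "fval v = real_of_ereal (f v)"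

definition lovasz_val :: "'a \<Rightarrow> real" where "lovasz_val x = (\<Sum>v\<in>cverts x. bary \<Phi> x v * fval v)"

lemma D_vertices: "D \<subseteq> cvertices \<Phi>"
  unfolding eff_dom_def by blast

lemma f_D: "v \<in> D \<Longrightarrow> f v = ereal (fval v)"
  unfolding eff_dom_def fval_def by (simp add: ereal_real)

lemma f_not_D: "v \<in> cvertices \<Phi> \<Longrightarrow> v \<notin> D \<Longrightarrow> f v = \<infinity>"
  using not_minf unfolding eff_dom_def by auto

lemma lovasz_D: "cverts x \<subseteq> D \<Longrightarrow> lovasz \<Phi> f x = ereal (lovasz_val x)"
  unfolding lovasz_val_def using f_D by (intro lovasz_finite) blast

lemma lovasz_not_D: "\<not> cverts x \<subseteq> D \<Longrightarrow> lovasz \<Phi> f x = \<infinity>"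
proof -
  assume "\<not> cverts x \<subseteq> D"
  then obtain v where v: "v \<in> cverts x" "v \<notin> D" by blast
  show ?thesis
    using lovasz_infinite[OF v(1), of f] f_not_D[of v] v cverts_iff not_minf by blast
qed

lemma lovasz_le_iff: "lovasz \<Phi> f x \<le> ereal t \<longleftrightarrow> cverts x \<subseteq> D \<and> lovasz_val x \<le> t"
  using lovasz_D[of x] lovasz_not_D[of x] by (cases "cverts x \<subseteq> D") auto

lemma epi_iff: "(x, t) \<in> epi (lovasz \<Phi> f) \<longleftrightarrow> cverts x \<subseteq> D \<and> lovasz_val x \<le> t"
  unfolding epi_def by (simp add: lovasz_le_iff)

lemma midpoint_ineq_iff:
  "midpoint_ineq \<Phi> f x y \<longleftrightarrow> 2 * lovasz \<Phi> f ((1/2) *\<^sub>R (x + y)) \<le> f x + f y"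
  unfolding midpoint_ineq_def lovasz_def Let_def ..

text \<open>With finite values at \<open>x\<close> and \<open>y\<close>, an infinite value at a
  vertex of the midpoint cell violates the inequality, which therefore also contains a closure
  property of \<open>D\<close>.\<close>

lemma midpoint_ineq_D:
  assumes "x \<in> D" "y \<in> D" and z: "z = (1/2) *\<^sub>R (x + y)"
  shows "midpoint_ineq \<Phi> f x y \<longleftrightarrow> cverts z \<subseteq> D \<and> 2 * lovasz_val z \<le> fval x + fval y"
proof (cases "cverts z \<subseteq> D")
  case True
  then show ?thesis unfolding midpoint_ineq_iff z[symmetric] using assms f_D lovasz_D[OF True]
    by (simp add: times_ereal.simps(1)[of 2, simplified])
next
  case False
  then show ?thesis unfolding midpoint_ineq_iff z[symmetric] using assms f_D lovasz_not_D[OF False] by simp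
qed

lemma midpoint_ineq_trivial:
  assumes "x \<in> cvertices \<Phi>" "y \<in> cvertices \<Phi>" "x \<notin> D \<or> y \<notin> D"
  shows "midpoint_ineq \<Phi> f x y"
proof -
  have inf: "f x + f y = \<infinity>" using assms f_not_D by fastforce
  show ?thesis unfolding midpoint_ineq_iff inf by simp
qed

text \<open>Arbitrary finite combinations are treated because convexity between two points of the
  domain mixes the vertices of two whole cells.\<close>

lemma jensen:
  assumes mid: "\<And>x y. x \<in> D \<Longrightarrow> y \<in> D \<Longrightarrow> midpoint_ineq \<Phi> f x y"
    and W: "finite W" "W \<subseteq> D" and l: "\<And>w. w \<in> W \<Longrightarrow> 0 \<le> l w" "sum l W = 1" "(\<Sum>w\<in>W. l w *\<^sub>R w) = z"
  shows "cverts z \<subseteq> D \<and> lovasz_val z \<le> (\<Sum>w\<in>W. l w * fval w)"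
proof -
  \<comment> \<open>The box is convex and contains the closed cells of its points, so the vertices
    introduced by an exchange stay in the finite set \<open>S\<close>.\<close>
  obtain N where N: "W \<subseteq> root_box N" using bounded_subset_root_box finite_imp_bounded W(1) by blast
  define S where "S = D \<inter> root_box N"
  have finS: "finite S" unfolding S_def 
    by (rule finite_subset[OF _ finite_vertices_root_box[of N]]) (use D_vertices in blast)
  have WS: "W \<subseteq> S" unfolding S_def using W N by blast
  define l' where "l' = (\<lambda>w. if w \<in> W then l w else 0)"
  have ext: "(\<Sum>w\<in>W. l w *\<^sub>R h w) = (\<Sum>w\<in>S. l' w *\<^sub>R h w)" for h :: "'a \<Rightarrow> real"
    unfolding l'_def using WS by (intro sum.mono_neutral_cong_left finS) auto
  have ext': "(\<Sum>w\<in>W. l w *\<^sub>R w) = (\<Sum>w\<in>S. l' w *\<^sub>R w)"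
    unfolding l'_def using WS by (intro sum.mono_neutral_cong_left finS) auto
  have l': "\<And>w. w \<in> S \<Longrightarrow> 0 \<le> l' w" "sum l' S = 1" "(\<Sum>w\<in>S. l' w *\<^sub>R w) = z"
    using l ext[of "\<lambda>_. 1"] ext' by (auto simp: l'_def)
  have key: "cverts z \<subseteq> D \<and> (\<Sum>v\<in>cverts z. bary \<Phi> z v * (fval v + \<epsilon> * height v)) \<le> (\<Sum>w\<in>S. l' w * (fval w + \<epsilon> * height w))"
    if eps: "\<epsilon> > 0" for \<epsilon> :: real
  proof -
    define F where "F = (\<lambda>v. fval v + \<epsilon> * height v)"
    obtain \<mu> where mu_all: "(\<forall>w\<in>S. 0 \<le> \<mu> w) \<and> sum \<mu> S = 1 \<and> (\<Sum>w\<in>S. \<mu> w *\<^sub>R w) = z \<and>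
      (\<forall>m. (\<forall>w\<in>S. 0 \<le> m w) \<and> sum m S = 1 \<and> (\<Sum>w\<in>S. m w *\<^sub>R w) = z \<longrightarrow>
         (\<Sum>w\<in>S. \<mu> w * F w) \<le> (\<Sum>w\<in>S. m w * F w))"
      using minimal_combination[OF finS l', of F] by (rule exE)
    note mu = bspec[OF conjunct1[OF mu_all]] conjunct1[OF conjunct2[OF mu_all]]
      conjunct1[OF conjunct2[OF conjunct2[OF mu_all]]]
    have least: "(\<Sum>w\<in>S. \<mu> w * F w) \<le> (\<Sum>w\<in>S. m w * F w)"
      if "\<And>w. w \<in> S \<Longrightarrow> 0 \<le> m w" "sum m S = 1" "(\<Sum>w\<in>S. m w *\<^sub>R w) = z" for m
      using conjunct2[OF conjunct2[OF conjunct2[OF mu_all]]] that by simp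
    define W' where "W' = {w\<in>S. 0 < \<mu> w}"
    have nosep: "\<not> (blinfun_apply \<alpha> x < of_int k \<and> of_int k < blinfun_apply \<alpha> y)"
      if a: "\<alpha> \<in> \<Phi>" and x: "x \<in> W'" and y: "y \<in> W'" for \<alpha> x y k
    proof
      assume s: "blinfun_apply \<alpha> x < of_int k \<and> of_int k < blinfun_apply \<alpha> y"
      then have xy: "x \<noteq> y" by force
      have xS: "x \<in> S" "y \<in> S" "0 < \<mu> x" "0 < \<mu> y" using x y unfolding W'_def by auto
      define u where "u = (1/2) *\<^sub>R (x + y)"
      have uD: "cverts u \<subseteq> D" "2 * lovasz_val u \<le> fval x + fval y"
        using mid[of x y] midpoint_ineq_D[of x y u] xS unfolding S_def u_def by auto
      have "u \<in> root_box N" unfolding u_def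
        using convexD[OF convex_root_box, of x N y "1/2" "1/2"] xS unfolding S_def by (simp add: scaleR_right_distrib)
      then have V: "cverts u \<subseteq> S" unfolding S_def using uD(1) root_box_closed_cell cverts_in_closed_cell by blast
      \<comment> \<open>The largest amount that can be taken from both weights.\<close>
      define m where "m = min (\<mu> x) (\<mu> y)"
      have m: "m > 0" "m \<le> \<mu> x" "m \<le> \<mu> y" unfolding m_def using xS by auto
      define \<mu>' where "\<mu>' = (\<lambda>w. \<mu> w - m * (of_bool (w = x) + of_bool (w = y)) + 2 * m * bary \<Phi> u w)"
      have b0: "bary \<Phi> u w = 0" if "w \<notin> cverts u" for w using bary_facts(2)[of u w] that by blast
      note ex = sum_exchange[OF finS xS(1,2) V, of "bary \<Phi> u", OF b0, where \<mu>=\<mu> and m=m]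
      have "(\<Sum>w\<in>S. \<mu> w * F w) \<le> (\<Sum>w\<in>S. \<mu>' w * F w)"
      proof (rule least)
        fix w assume "w \<in> S"
        have "0 \<le> \<mu> w - m * (of_bool (w = x) + of_bool (w = y))"
          using mu(1)[OF \<open>w \<in> S\<close>] m xy by auto
        moreover have "0 \<le> 2 * m * bary \<Phi> u w" using m bary_facts(1)[of u w] by simp
        ultimately show "0 \<le> \<mu>' w" unfolding \<mu>'_def by linarith
      next
        show "sum \<mu>' S = 1" unfolding \<mu>'_def using ex[of "\<lambda>_. 1::real"] mu(2) bary_facts(3)[of u] by simp
        show "(\<Sum>w\<in>S. \<mu>' w *\<^sub>R w) = z" unfolding \<mu>'_def using ex[of "\<lambda>w. w"] mu(3) bary_facts(4)[of u] by (simp add: u_def)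
      qed
      moreover have "(\<Sum>w\<in>S. \<mu>' w * F w) = (\<Sum>w\<in>S. \<mu> w * F w) - m * (F x + F y) + 2 * m * (\<Sum>v\<in>cverts u. bary \<Phi> u v * F v)"
        unfolding \<mu>'_def using ex[of F] by simp
      moreover have "2 * (\<Sum>v\<in>cverts u. bary \<Phi> u v * F v) < F x + F y"
      proof -
        have "(\<Sum>v\<in>cverts u. bary \<Phi> u v * F v) = lovasz_val u + \<epsilon> * (\<Sum>v\<in>cverts u. bary \<Phi> u v * height v)"
          unfolding F_def lovasz_val_def by (simp add: distrib_left sum.distrib sum_distrib_left mult.left_commute)
        moreover have "\<epsilon> * (2 * (\<Sum>v\<in>cverts u. bary \<Phi> u v * height v)) < \<epsilon> * (height x + height y)"
          using height_midpoint[OF u_def a] s eps by (intro mult_strict_left_mono) auto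
        ultimately show ?thesis using uD(2) unfolding F_def by (simp add: algebra_simps)
      qed
      then have "m * (2 * (\<Sum>v\<in>cverts u. bary \<Phi> u v * F v)) < m * (F x + F y)"
        using m by (intro mult_strict_left_mono)
      ultimately show False by (simp add: algebra_simps)
    qed
    have W'S: "W' \<subseteq> S" unfolding W'_def by blast
    have rest: "\<mu> w = 0" if "w \<in> S - W'" for w using mu(1)[of w] that unfolding W'_def by force
    have restr: "(\<Sum>w\<in>S. \<mu> w * h w) = (\<Sum>w\<in>W'. \<mu> w * h w)" for h
      using rest W'S by (intro sum.mono_neutral_right finS) auto
    have restr': "(\<Sum>w\<in>S. \<mu> w *\<^sub>R w) = (\<Sum>w\<in>W'. \<mu> w *\<^sub>R w)"
      using rest W'S by (intro sum.mono_neutral_right finS) auto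
    have s1: "sum \<mu> W' = 1" using restr[of "\<lambda>_. 1"] mu(2) by simp
    have s2: "(\<Sum>w\<in>W'. \<mu> w *\<^sub>R w) = z" using restr' mu(3) by simp
    \<comment> \<open>If a vertex of positive weight exceeded an integer bound valid at
      \<open>z\<close>, then, without separated pairs, all the others would lie weakly above it too,
      and so would force \<open>z\<close> strictly beyond the bound.\<close>
    have "W' \<subseteq> cverts z"
    proof
      fix w assume w: "w \<in> W'"
      have "w \<in> closed_cell z" unfolding closed_cell_def
      proof (intro CollectI ballI allI impI, rule ccontr)
        fix \<alpha> and k :: int assume a: "\<alpha> \<in> \<Phi>" "blinfun_apply \<alpha> z \<le> k" "\<not> blinfun_apply \<alpha> w \<le> k"
        have ge: "k \<le> blinfun_apply \<alpha> w'" if "w' \<in> W'" for w'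
          using nosep[OF a(1) that w, of k] a(3) by linarith
        have "0 < (\<Sum>w\<in>W'. \<mu> w * (blinfun_apply \<alpha> w - k))"
        proof (rule sum_pos2)
          show "finite W'" using W'S finS finite_subset by blast
          show "w \<in> W'" by fact
          show "0 < \<mu> w * (blinfun_apply \<alpha> w - k)" using w a(3) unfolding W'_def by simp
          show "0 \<le> \<mu> v * (blinfun_apply \<alpha> v - k)" if "v \<in> W'" for v
            using ge[OF that] that unfolding W'_def by simp
        qed
        also have "\<dots> = blinfun_apply \<alpha> z - k"
          unfolding s2[symmetric] using s1 by (simp add: blinfun.sum_right blinfun.scaleR_right
              right_diff_distrib sum_subtractf sum_distrib_right[symmetric])
        finally show False using a(2) by simp
      qed
      then show "w \<in> cverts z" using w D_vertices unfolding cverts_iff W'_def S_def by blast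
    qed
    note u = bary_unique[OF this less_imp_le s1 s2]
    have pos: "0 < \<mu> w" if "w \<in> W'" for w using that unfolding W'_def by blast
    have "cverts z \<subseteq> D" using u(2)[OF pos] W'S unfolding S_def by blast
    moreover have "(\<Sum>v\<in>cverts z. bary \<Phi> z v * F v) \<le> (\<Sum>w\<in>S. l' w * F w)"
      using u(1)[OF pos, of F] restr[of F] least[OF l'] by simp
    ultimately show ?thesis unfolding F_def by blast
  qed
  have "lovasz_val z \<le> (\<Sum>w\<in>W. l w * fval w)"
  proof (rule ccontr)
    assume not: "\<not> ?thesis"
    define a where "a = (\<Sum>v\<in>cverts z. bary \<Phi> z v * height v)"
    define c where "c = (\<Sum>w\<in>S. l' w * height w)"
    have e: "lovasz_val z + \<epsilon> * a \<le> (\<Sum>w\<in>W. l w * fval w) + \<epsilon> * c" if "\<epsilon> > 0" for \<epsilon>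
      using key[OF that] ext[of fval]
      by (simp add: lovasz_val_def a_def c_def distrib_left sum.distrib sum_distrib_left mult.left_commute)
    define d where "d = lovasz_val z - (\<Sum>w\<in>W. l w * fval w)"
    have d: "d > 0" "\<And>\<epsilon>. \<epsilon> > 0 \<Longrightarrow> d \<le> \<epsilon> * (c - a)"
      using not e unfolding d_def by (simp_all add: algebra_simps)
    have "c - a > 0" using less_le_trans[OF d(1) d(2)[OF zero_less_one]] by simp
    \<comment> \<open>This value of \<open>\<epsilon>\<close> makes the right-hand side half of
      \<open>d\<close>, a contradiction for positive \<open>d\<close>.\<close>
    then have "d \<le> d / (2 * (c - a)) * (c - a)" using d(1) by (intro d(2)) simp
    also have "\<dots> = d / 2" using \<open>c - a > 0\<close> by (simp add: field_simps)
    finally show False using d(1) by simp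
  qed
  then show ?thesis using key[of 1] by simp
qed

text \<open>The barycentric weights of both end points are mixed on the union of their vertex sets,
  which gives a single combination to compare with.\<close>

lemma convex_of_midpoint:
  assumes mid: "\<And>x y. x \<in> D \<Longrightarrow> y \<in> D \<Longrightarrow> midpoint_ineq \<Phi> f x y"
  shows "convex_fun (lovasz \<Phi> f)"
  unfolding convex_fun_def
proof (rule convexI, safe)
  fix x y :: 'a and s t u v :: real
  assume x: "(x, s) \<in> epi (lovasz \<Phi> f)" and y: "(y, t) \<in> epi (lovasz \<Phi> f)"
    and uv: "0 \<le> u" "0 \<le> v" "u + v = 1"
  have xD: "cverts x \<subseteq> D" "lovasz_val x \<le> s" and yD: "cverts y \<subseteq> D" "lovasz_val y \<le> t" using x y unfolding epi_iff by auto
  let ?W = "cverts x \<union> cverts y" and ?l = "\<lambda>w. u * bary \<Phi> x w + v * bary \<Phi> y w"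
  have fW: "finite ?W" using cverts_facts(1) by blast
  have b0: "bary \<Phi> p w = 0" if "w \<notin> cverts p" for w p using bary_facts(2)[of p w] that by blast
  have part: "(\<Sum>w\<in>?W. bary \<Phi> p w * h w) = (\<Sum>w\<in>cverts p. bary \<Phi> p w * h w)" if "p \<in> {x, y}" for p h
    using that b0 by (intro sum.mono_neutral_right fW) auto
  have part': "(\<Sum>w\<in>?W. bary \<Phi> p w *\<^sub>R w) = p" if "p \<in> {x, y}" for p
  proof -
    have "(\<Sum>w\<in>?W. bary \<Phi> p w *\<^sub>R w) = (\<Sum>w\<in>cverts p. bary \<Phi> p w *\<^sub>R w)"
      using that b0 by (intro sum.mono_neutral_right fW) auto
    then show ?thesis using bary_facts(4)[of p] by simp
  qed
  have comb: "(\<Sum>w\<in>?W. ?l w * h w) = u * (\<Sum>w\<in>cverts x. bary \<Phi> x w * h w) + v * (\<Sum>w\<in>cverts y. bary \<Phi> y w * h w)" for h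
    unfolding part[of x h, symmetric, simplified] part[of y h, symmetric, simplified]
    by (simp add: distrib_right sum.distrib sum_distrib_left mult.assoc)
  have "cverts (u *\<^sub>R x + v *\<^sub>R y) \<subseteq> D \<and> lovasz_val (u *\<^sub>R x + v *\<^sub>R y) \<le> (\<Sum>w\<in>?W. ?l w * fval w)"
  proof (rule jensen[OF mid fW])
    show "?W \<subseteq> D" using xD yD by blast
    show "0 \<le> ?l w" for w using uv bary_facts(1) by simp
    show "sum ?l ?W = 1" using comb[of "\<lambda>_. 1"] bary_facts(3) uv by simp
    have "(\<Sum>w\<in>?W. ?l w *\<^sub>R w) = u *\<^sub>R (\<Sum>w\<in>?W. bary \<Phi> x w *\<^sub>R w) + v *\<^sub>R (\<Sum>w\<in>?W. bary \<Phi> y w *\<^sub>R w)"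
      by (simp add: scaleR_left_distrib sum.distrib scaleR_sum_right)
    then show "(\<Sum>w\<in>?W. ?l w *\<^sub>R w) = u *\<^sub>R x + v *\<^sub>R y" using part'[of x] part'[of y] by simp
  qed
  moreover have "(\<Sum>w\<in>?W. ?l w * fval w) \<le> u * s + v * t"
    unfolding comb lovasz_val_def[symmetric] using xD yD uv by (intro add_mono mult_left_mono)
  ultimately show "u *\<^sub>R (x, s) + v *\<^sub>R (y, t) \<in> epi (lovasz \<Phi> f)" by (simp add: epi_iff)
qed

lemma midpoint_of_convex:
  assumes c: "convex_fun (lovasz \<Phi> f)" and x: "x \<in> cvertices \<Phi>" and y: "y \<in> cvertices \<Phi>"
  shows "midpoint_ineq \<Phi> f x y"
proof (cases "x \<in> D \<and> y \<in> D")
  case False then show ?thesis using midpoint_ineq_trivial x y by blast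
next
  case True
  have v: "(w, fval w) \<in> epi (lovasz \<Phi> f)" if "w \<in> D" for w
    using that lovasz_vertex[of w f] f_D D_vertices unfolding epi_def by auto
  have "(1/2) *\<^sub>R (x, fval x) + (1/2) *\<^sub>R (y, fval y) \<in> epi (lovasz \<Phi> f)"
    using c v True unfolding convex_fun_def by (intro convexD) auto
  then have "cverts ((1/2) *\<^sub>R (x + y)) \<subseteq> D \<and> 2 * lovasz_val ((1/2) *\<^sub>R (x + y)) \<le> fval x + fval y"
    by (simp add: epi_iff scaleR_right_distrib)
  then show ?thesis using midpoint_ineq_D[OF _ _ refl] True by blast
qed

end

section \<open>Convexity of the Lovasz extension\<close>

lemma polytope_convex_Union:
  assumes "finite \<P>" "\<And>P. P \<in> \<P> \<Longrightarrow> polytope P" "convex (\<Union>\<P>)"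
  shows "polytope (\<Union>\<P>)"
proof -
  have "\<forall>P\<in>\<P>. \<exists>V. finite V \<and> P = convex hull V" using assms(2) unfolding polytope_def by blast
  then obtain V where V0: "\<forall>P\<in>\<P>. finite (V P) \<and> P = convex hull (V P)" by (rule bchoice[THEN exE])
  then have V: "finite (V P)" "convex hull (V P) = P" if "P \<in> \<P>" for P using that by blast+
  \<comment> \<open>Convexity of the union is what keeps the hull of all generators inside
    it.\<close>
  have "\<Union>\<P> = convex hull (\<Union>P\<in>\<P>. V P)"
  proof
    show "\<Union>\<P> \<subseteq> convex hull (\<Union>P\<in>\<P>. V P)"
    proof
      fix x assume "x \<in> \<Union>\<P>"
      then obtain P where P: "P \<in> \<P>" "x \<in> P" by blast
      then have "x \<in> convex hull (V P)" using V(2) by simp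
      then show "x \<in> convex hull (\<Union>P\<in>\<P>. V P)" using hull_mono[of "V P" "\<Union>P\<in>\<P>. V P"] P(1) by blast
    qed
    show "convex hull (\<Union>P\<in>\<P>. V P) \<subseteq> \<Union>\<P>"
    proof (rule hull_minimal)
      show "convex (\<Union>\<P>)" by (rule assms(3))
      have "V P \<subseteq> P" if "P \<in> \<P>" for P using hull_subset[of "V P" convex] V(2)[OF that] by simp
      then show "(\<Union>P\<in>\<P>. V P) \<subseteq> \<Union>\<P>" by blast
    qed
  qed
  moreover have "finite (\<Union>P\<in>\<P>. V P)" using assms(1) V(1) by blast
  ultimately show ?thesis unfolding polytope_def by blast
qed

text \<open>Convexity alone may fail to give subgradients at boundary points of the domain. Here the
  epigraph near the point is a polytope, so its tangent cone is finitely generated, hence closed,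
  and can be separated strictly from the downward direction.\<close>

lemma subgradient_exists:
  fixes h :: "'a::euclidean_space \<Rightarrow> ereal"
  assumes c: "convex (epi h)" and lp: "locally_polyhedral (epi h)"
    and nm: "\<And>y. h y \<noteq> -\<infinity>" and x: "h x = ereal \<eta>"
  shows "\<exists>p. \<forall>y. ereal (\<eta> + blinfun_apply p (y - x)) \<le> h y"
proof -
  define z where "z = (x, \<eta>)"
  let ?Q = "cbox (z - One) (z + One)"
  have zE: "z \<in> epi h" unfolding z_def epi_def using x by simp
  have zbox: "z \<in> box (z - One) (z + One)"
    by (simp add: mem_box inner_diff_left inner_add_left)
  have "polytope (epi h \<inter> ?Q)" using lp polytope_interval unfolding locally_polyhedral_def by blast
  then obtain F where F: "finite F" "epi h \<inter> ?Q = convex hull F" unfolding polytope_def by blast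
  define F' where "F' = (\<lambda>q. q - z) ` F"
  define T where "T = convex_cone hull F'"
  have "z \<in> convex hull F" using zE zbox box_subset_cbox F(2) by blast
  then have Fne: "F' \<noteq> {}" unfolding F'_def by auto
  have hullF': "convex hull F' = (\<lambda>q. q - z) ` (convex hull F)"
    unfolding F'_def using convex_hull_translation[of "- z" F] by simp
  have Tc: "closed T" unfolding T_def F'_def using F(1) by (intro closed_convex_cone_hull) simp
  have T: "T = (\<Union>q\<in>convex hull F'. \<Union>c\<in>{0..}. {c *\<^sub>R q})"
    unfolding T_def by (rule convex_cone_hull_convex_hull_nonempty[OF Fne])
  \<comment> \<open>A downward direction in the cone would give a point of the epigraph strictly
    below \<open>(x, \<eta>)\<close>.\<close>
  have low: "(0, -1) \<notin> T"
  proof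
    assume "(0, -1) \<in> T"
    then obtain q c' where q: "q \<in> convex hull F" "c' \<ge> 0" "(0, -1) = c' *\<^sub>R (q - z)"
      unfolding T hullF' by auto
    then have c': "c' > 0" by (cases "c' = 0") (auto simp: zero_prod_def)
    have "fst q = x" "c' * (snd q - \<eta>) = -1" using q(3) c' unfolding z_def by (auto simp: prod_eq_iff)
    moreover from this have "snd q < \<eta>"
      using c' by (metis mult_nonneg_nonneg diff_ge_0_iff_ge less_imp_le linorder_not_less neg_0_le_iff_le not_one_le_zero)
    moreover have "q \<in> epi h" using q(1) F(2) by blast
    ultimately have "h x \<le> ereal (snd q)" unfolding epi_def by auto
    then show False using x \<open>snd q < \<eta>\<close> by simp
  qed
  have "convex T" unfolding T_def by (rule convex_convex_cone_hull)
  from separating_hyperplane_closed_point[OF this Tc low]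
  obtain a b where ab: "a \<bullet> (0, -1) < b" "\<And>q. q \<in> T \<Longrightarrow> a \<bullet> q > b" by blast
  have scale: "c' *\<^sub>R q \<in> T" if "q \<in> T" "c' \<ge> 0" for q c'
    using that unfolding T_def by (simp add: convex_cone_hull_mul)
  have "0 \<in> T" unfolding T_def by (rule convex_cone_hull_contains_0)
  then have b0: "b < 0" using ab(2)[of 0] by simp
  have nonneg: "a \<bullet> q \<ge> 0" if q: "q \<in> T" for q
  proof (rule ccontr)
    assume n: "\<not> ?thesis"
    then have "(b / (a \<bullet> q)) *\<^sub>R q \<in> T" using b0 by (intro scale q) (simp add: zero_le_divide_iff)
    then have "a \<bullet> ((b / (a \<bullet> q)) *\<^sub>R q) > b" by (rule ab(2))
    then show False using n by simp
  qed
  \<comment> \<open>Separating \<open>(0, -1)\<close> from the cone makes the last coordinate of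
    \<open>a\<close> positive: the hyperplane is not vertical, and dividing by \<open>s\<close> will
    give a slope.\<close>
  define s where "s = snd a"
  have s: "s > 0" using ab(1) b0 unfolding s_def by (simp add: inner_prod_def)
  have local: "fst a \<bullet> (y - x) + s * (t - \<eta>) \<ge> 0" if "(y, t) \<in> epi h \<inter> ?Q" for y t
  proof -
    have "(y, t) - z \<in> convex hull F'" unfolding hullF' using that F(2) by blast
    then have "(y, t) - z \<in> T" unfolding T_def using convex_hull_subset_convex_cone_hull by blast
    from nonneg[OF this] show ?thesis unfolding s_def z_def by (simp add: inner_prod_def)
  qed
  \<comment> \<open>By convexity a point near \<open>z\<close> on the segment to
    \<open>(y, t)\<close> is in the epigraph and in the box; the inequality scales along the
    segment.\<close>
  have global: "fst a \<bullet> (y - x) + s * (t - \<eta>) \<ge> 0" if yt: "(y, t) \<in> epi h" for y t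
  proof -
    have "((\<lambda>e. z + e *\<^sub>R ((y, t) - z)) \<longlongrightarrow> z + 0 *\<^sub>R ((y, t) - z)) (at_right (0::real))"
      by (intro tendsto_intros)
    then have "((\<lambda>e. z + e *\<^sub>R ((y, t) - z)) \<longlongrightarrow> z) (at_right (0::real))" by simp
    then have "\<forall>\<^sub>F e::real in at_right 0. z + e *\<^sub>R ((y, t) - z) \<in> box (z - One) (z + One)"
      using zbox by (intro topological_tendstoD open_box)
    then have "\<forall>\<^sub>F e::real in at_right 0. z + e *\<^sub>R ((y, t) - z) \<in> box (z - One) (z + One) \<and> e \<in> {0<..<1}"
      by (intro eventually_conj eventually_at_right_real) auto
    then obtain e :: real where e: "z + e *\<^sub>R ((y, t) - z) \<in> box (z - One) (z + One)" "0 < e" "e < 1"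
      using eventually_happens'[OF trivial_limit_at_right_real] by fastforce
    have "z + e *\<^sub>R ((y, t) - z) \<in> epi h"
      using convexD_alt[OF c zE yt, of e] e by (simp add: algebra_simps)
    then have "z + e *\<^sub>R ((y, t) - z) \<in> epi h \<inter> ?Q" using e(1) box_subset_cbox by blast
    moreover have "z + e *\<^sub>R ((y, t) - z) = (x + e *\<^sub>R (y - x), \<eta> + e * (t - \<eta>))" unfolding z_def by simp
    ultimately have "fst a \<bullet> (x + e *\<^sub>R (y - x) - x) + s * (\<eta> + e * (t - \<eta>) - \<eta>) \<ge> 0"
      using local by metis
    then have "e * (fst a \<bullet> (y - x) + s * (t - \<eta>)) \<ge> 0"
      by (simp add: distrib_left mult.left_commute)
    then show ?thesis using e(2) by (simp add: zero_le_mult_iff)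
  qed
  define p where "p = blinfun_inner_left (- (1/s) *\<^sub>R fst a)"
  show ?thesis
  proof (intro exI[of _ p] allI)
    fix y
    show "ereal (\<eta> + blinfun_apply p (y - x)) \<le> h y"
    proof (cases "h y")
      case (real t)
      then have "(y, t) \<in> epi h" unfolding epi_def by simp
      from global[OF this] have "s * (t - \<eta>) \<ge> - (fst a \<bullet> (y - x))" by simp
      then have "t - \<eta> \<ge> - (fst a \<bullet> (y - x)) / s" using s by (simp add: field_simps)
      then show ?thesis unfolding real p_def by (simp add: inner_commute)
    qed (use nm in auto)
  qed
qed

context irreducible_root_system
begin

text \<open>The coordinates of an alcove having the cell as a face are affine functions; weighting
  them with the values of \<open>g\<close> interpolates.\<close>

lemma affine_interpolation:
  fixes g :: "'a \<Rightarrow> real"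
  shows "\<exists>p c. \<forall>v\<in>cverts x. g v = blinfun_apply p v + c"
proof -
  obtain S a \<kappa> where C: "chamber \<Phi> S a \<kappa>" and x: "\<forall>w\<in>S. \<kappa> w \<le> blinfun_apply (a w) x"
    and vx: "cverts x = {w\<in>S. \<kappa> w < blinfun_apply (a w) x}" by (rule chamber_at[of x])
  interpret C: chamber \<Phi> S a \<kappa> by (rule C)
  define den where "den = (\<lambda>w. blinfun_apply (a w) w - \<kappa> w)"
  define p where "p = (\<Sum>w\<in>S. (g w / den w) *\<^sub>R a w)"
  define c where "c = - (\<Sum>w\<in>S. g w / den w * \<kappa> w)"
  have "g v = blinfun_apply p v + c" if v: "v \<in> S" for v
  proof -
    have "blinfun_apply p v + c = (\<Sum>w\<in>S. g w / den w * (blinfun_apply (a w) v - \<kappa> w))"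
      unfolding p_def c_def by (simp add: blinfun.sum_left blinfun.scaleR_left right_diff_distrib sum_subtractf)
    also have "\<dots> = (\<Sum>w\<in>S. if w = v then g v else 0)"
      using v C.wall_on[OF _ v] C.wall_above[OF v] by (intro sum.cong refl) (auto simp: den_def)
    also have "\<dots> = g v" using C.finite_S v by simp
    finally show ?thesis by simp
  qed
  then show ?thesis using vx by blast
qed

text \<open>Among the integral bounds for a root the least one implies the others, so a closed cell
  is a finite intersection of half-spaces.\<close>

lemma closed_cell_ceiling: "closed_cell x = {y. \<forall>\<alpha>\<in>\<Phi>. blinfun_apply \<alpha> y \<le> \<lceil>blinfun_apply \<alpha> x\<rceil>}"
proof -
  have "blinfun_apply \<alpha> y \<le> k" if "blinfun_apply \<alpha> x \<le> k" "blinfun_apply \<alpha> y \<le> \<lceil>blinfun_apply \<alpha> x\<rceil>" for \<alpha> y and k :: int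
    using that by (meson ceiling_le_iff of_int_le_iff order_trans)
  then show ?thesis unfolding closed_cell_def by (auto intro: le_of_int_ceiling)
qed

text \<open>In the affine coordinates of \<open>cverts x\<close>, the vertex \<open>v'\<close> has a
  negative coefficient at \<open>v\<close> and nonnegative ones on the facet. Whether the former is
  at least -1 decides on which side of the wall the midpoint lies.\<close>

lemma midpoint_across_facet:
  fixes \<alpha> :: "'a \<Rightarrow>\<^sub>L real"
  assumes v: "v \<in> cverts x" and x': "cverts x' = insert v' (cverts x - {v})"
    and \<alpha>: "\<And>f. f \<in> cverts x - {v} \<Longrightarrow> blinfun_apply \<alpha> f = of_int k"
      "blinfun_apply \<alpha> v > of_int k" "blinfun_apply \<alpha> v' < of_int k"
    and aff: "v' \<in> affine hull (cverts x)"
  shows "(1/2) *\<^sub>R (v + v') \<in> closed_cell x \<union> closed_cell x'"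
proof -
  let ?A = "cverts x" let ?F = "cverts x - {v}"
  have fA: "finite ?A" and fF: "finite ?F" using cverts_facts(1) by auto
  have v'F: "v' \<notin> ?F"
  proof
    assume "v' \<in> ?F"
    from \<alpha>(1)[OF this] show False using \<alpha>(3) by simp
  qed
  obtain \<mu> where m: "sum \<mu> ?A = 1" "(\<Sum>f\<in>?A. \<mu> f *\<^sub>R f) = v'"
    using aff unfolding affine_hull_finite[OF fA] by blast
  have mF: "sum \<mu> ?F = 1 - \<mu> v" using m(1) fA v by (simp add: sum_diff1)
  have vF: "(\<Sum>f\<in>?F. \<mu> f *\<^sub>R f) = v' - \<mu> v *\<^sub>R v" using m(2) fA v by (simp add: sum_diff1)
  have eval: "blinfun_apply \<beta> v' - l = \<mu> v * (blinfun_apply \<beta> v - l) + (\<Sum>f\<in>?F. \<mu> f * (blinfun_apply \<beta> f - l))" for \<beta> l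
  proof -
    have "blinfun_apply \<beta> v' - l = (\<Sum>f\<in>?A. \<mu> f * (blinfun_apply \<beta> f - l))"
      unfolding m(2)[symmetric] using m(1)
      by (simp add: blinfun.sum_right blinfun.scaleR_right right_diff_distrib sum_subtractf sum_distrib_right[symmetric])
    then show ?thesis using fA v by (simp add: sum.remove)
  qed
  have "(\<Sum>f\<in>?F. \<mu> f * (blinfun_apply \<alpha> f - k)) = 0" using \<alpha>(1) by (intro sum.neutral) auto
  then have "\<mu> v * (blinfun_apply \<alpha> v - k) < 0" using eval[of \<alpha> k] \<alpha>(3) by linarith
  then have neg: "\<mu> v < 0" using \<alpha>(2) by (simp add: mult_less_0_iff)
  \<comment> \<open>The wall of \<open>x'\<close> opposite \<open>f\<close> contains
    \<open>v'\<close> and the rest of the facet and has \<open>f\<close> and \<open>v\<close> weakly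
    on one side. As the coefficient at \<open>v\<close> is negative, the one at \<open>f\<close>
    must balance it and cannot be negative.\<close>
  have nonneg: "0 \<le> \<mu> f" if f: "f \<in> ?F" for f
  proof -
    have fx': "f \<in> cverts x'" using f x' by blast
    obtain \<beta> l where b: "\<beta> \<in> \<Phi>" "\<And>f'. f' \<in> cverts x' - {f} \<Longrightarrow> blinfun_apply \<beta> f' = of_int l" "blinfun_apply \<beta> f > of_int l"
      by (rule facet_wall[OF fx']) blast
    have "v' \<in> cverts x' - {f}" using x' v'F f by blast
    then have "blinfun_apply \<beta> v' = l" by (rule b(2))
    have "\<not> blinfun_apply \<beta> x \<le> l"
      using closed_cellD[OF cverts_in_closed_cell b(1), of f x l] f b(3) by fastforce
    then have bv: "l \<le> blinfun_apply \<beta> v"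
      using closed_cellD_ge[OF cverts_in_closed_cell[OF v] b(1), of l] by linarith
    have "(\<Sum>f'\<in>?F. \<mu> f' * (blinfun_apply \<beta> f' - l)) = \<mu> f * (blinfun_apply \<beta> f - l)"
    proof -
      have "(\<Sum>f'\<in>?F - {f}. \<mu> f' * (blinfun_apply \<beta> f' - l)) = 0"
        using b(2) x' by (intro sum.neutral) auto
      then show ?thesis using fF f by (simp add: sum.remove[of ?F f])
    qed
    then have "\<mu> f * (blinfun_apply \<beta> f - l) = - (\<mu> v * (blinfun_apply \<beta> v - l))"
      using eval[of \<beta> l] \<open>blinfun_apply \<beta> v' = l\<close> by simp
    moreover have "\<mu> v * (blinfun_apply \<beta> v - l) \<le> 0" using neg bv by (simp add: mult_nonpos_nonneg)
    ultimately have "0 \<le> \<mu> f * (blinfun_apply \<beta> f - l)" by linarith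
    then show ?thesis using b(3) by (simp add: zero_le_mult_iff)
  qed
  show ?thesis
  proof (cases "\<mu> v \<ge> -1")
    case True
    \<comment> \<open>The average of the coordinates of \<open>v'\<close> and a unit mass at
      \<open>v\<close>; its value at \<open>v\<close> is \<open>(1 + \<mu> v) / 2\<close>.\<close>
    define \<nu> where "\<nu> = (\<lambda>f. (\<mu> f + of_bool (f = v)) / 2)"
    have F\<nu>: "\<nu> f = \<mu> f / 2" if "f \<in> ?F" for f using that unfolding \<nu>_def by simp
    have "(1/2) *\<^sub>R (v + v') \<in> convex hull ?A"
      unfolding convex_hull_finite[OF fA]
    proof (intro CollectI exI[of _ \<nu>] conjI ballI)
      show "0 \<le> \<nu> f" if "f \<in> ?A" for f using that nonneg[of f] True unfolding \<nu>_def by (cases "f = v") auto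
      have "sum \<nu> ?F = sum \<mu> ?F / 2" unfolding sum_divide_distrib using F\<nu> by (intro sum.cong) auto
      then show "sum \<nu> ?A = 1" using fA v mF by (simp add: sum.remove[of ?A v] \<nu>_def field_simps)
      have "(\<Sum>f\<in>?F. \<nu> f *\<^sub>R f) = (1/2) *\<^sub>R (\<Sum>f\<in>?F. \<mu> f *\<^sub>R f)"
        unfolding scaleR_sum_right using F\<nu> by (intro sum.cong) auto
      then have "(\<Sum>f\<in>?A. \<nu> f *\<^sub>R f) = \<nu> v *\<^sub>R v + (1/2) *\<^sub>R (v' - \<mu> v *\<^sub>R v)"
        using fA v unfolding vF by (simp add: sum.remove[of ?A v])
      also have "\<dots> = (1/2) *\<^sub>R (v + v')" unfolding \<nu>_def by (simp add: algebra_simps add_divide_distrib)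
      finally show "(\<Sum>f\<in>?A. \<nu> f *\<^sub>R f) = (1/2) *\<^sub>R (v + v')" .
    qed
    then show ?thesis unfolding cverts_facts(3) by blast
  next
    case False
    define c where "c = - \<mu> v"
    have c: "c > 1" "\<mu> v = - c" using False unfolding c_def by auto
    \<comment> \<open>Solving for \<open>v\<close> gives the facet combination minus
      \<open>v'\<close>, divided by \<open>c\<close>. Averaging with \<open>v'\<close> leaves the
      weight \<open>(1 - 1/c) / 2\<close> at \<open>v'\<close>, positive as
      \<open>c > 1\<close>.\<close>
    define \<nu> where "\<nu> = (\<lambda>f. if f = v' then (1 - 1/c) / 2 else \<mu> f / (2 * c))"
    have F\<nu>: "\<nu> f = \<mu> f / (2 * c)" if "f \<in> ?F" for f using that v'F unfolding \<nu>_def by auto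
    have \<nu>v': "\<nu> v' = (1 - 1/c) / 2" unfolding \<nu>_def by simp
    have "(1/2) *\<^sub>R (v + v') \<in> convex hull (insert v' ?F)"
      unfolding convex_hull_finite[OF finite.insertI[OF fF]]
    proof (intro CollectI exI[of _ \<nu>] conjI ballI)
      show "0 \<le> \<nu> f" if "f \<in> insert v' ?F" for f
        using that nonneg[of f] c unfolding \<nu>_def by auto
      have "sum \<nu> ?F = sum \<mu> ?F / (2 * c)" unfolding sum_divide_distrib using F\<nu> by (intro sum.cong) auto
      then have "sum \<nu> (insert v' ?F) = (1 - 1/c) / 2 + (1 + c) / (2 * c)"
        using fF v'F mF c \<nu>v' by simp
      also have "\<dots> = 1" using c by (simp add: field_simps)
      finally show "sum \<nu> (insert v' ?F) = 1" .
      have "(\<Sum>f\<in>?F. \<nu> f *\<^sub>R f) = (1 / (2 * c)) *\<^sub>R (\<Sum>f\<in>?F. \<mu> f *\<^sub>R f)"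
        unfolding scaleR_sum_right using F\<nu> by (intro sum.cong) auto
      then have "(\<Sum>f\<in>insert v' ?F. \<nu> f *\<^sub>R f) = \<nu> v' *\<^sub>R v' + (1 / (2 * c)) *\<^sub>R (v' + c *\<^sub>R v)"
        using fF v'F c unfolding vF by simp
      also have "\<dots> = ((1 - 1/c) / 2 + 1 / (2 * c)) *\<^sub>R v' + (1 / (2 * c) * c) *\<^sub>R v"
        unfolding \<nu>v' by (simp add: scaleR_right_distrib scaleR_left_distrib)
      also have "(1 - 1/c) / 2 + 1 / (2 * c) = 1/2" using c by (simp add: field_simps)
      also have "1 / (2 * c) * c = 1/2" using c by simp
      finally show "(\<Sum>f\<in>insert v' ?F. \<nu> f *\<^sub>R f) = (1/2) *\<^sub>R (v + v')"
        by (simp add: scaleR_right_distrib add.commute)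
    qed
    then show ?thesis unfolding cverts_facts(3)[of x'] x' by blast
  qed
qed

end

context vertex_function
begin

section \<open>Domain, epigraph and argmin sets of the Lovasz extension\<close>

definition lovasz_dom :: "'a set" where "lovasz_dom = {x. cverts x \<subseteq> D}"

lemma cell_closed_lovasz_dom: "cell_closed lovasz_dom"
  unfolding cell_closed_def lovasz_dom_def using cverts_mono by blast

lemma lovasz_dom_nonempty: "lovasz_dom \<noteq> {}"
proof -
  obtain v where "v \<in> D" using dom_nonempty by blast
  then have "v \<in> lovasz_dom" unfolding lovasz_dom_def using cvertices_cverts[of v] D_vertices by auto
  then show ?thesis by blast
qed

lemma lovasz_dom_vertices: "lovasz_dom \<inter> cvertices \<Phi> = D"
  unfolding lovasz_dom_def using cvertices_cverts D_vertices by auto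

lemma lovasz_val_vertex: "v \<in> D \<Longrightarrow> lovasz_val v = fval v"
proof -
  assume "v \<in> D"
  then have v: "cverts v = {v}" using cvertices_cverts D_vertices by blast
  then show ?thesis using bary_facts(3)[of v] unfolding lovasz_val_def v by simp
qed

lemma lovasz_val_affine:
  assumes fval: "\<And>v. v \<in> cverts x \<Longrightarrow> fval v = blinfun_apply p v + c" and y: "y \<in> closed_cell x"
  shows "lovasz_val y = blinfun_apply p y + c"
proof -
  have "lovasz_val y = (\<Sum>v\<in>cverts y. bary \<Phi> y v * (blinfun_apply p v + c))"
    unfolding lovasz_val_def using fval cverts_mono[OF y] by (intro sum.cong) auto
  also have "\<dots> = (\<Sum>v\<in>cverts y. bary \<Phi> y v * blinfun_apply p v) + (\<Sum>v\<in>cverts y. bary \<Phi> y v) * c"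
    by (simp add: distrib_left sum.distrib sum_distrib_right)
  finally show ?thesis by (simp add: bary_apply bary_facts(3))
qed

lemma convex_fun_iff:
  "convex_fun (lovasz \<Phi> f) \<longleftrightarrow> (\<forall>x\<in>lovasz_dom. \<forall>y\<in>lovasz_dom. \<forall>u v. 0 \<le> u \<and> 0 \<le> v \<and> u + v = 1 \<longrightarrow>
     u *\<^sub>R x + v *\<^sub>R y \<in> lovasz_dom \<and> lovasz_val (u *\<^sub>R x + v *\<^sub>R y) \<le> u * lovasz_val x + v * lovasz_val y)" (is "_ \<longleftrightarrow> ?R")
proof
  assume c: "convex_fun (lovasz \<Phi> f)"
  show ?R
  proof (intro ballI allI impI)
    fix x y and u v :: real assume x: "x \<in> lovasz_dom" and y: "y \<in> lovasz_dom" and uv: "0 \<le> u \<and> 0 \<le> v \<and> u + v = 1"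
    have "(x, lovasz_val x) \<in> epi (lovasz \<Phi> f)" "(y, lovasz_val y) \<in> epi (lovasz \<Phi> f)"
      using x y unfolding epi_iff lovasz_dom_def by auto
    then have "u *\<^sub>R (x, lovasz_val x) + v *\<^sub>R (y, lovasz_val y) \<in> epi (lovasz \<Phi> f)"
      using c uv unfolding convex_fun_def by (intro convexD) auto
    then show "u *\<^sub>R x + v *\<^sub>R y \<in> lovasz_dom \<and> lovasz_val (u *\<^sub>R x + v *\<^sub>R y) \<le> u * lovasz_val x + v * lovasz_val y"
      by (simp add: epi_iff lovasz_dom_def)
  qed
next
  assume R: ?R
  show "convex_fun (lovasz \<Phi> f)" unfolding convex_fun_def
  proof (rule convexI, safe)
    fix x y :: 'a and s t u v :: real
    assume x: "(x, s) \<in> epi (lovasz \<Phi> f)" and y: "(y, t) \<in> epi (lovasz \<Phi> f)"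
      and uv: "0 \<le> u" "0 \<le> v" "u + v = 1"
    have xK: "x \<in> lovasz_dom" "lovasz_val x \<le> s" "y \<in> lovasz_dom" "lovasz_val y \<le> t" using x y unfolding epi_iff lovasz_dom_def by auto
    then have r: "u *\<^sub>R x + v *\<^sub>R y \<in> lovasz_dom" "lovasz_val (u *\<^sub>R x + v *\<^sub>R y) \<le> u * lovasz_val x + v * lovasz_val y" using R uv by blast+
    have "u * lovasz_val x + v * lovasz_val y \<le> u * s + v * t" using xK uv by (intro add_mono mult_left_mono)
    then show "u *\<^sub>R (x, s) + v *\<^sub>R (y, t) \<in> epi (lovasz \<Phi> f)" using r by (simp add: epi_iff lovasz_dom_def)
  qed
qed

lemma convex_lovasz_dom: "convex_fun (lovasz \<Phi> f) \<Longrightarrow> convex lovasz_dom"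
  unfolding convex_fun_iff convex_def by blast

lemma L_convex_set_dom:
  assumes "convex_fun (lovasz \<Phi> f)"
  shows "L_convex_set \<Phi> D"
  unfolding L_convex_set_def
  using polyhedron_of_cell_closed[OF convex_lovasz_dom[OF assms] cell_closed_lovasz_dom lovasz_dom_nonempty] lovasz_dom_vertices dom_nonempty
  by blast

lemma polyhedron_epi_cell:
  fixes p :: "'a \<Rightarrow>\<^sub>L real"
  shows "polyhedron {(y, t). y \<in> closed_cell x \<and> blinfun_apply p y + c \<le> t}"
proof -
  have "{(y, t). y \<in> closed_cell x \<and> blinfun_apply p y + c \<le> t}
     = \<Inter>((\<lambda>\<alpha>. {q. (riesz \<alpha>, 0::real) \<bullet> q \<le> \<lceil>blinfun_apply \<alpha> x\<rceil>}) ` \<Phi>) \<inter> {q. (riesz p, -1::real) \<bullet> q \<le> - c}"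
    unfolding closed_cell_ceiling by (auto simp: inner_prod_def riesz_inner)
  also have "polyhedron \<dots>"
    using finite_roots by (intro polyhedron_Int polyhedron_Inter polyhedron_halfspace_le) (auto intro: polyhedron_halfspace_le)
  finally show ?thesis .
qed

text \<open>A polytope meets the epigraph over finitely many cells only, and over each closed cell
  the epigraph is a polyhedron. Convexity merges these pieces into one polytope.\<close>

lemma locally_polyhedral_lovasz:
  assumes c: "convex_fun (lovasz \<Phi> f)"
  shows "locally_polyhedral (epi (lovasz \<Phi> f))"
  unfolding locally_polyhedral_def
proof (intro allI impI)
  fix Q :: "('a \<times> real) set" assume Q: "polytope Q"
  have "bounded (fst ` Q)" using polytope_imp_bounded[OF Q] by (rule bounded_fst)
  then obtain N where N: "fst ` Q \<subseteq> root_box N" using bounded_subset_root_box by blast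
  \<comment> \<open>Indexing the pieces by vertex sets rather than by points makes the family
    finite.\<close>
  define E where "E = (\<lambda>V. {(y, t). y \<in> convex hull V \<and> lovasz_val y \<le> t})"
  define \<V> where "\<V> = cverts ` (lovasz_dom \<inter> root_box N)"
  have "\<V> \<subseteq> Pow (cvertices \<Phi> \<inter> root_box N)"
    unfolding \<V>_def using cverts_vertex(3) cverts_in_closed_cell root_box_closed_cell by blast
  then have fin: "finite \<V>" using finite_vertices_root_box finite_subset by blast
  have E: "E (cverts x) = {(y, t). y \<in> closed_cell x \<and> lovasz_val y \<le> t}" for x
    unfolding E_def cverts_facts(3) ..
  have "epi (lovasz \<Phi> f) \<inter> Q = \<Union>((\<lambda>V. E V \<inter> Q) ` \<V>)"
  proof (intro equalityI subsetI)
    fix q assume q: "q \<in> epi (lovasz \<Phi> f) \<inter> Q"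
    then have "(fst q, snd q) \<in> epi (lovasz \<Phi> f)" by simp
    then have "fst q \<in> lovasz_dom" "lovasz_val (fst q) \<le> snd q" unfolding epi_iff lovasz_dom_def by auto
    moreover have "fst q \<in> root_box N" using q N by blast
    moreover have "fst q \<in> closed_cell (fst q)" by (rule closed_cell_refl)
    ultimately have "cverts (fst q) \<in> \<V>" "q \<in> E (cverts (fst q))" unfolding \<V>_def E by auto
    then show "q \<in> \<Union>((\<lambda>V. E V \<inter> Q) ` \<V>)" using q by blast
  next
    fix q assume "q \<in> \<Union>((\<lambda>V. E V \<inter> Q) ` \<V>)"
    then obtain x where x: "x \<in> lovasz_dom" "q \<in> E (cverts x)" "q \<in> Q" unfolding \<V>_def by blast
    then have "fst q \<in> closed_cell x" "lovasz_val (fst q) \<le> snd q" unfolding E by auto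
    then have "fst q \<in> lovasz_dom" "lovasz_val (fst q) \<le> snd q" using cell_closed_lovasz_dom x(1) unfolding cell_closed_def by blast+
    then have "(fst q, snd q) \<in> epi (lovasz \<Phi> f)" unfolding epi_iff lovasz_dom_def by simp
    then show "q \<in> epi (lovasz \<Phi> f) \<inter> Q" using x by simp
  qed
  moreover have "polytope (\<Union>((\<lambda>V. E V \<inter> Q) ` \<V>))"
  proof (rule polytope_convex_Union)
    show "finite ((\<lambda>V. E V \<inter> Q) ` \<V>)" using fin by simp
    show "convex (\<Union>((\<lambda>V. E V \<inter> Q) ` \<V>))"
      unfolding calculation[symmetric] using c polytope_imp_convex[OF Q] unfolding convex_fun_def by (rule convex_Int)
    fix P assume "P \<in> (\<lambda>V. E V \<inter> Q) ` \<V>"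
    then obtain x where P: "P = E (cverts x) \<inter> Q" unfolding \<V>_def by blast
    obtain p c where pc: "\<forall>v\<in>cverts x. fval v = blinfun_apply p v + c" using affine_interpolation by blast
    have "E (cverts x) = {(y, t). y \<in> closed_cell x \<and> blinfun_apply p y + c \<le> t}"
      unfolding E using lovasz_val_affine[of x p c] pc by auto
    then have "polyhedron (E (cverts x))" using polyhedron_epi_cell by simp
    then show "polytope P" unfolding P using polytope_Int_polyhedron[OF Q] by (subst Int_commute)
  qed
  ultimately show "polytope (epi (lovasz \<Phi> f) \<inter> Q)" by simp
qed

lemma lovasz_real: "x \<in> lovasz_dom \<Longrightarrow> lovasz \<Phi> f x = ereal (lovasz_val x)"
  and lovasz_outside: "x \<notin> lovasz_dom \<Longrightarrow> lovasz \<Phi> f x = \<infinity>"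
  unfolding lovasz_dom_def using lovasz_D lovasz_not_D by auto

lemma argmin_lovasz:
  "argmin_lin (lovasz \<Phi> f) p = {x\<in>lovasz_dom. \<forall>y\<in>lovasz_dom. lovasz_val x - blinfun_apply p x \<le> lovasz_val y - blinfun_apply p y}"
proof (intro equalityI subsetI)
  fix x assume x: "x \<in> argmin_lin (lovasz \<Phi> f) p"
  have le: "lovasz \<Phi> f x - ereal (blinfun_apply p x) \<le> lovasz \<Phi> f y - ereal (blinfun_apply p y)" for y
    using x unfolding argmin_lin_def by blast
  have xK: "x \<in> lovasz_dom"
  proof (rule ccontr)
    assume "x \<notin> lovasz_dom"
    obtain y where "y \<in> lovasz_dom" using lovasz_dom_nonempty by blast
    then show False using le[of y] lovasz_real lovasz_outside[OF \<open>x \<notin> lovasz_dom\<close>] by simp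
  qed
  have "lovasz_val x - blinfun_apply p x \<le> lovasz_val y - blinfun_apply p y" if "y \<in> lovasz_dom" for y
    using le[of y] lovasz_real[OF that] lovasz_real[OF xK] by simp
  then show "x \<in> {x\<in>lovasz_dom. \<forall>y\<in>lovasz_dom. lovasz_val x - blinfun_apply p x \<le> lovasz_val y - blinfun_apply p y}" using xK by blast
next
  fix x assume x: "x \<in> {x\<in>lovasz_dom. \<forall>y\<in>lovasz_dom. lovasz_val x - blinfun_apply p x \<le> lovasz_val y - blinfun_apply p y}"
  have "lovasz \<Phi> f x - ereal (blinfun_apply p x) \<le> lovasz \<Phi> f y - ereal (blinfun_apply p y)" for y
  proof (cases "y \<in> lovasz_dom")
    case True then show ?thesis using x lovasz_real by simp
  next
    case False then show ?thesis using lovasz_outside by simp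
  qed
  then show "x \<in> argmin_lin (lovasz \<Phi> f) p" unfolding argmin_lin_def by blast
qed

text \<open>At a minimiser, the excesses over the minimum at the vertices of its cell are
  nonnegative with weighted mean zero. All weights being positive, they vanish, and the whole closed
  cell consists of minimisers.\<close>

lemma argmin_polyhedron:
  assumes c: "convex_fun (lovasz \<Phi> f)" and ne: "argmin_lin (lovasz \<Phi> f) p \<noteq> {}"
  shows "int_L_convex_polyhedron \<Phi> (argmin_lin (lovasz \<Phi> f) p)" (is "int_L_convex_polyhedron \<Phi> ?P")
proof (rule polyhedron_of_cell_closed[OF _ _ ne])
  show "convex ?P"
  proof (rule convexI)
    fix x y and u v :: real assume x: "x \<in> ?P" and y: "y \<in> ?P" and uv: "0 \<le> u" "0 \<le> v" "u + v = 1"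
    let ?z = "u *\<^sub>R x + v *\<^sub>R y"
    have xK: "x \<in> lovasz_dom" "y \<in> lovasz_dom" using x y unfolding argmin_lovasz by auto
    then have z: "?z \<in> lovasz_dom" "lovasz_val ?z \<le> u * lovasz_val x + v * lovasz_val y" using c uv unfolding convex_fun_iff by blast+
    have eq: "lovasz_val x - blinfun_apply p x = lovasz_val y - blinfun_apply p y"
      using x y unfolding argmin_lovasz by (auto intro: antisym)
    have "lovasz_val ?z - blinfun_apply p ?z \<le> u * (lovasz_val x - blinfun_apply p x) + v * (lovasz_val y - blinfun_apply p y)"
      using z(2) by (simp add: blinfun.add_right blinfun.scaleR_right algebra_simps)
    also have "\<dots> = lovasz_val x - blinfun_apply p x" unfolding eq[symmetric] using uv(3)
      by (simp add: distrib_right[symmetric])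
    finally show "?z \<in> ?P" using x z(1) unfolding argmin_lovasz by force
  qed
  show "cell_closed ?P" unfolding cell_closed_def
  proof (intro ballI subsetI)
    fix x y assume x: "x \<in> ?P" and y: "y \<in> closed_cell x"
    define m where "m = lovasz_val x - blinfun_apply p x"
    have xK: "x \<in> lovasz_dom" and min: "\<And>y. y \<in> lovasz_dom \<Longrightarrow> m \<le> lovasz_val y - blinfun_apply p y"
      using x unfolding argmin_lovasz m_def by auto
    have ge: "m \<le> fval v - blinfun_apply p v" if v: "v \<in> cverts x" for v
    proof -
      have "v \<in> D" using xK v unfolding lovasz_dom_def by blast
      moreover from this have "v \<in> lovasz_dom" using lovasz_dom_vertices by blast
      ultimately show ?thesis using min[of v] lovasz_val_vertex by simp
    qed
    have "(\<Sum>v\<in>cverts x. bary \<Phi> x v * (fval v - blinfun_apply p v - m)) = 0"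
    proof -
      have "(\<Sum>v\<in>cverts x. bary \<Phi> x v * (fval v - blinfun_apply p v - m))
        = lovasz_val x - (\<Sum>v\<in>cverts x. bary \<Phi> x v * blinfun_apply p v) - (\<Sum>v\<in>cverts x. bary \<Phi> x v) * m"
        unfolding lovasz_val_def by (simp add: right_diff_distrib sum_subtractf sum_distrib_right)
      then show ?thesis unfolding m_def by (simp add: bary_apply bary_facts(3))
    qed
    then have "\<forall>v\<in>cverts x. bary \<Phi> x v * (fval v - blinfun_apply p v - m) = 0"
      using ge bary_facts(1) cverts_facts(1) by (subst (asm) sum_nonneg_eq_0_iff) auto
    then have "fval v = blinfun_apply p v + m" if "v \<in> cverts x" for v
      using bary_pos[OF that] that by fastforce
    from lovasz_val_affine[OF this y] have "lovasz_val y - blinfun_apply p y = m" by simp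
    moreover have "y \<in> lovasz_dom" using xK y cell_closed_lovasz_dom unfolding cell_closed_def by blast
    ultimately show "y \<in> ?P" using min unfolding argmin_lovasz by simp
  qed
qed

lemma L_convex_of_convex:
  assumes c: "convex_fun (lovasz \<Phi> f)"
  shows "L_convex_fun \<Phi> f"
  unfolding L_convex_fun_def
proof (intro exI[of _ "lovasz \<Phi> f"] conjI ballI)
  show "f v = lovasz \<Phi> f v" if "v \<in> cvertices \<Phi>" for v using lovasz_vertex[OF that] by simp
  show "primal_int_L_convex_fun \<Phi> (lovasz \<Phi> f)"
    unfolding primal_int_L_convex_fun_def locally_polyhedral_convex_fun_def
  proof (intro conjI ballI)
    show "proper_fun (lovasz \<Phi> f)" unfolding proper_fun_def
    proof (intro conjI allI)
      show "lovasz \<Phi> f x \<noteq> - \<infinity>" for x using lovasz_real[of x] lovasz_outside[of x] by (cases "x \<in> lovasz_dom") auto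
      show "\<exists>x. lovasz \<Phi> f x \<noteq> \<infinity>" using lovasz_dom_nonempty lovasz_real by force
    qed
    show "convex (epi (lovasz \<Phi> f))" using c unfolding convex_fun_def .
    show "locally_polyhedral (epi (lovasz \<Phi> f))" by (rule locally_polyhedral_lovasz[OF c])
    fix P assume "P \<in> Pi_fam (lovasz \<Phi> f)"
    then show "int_L_convex_polyhedron \<Phi> P" unfolding Pi_fam_def using argmin_polyhedron[OF c] by blast
  qed
qed

text \<open>
  A subgradient at a point exhibits it as a member of some argmin set; as that set is a union of
  closed cells, the convex extension is affine on the closed cell of the point.
\<close>

lemma convex_of_L_convex:
  assumes "L_convex_fun \<Phi> f"
  shows "convex_fun (lovasz \<Phi> f)"
proof -
  obtain h where h: "primal_int_L_convex_fun \<Phi> h" and fh: "\<And>v. v \<in> cvertices \<Phi> \<Longrightarrow> f v = h v"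
    using assms unfolding L_convex_fun_def by blast
  have nm: "\<And>y. h y \<noteq> -\<infinity>" and ce: "convex (epi h)" and lp: "locally_polyhedral (epi h)"
    and am: "\<And>p. argmin_lin h p \<noteq> {} \<Longrightarrow> int_L_convex_polyhedron \<Phi> (argmin_lin h p)"
    using h unfolding primal_int_L_convex_fun_def proper_fun_def locally_polyhedral_convex_fun_def Pi_fam_def by blast+
  have fin: "h x = lovasz \<Phi> f x" if x: "h x = ereal \<eta>" for x \<eta>
  proof -
    obtain p where p: "\<And>y. ereal (\<eta> + blinfun_apply p (y - x)) \<le> h y"
      using subgradient_exists[OF ce lp nm x] by blast
    have xA: "x \<in> argmin_lin h p" unfolding argmin_lin_def
    proof (intro CollectI allI)
      fix y show "h x - ereal (blinfun_apply p x) \<le> h y - ereal (blinfun_apply p y)"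
      proof (cases "h y")
        case (real t) then show ?thesis using p[of y] x by (simp add: blinfun.diff_right)
      qed (use x nm in auto)
    qed
    then have "cell_closed (argmin_lin h p)" using int_polyhedron_facts(2)[OF am] by blast
    then have sub: "closed_cell x \<subseteq> argmin_lin h p" using xA unfolding cell_closed_def by blast
    have hv: "h v = ereal (blinfun_apply p v + (\<eta> - blinfun_apply p x))" if v: "v \<in> cverts x" for v
    proof -
      have "v \<in> argmin_lin h p" using sub cverts_in_closed_cell[OF v] by blast
      then have "h v - ereal (blinfun_apply p v) \<le> h x - ereal (blinfun_apply p x)"
        "h x - ereal (blinfun_apply p x) \<le> h v - ereal (blinfun_apply p v)"
        using xA unfolding argmin_lin_def by blast+
      then show ?thesis using x nm[of v] by (cases "h v") auto
    qed
    have vD: "v \<in> D" and gv: "fval v = blinfun_apply p v + (\<eta> - blinfun_apply p x)" if v: "v \<in> cverts x" for v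
      using hv[OF v] fh[OF cverts_vertex(3)[OF v]] cverts_vertex(3)[OF v]
      unfolding eff_dom_def fval_def by auto
    have "lovasz_val x = \<eta>" using lovasz_val_affine[OF gv closed_cell_refl] by simp
    moreover have "cverts x \<subseteq> D" using vD by blast
    ultimately show ?thesis using x lovasz_D[of x] by simp
  qed
  have "h x = lovasz \<Phi> f x" for x
  proof (cases "h x")
    case (real \<eta>) then show ?thesis by (rule fin)
  next
    case PInf
    \<comment> \<open>If all vertices were in \<open>D\<close>, convexity of the epigraph of
      \<open>h\<close> would bound \<open>h x\<close> by a finite value.\<close>
    have "\<not> cverts x \<subseteq> D"
    proof
      assume sub: "cverts x \<subseteq> D"
      have "(\<Sum>v\<in>cverts x. bary \<Phi> x v *\<^sub>R (v, fval v)) \<in> epi h"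
      proof (rule convex_sum[OF cverts_facts(1) ce bary_facts(3) bary_facts(1)])
        fix v assume "v \<in> cverts x"
        then have "v \<in> D" using sub by blast
        then have "h v = ereal (fval v)" using f_D[of v] fh[of v] D_vertices by (metis subsetD)
        then show "(v, fval v) \<in> epi h" unfolding epi_def by simp
      qed
      moreover have "fst (\<Sum>v\<in>cverts x. bary \<Phi> x v *\<^sub>R (v, fval v)) = x" by (simp add: fst_sum bary_facts(4))
      ultimately show False using PInf unfolding epi_def by (auto simp: case_prod_beta)
    qed
    then show ?thesis using lovasz_not_D PInf by simp
  qed (use nm in blast)
  then have "lovasz \<Phi> f = h" by auto
  then show ?thesis unfolding convex_fun_def using ce by simp
qed

section \<open>From adjacent simplices to global convexity\<close>

lemma maximal_simplex:
  assumes P: "P \<inter> cvertices \<Phi> = D" "convex P" "cell_closed P" and x: "maximal_in P x"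
  shows "cell_at \<Phi> x \<in> max_simplices (subcomplex \<Phi> D)"
proof -
  \<comment> \<open>Convexity keeps hulls of vertices inside \<open>P\<close>; conversely
    \<open>P\<close> contains the closed cell of each of its points and thus the vertices.\<close>
  have PD: "cverts y \<subseteq> D \<longleftrightarrow> y \<in> P" for y
  proof
    assume "cverts y \<subseteq> D"
    then have "closed_cell y \<subseteq> P" unfolding cverts_facts(3) using P(1,2) by (intro hull_minimal) auto
    then show "y \<in> P" using closed_cell_refl by blast
  next
    assume "y \<in> P"
    then show "cverts y \<subseteq> D" using P(1,3) cverts_vertex(3) cverts_in_closed_cell unfolding cell_closed_def by blast
  qed
  show ?thesis unfolding max_simplices_def
  proof (intro CollectI conjI ballI impI)
    show "cell_at \<Phi> x \<in> subcomplex \<Phi> D"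
      unfolding subcomplex_def coxeter_complex_def using cell_at_cell PD x unfolding maximal_in_def by blast
    fix B assume B: "B \<in> subcomplex \<Phi> D" and le: "cell_le (cell_at \<Phi> x) B"
    have "B \<noteq> {}" using le in_cell_at[of x] closure_subset[of "cell_at \<Phi> x"] unfolding cell_le_def by auto
    then obtain b where "b \<in> B" by blast
    then have b: "B = cell_at \<Phi> b" using B cells_eq_cell_at unfolding subcomplex_def coxeter_complex_def by blast
    then have "b \<in> P" using B PD unfolding subcomplex_def by blast
    have xb: "x \<in> closed_cell b" using le closed_cell_refl[of x] unfolding cell_le_def b closure_cell_at by blast
    have "cverts x = cverts b"
      using card_seteq[OF cverts_facts(1) cverts_mono[OF xb]] x \<open>b \<in> P\<close> unfolding maximal_in_def by blast
    then have "b \<in> closed_cell x" using closed_cell_refl[of b] unfolding cverts_facts(3) by simp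
    then show "B = cell_at \<Phi> x" unfolding b using cell_at_eq_iff xb by blast
  qed
qed

text \<open>The common face is realised as the cell of a point \<open>b\<close> whose vertex set is
  the facet; such a point exists as the facet is nonempty.\<close>

lemma adjacent_across_facet:
  assumes v: "v \<in> cverts x" "cverts x' = insert v' (cverts x - {v})" "v' \<notin> cverts x" and ne: "cverts x - {v} \<noteq> {}"
  shows "adjacent \<Phi> (cell_at \<Phi> x) (cell_at \<Phi> x')"
proof -
  let ?F = "cverts x - {v}"
  obtain b where b: "b \<in> closed_cell x" "cverts b = ?F" using face_point[of ?F x] ne by blast
  have "convex hull ?F \<subseteq> convex hull (cverts x')" using v(2) by (intro hull_mono) auto
  then have b': "b \<in> closed_cell x'"
    using closed_cell_refl[of b] unfolding cverts_facts(3)[of b] cverts_facts(3)[of x'] b(2) by blast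
  have fin: "finite (cverts x)" by (rule cverts_facts)
  show ?thesis unfolding adjacent_def
  proof (intro conjI bexI[of _ "cell_at \<Phi> b"])
    show "cell_at \<Phi> x \<noteq> cell_at \<Phi> x'"
    proof
      assume "cell_at \<Phi> x = cell_at \<Phi> x'"
      then have "cverts x = cverts x'" by (rule arg_cong)
      moreover have "v' \<in> cverts x'" unfolding v(2) by (rule insertI1)
      ultimately show False using v(3) by blast
    qed
    show "cell_le (cell_at \<Phi> b) (cell_at \<Phi> x)" "cell_le (cell_at \<Phi> b) (cell_at \<Phi> x')"
      unfolding cell_le_def closure_cell_at using closed_cell_subset b(1) b' by auto
    show "card (cverts x) = card (cverts b) + 1" unfolding b(2) using card_Suc_Diff1[OF fin v(1)] by simp
    show "card (cverts x') = card (cverts b) + 1" unfolding b(2) v(2) using fin v(3) by simp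
    show "cell_at \<Phi> b \<in> coxeter_complex \<Phi>" unfolding coxeter_complex_def using cell_at_cell by blast
  qed
qed

lemma convex_of_local:
  assumes dom: "L_convex_set \<Phi> D"
    and loc: "\<And>A1 A2 x y. A1 \<in> max_simplices (subcomplex \<Phi> D) \<Longrightarrow> A2 \<in> max_simplices (subcomplex \<Phi> D) \<Longrightarrow>
      adjacent \<Phi> A1 A2 \<Longrightarrow> x \<in> verts A1 - verts A2 \<Longrightarrow> y \<in> verts A2 - verts A1 \<Longrightarrow> midpoint_ineq \<Phi> f x y"
  shows "convex_fun (lovasz \<Phi> f)"
proof -
  obtain P where "int_L_convex_polyhedron \<Phi> P" and PD: "P \<inter> cvertices \<Phi> = D"
    using dom unfolding L_convex_set_def by blast
  then have P: "convex P" "cell_closed P" "P \<noteq> {}" using int_polyhedron_facts by blast+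
  have vP: "cverts x \<subseteq> P" if "x \<in> P" for x
    using that P(2) cverts_in_closed_cell unfolding cell_closed_def by blast
  have vD: "cverts x \<subseteq> D" if "x \<in> P" for x using vP[OF that] PD cverts_vertex(3) by blast
  have KP: "lovasz_dom = P"
  proof
    show "P \<subseteq> lovasz_dom" unfolding lovasz_dom_def using vD by blast
    show "lovasz_dom \<subseteq> P"
    proof
      fix x assume "x \<in> lovasz_dom"
      then have "closed_cell x \<subseteq> P" unfolding cverts_facts(3) lovasz_dom_def using PD P(1) by (intro hull_minimal) auto
      then show "x \<in> P" using closed_cell_refl by blast
    qed
  qed
  \<comment> \<open>Induction on the number of hyperplanes between the cell and \<open>y\<close>: at
    \<open>y\<close>, the affine piece of the current cell lies below that of the next cell of the
    walk.\<close>
  have minorant: "blinfun_apply p y + c \<le> lovasz_val y"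
    if y: "y \<in> P" and x: "maximal_in P x" and pc: "\<And>v. v \<in> cverts x \<Longrightarrow> fval v = blinfun_apply p v + c" for x y p c
    using x pc
  proof (induction "card (sep x y)" arbitrary: x p c rule: less_induct)
    case less
    note pc = less.prems(2)
    show ?case
    proof (cases "y \<in> closed_cell x")
      case True then show ?thesis using lovasz_val_affine[OF pc True] by simp
    next
      case False
      have yh: "y \<in> root_hull P" using y subset_root_hull by blast
      obtain v v' x' \<alpha> k where
        a: "\<alpha> \<in> \<Phi>" and v: "v \<in> cverts x" and aF: "\<And>f. f \<in> cverts x - {v} \<Longrightarrow> blinfun_apply \<alpha> f = of_int k"
        and av: "blinfun_apply \<alpha> v > of_int k" and ay: "blinfun_apply \<alpha> y < of_int k" and av': "blinfun_apply \<alpha> v' < of_int k"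
        and x': "maximal_in P x'" and cx': "cverts x' = insert v' (cverts x - {v})" and sep: "card (sep x' y) < card (sep x y)"
        and yaff: "y \<in> affine hull (cverts x)" and Fne: "cverts x - {v} \<noteq> {}"
        by (rule gallery_step[OF P(1,2) less.prems(1) yh False]) blast
      obtain p' c' where pc': "\<forall>w\<in>cverts x'. fval w = blinfun_apply p' w + c'" using affine_interpolation by blast
      have IH: "blinfun_apply p' y + c' \<le> lovasz_val y" using less.hyps[OF sep x'] pc' by blast
      have x'P: "x' \<in> P" using x' unfolding maximal_in_def by blast
      have xP: "x \<in> P" using less.prems(1) unfolding maximal_in_def by blast
      have v'x': "v' \<in> cverts x'" using cx' by blast
      have v'P: "v' \<in> P" using vP[OF x'P] v'x' by blast
      have v'aff: "v' \<in> affine hull (cverts x)" by (rule maximal_affine_hull[OF P(1) less.prems(1) v'P])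
      have v'x: "v' \<notin> cverts x" using av av' aF by (metis DiffI order_less_asym order_less_irrefl singletonD)
      have vx': "v \<notin> cverts x'" using cx' v v'x by auto
      have vD': "v \<in> D" "v' \<in> D" using vD[OF xP] v vD[OF x'P] v'x' by blast+
      have mid: "midpoint_ineq \<Phi> f v v'"
      proof (rule loc)
        show "cell_at \<Phi> x \<in> max_simplices (subcomplex \<Phi> D)" "cell_at \<Phi> x' \<in> max_simplices (subcomplex \<Phi> D)"
          using maximal_simplex[OF PD P(1,2)] less.prems(1) x' by blast+
        show "adjacent \<Phi> (cell_at \<Phi> x) (cell_at \<Phi> x')" by (rule adjacent_across_facet[OF v cx' v'x Fne])
      qed (use v vx' v'x v'x' in auto)
      define z where "z = (1/2) *\<^sub>R (v + v')"
      have Lz: "2 * lovasz_val z \<le> fval v + fval v'" using mid midpoint_ineq_D[OF vD' z_def] by blast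
      \<comment> \<open>\<open>q\<close> and \<open>d\<close> form the difference of the affine
        pieces of \<open>x'\<close> and \<open>x\<close>. It vanishes on the common facet, so inside
        the affine hull its value is proportional to that of the wall, and crossing the wall
        reverses its sign.\<close>
      define q where "q = p' - p"
      define d where "d = c' - c"
      have qF: "blinfun_apply q f = - d" if "f \<in> cverts x - {v}" for f
      proof -
        have "f \<in> cverts x'" "f \<in> cverts x" using that cx' by auto
        then have "blinfun_apply p' f + c' = blinfun_apply p f + c" using pc pc' by metis
        then show ?thesis unfolding q_def d_def by (simp add: blinfun.diff_left)
      qed
      have cross: "\<exists>m<0. blinfun_apply q w + d = m * (blinfun_apply q v + d)"
        if w: "w \<in> affine hull (cverts x)" "blinfun_apply \<alpha> w < of_int k" for w
      proof -
        obtain \<mu> where m: "sum \<mu> (cverts x) = 1" "(\<Sum>f\<in>cverts x. \<mu> f *\<^sub>R f) = w"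
          using w(1) unfolding affine_hull_finite[OF cverts_facts(1)] by blast
        have "blinfun_apply \<alpha> w - k = \<mu> v * (blinfun_apply \<alpha> v - k)"
          unfolding m(2)[symmetric] using aF by (intro affine_eval cverts_facts m v) auto
        then have "\<mu> v * (blinfun_apply \<alpha> v - k) < 0" using w(2) by linarith
        then have "\<mu> v < 0" using av by (simp add: mult_less_0_iff)
        moreover have "blinfun_apply q w - (- d) = \<mu> v * (blinfun_apply q v - (- d))"
          unfolding m(2)[symmetric] using qF by (intro affine_eval cverts_facts m v) auto
        ultimately show ?thesis by (intro exI[of _ "\<mu> v"]) simp
      qed
      \<comment> \<open>If \<open>z\<close> lies in the closed cell of \<open>x'\<close>, the
        inequality bounds the difference from above at \<open>v\<close>. If it lies in that of
        \<open>x\<close>, it bounds the difference from below at \<open>v'\<close>, which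
        \<open>cross\<close> turns into the same bound.\<close>
      have qv: "blinfun_apply q v + d \<le> 0"
      proof -
        have gv: "fval v = blinfun_apply p v + c" and gv': "fval v' = blinfun_apply p' v' + c'"
          using pc[OF v] pc' v'x' by blast+
        have zhalf: "2 * blinfun_apply r z = blinfun_apply r v + blinfun_apply r v'" for r :: "'a \<Rightarrow>\<^sub>L real"
          unfolding z_def by (simp add: blinfun.scaleR_right blinfun.add_right)
        have "z \<in> closed_cell x \<union> closed_cell x'"
          unfolding z_def by (rule midpoint_across_facet[OF v cx' aF av av' v'aff])
        then show ?thesis
        proof
          assume "z \<in> closed_cell x"
          then have "lovasz_val z = blinfun_apply p z + c" using lovasz_val_affine[OF pc] by blast
          then have "blinfun_apply p v' + c \<le> blinfun_apply p' v' + c'" using Lz gv gv' zhalf[of p] by argo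
          then have ge: "0 \<le> blinfun_apply q v' + d" unfolding q_def d_def by (simp add: blinfun.diff_left)
          obtain m where "m < 0" "blinfun_apply q v' + d = m * (blinfun_apply q v + d)"
            using cross[OF v'aff av'] by blast
          then show ?thesis using ge by (simp add: zero_le_mult_iff)
        next
          assume "z \<in> closed_cell x'"
          then have "lovasz_val z = blinfun_apply p' z + c'" using lovasz_val_affine pc' by blast
          then have "blinfun_apply p' v + c' \<le> blinfun_apply p v + c" using Lz gv gv' zhalf[of p'] by argo
          then show ?thesis unfolding q_def d_def by (simp add: blinfun.diff_left)
        qed
      qed
      obtain m where "m < 0" "blinfun_apply q y + d = m * (blinfun_apply q v + d)"
        using cross[OF yaff ay] by blast
      then have "0 \<le> blinfun_apply q y + d" using qv by (simp add: mult_nonpos_nonpos)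
      then show ?thesis using IH unfolding q_def d_def by (simp add: blinfun.diff_left)
    qed
  qed
  show ?thesis unfolding convex_fun_iff KP
  proof (intro ballI allI impI)
    fix x y and u v :: real assume x: "x \<in> P" and y: "y \<in> P" and uv: "0 \<le> u \<and> 0 \<le> v \<and> u + v = 1"
    define z where "z = u *\<^sub>R x + v *\<^sub>R y"
    have zP: "z \<in> P" unfolding z_def using P(1) x y uv by (simp add: convexD)
    \<comment> \<open>The affine piece of a maximal cell whose closure contains \<open>z\<close> is
      exact at \<open>z\<close> and a minorant at \<open>x\<close> and \<open>y\<close>.\<close>
    then obtain m where m: "maximal_in P m" "z \<in> closed_cell m"
      using maximal_cover[OF P] subset_root_hull by blast
    obtain p c where pc: "\<forall>v\<in>cverts m. fval v = blinfun_apply p v + c" using affine_interpolation by blast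
    have "lovasz_val z = blinfun_apply p z + c" using lovasz_val_affine[OF _ m(2)] pc by blast
    also have "\<dots> = u * (blinfun_apply p x + c) + v * (blinfun_apply p y + c)"
    proof -
      have "c = u * c + v * c" using uv by (simp add: distrib_right[symmetric])
      then show ?thesis unfolding z_def by (simp add: blinfun.add_right blinfun.scaleR_right algebra_simps)
    qed
    also have "\<dots> \<le> u * lovasz_val x + v * lovasz_val y"
      using minorant[OF x m(1)] minorant[OF y m(1)] pc uv by (intro add_mono mult_left_mono) auto
    finally show "u *\<^sub>R x + v *\<^sub>R y \<in> P \<and> lovasz_val (u *\<^sub>R x + v *\<^sub>R y) \<le> u * lovasz_val x + v * lovasz_val y"
      using zP unfolding z_def by blast
  qed
qed

end

theorem theorem7p2:
  fixes \<Phi> :: "('a::euclidean_space \<Rightarrow>\<^sub>L real) set"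
    and f :: "'a \<Rightarrow> ereal"
  assumes "root_system \<Phi>" and "essential \<Phi>" and "irreducible_roots \<Phi>" and "classical_type \<Phi>"
    and "\<forall>v\<in>cvertices \<Phi>. f v \<noteq> - \<infinity>"
    and "eff_dom \<Phi> f \<noteq> {}"
  shows "(L_convex_fun \<Phi> f \<longleftrightarrow> convex_fun (lovasz \<Phi> f))
       \<and> (convex_fun (lovasz \<Phi> f) \<longleftrightarrow>
            (\<forall>x\<in>cvertices \<Phi>. \<forall>y\<in>cvertices \<Phi>. midpoint_ineq \<Phi> f x y))
       \<and> ((\<forall>x\<in>cvertices \<Phi>. \<forall>y\<in>cvertices \<Phi>. midpoint_ineq \<Phi> f x y) \<longleftrightarrow>
            (L_convex_set \<Phi> (eff_dom \<Phi> f) \<and>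
             (\<forall>A1\<in>max_simplices (subcomplex \<Phi> (eff_dom \<Phi> f)).
              \<forall>A2\<in>max_simplices (subcomplex \<Phi> (eff_dom \<Phi> f)).
                adjacent \<Phi> A1 A2 \<longrightarrow>
                (\<forall>x\<in>verts A1 - verts A2. \<forall>y\<in>verts A2 - verts A1. midpoint_ineq \<Phi> f x y))))"
proof -
  interpret vertex_function \<Phi> f
    using assms by unfold_locales auto
  have ab: "L_convex_fun \<Phi> f \<longleftrightarrow> convex_fun (lovasz \<Phi> f)"
    using L_convex_of_convex convex_of_L_convex by blast
  have bc: "convex_fun (lovasz \<Phi> f) \<longleftrightarrow> (\<forall>x\<in>cvertices \<Phi>. \<forall>y\<in>cvertices \<Phi>. midpoint_ineq \<Phi> f x y)"
    using convex_of_midpoint midpoint_of_convex D_vertices by blast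
  have simplex_verts: "verts A \<subseteq> cvertices \<Phi>" if "A \<in> max_simplices (subcomplex \<Phi> D)" for A
    using that D_vertices unfolding max_simplices_def subcomplex_def by blast
  show ?thesis
  proof (intro conjI ab bc iffI)
    assume mid: "\<forall>x\<in>cvertices \<Phi>. \<forall>y\<in>cvertices \<Phi>. midpoint_ineq \<Phi> f x y"
    then show "L_convex_set \<Phi> D" using bc L_convex_set_dom by blast
    show "\<forall>A1\<in>max_simplices (subcomplex \<Phi> D). \<forall>A2\<in>max_simplices (subcomplex \<Phi> D). adjacent \<Phi> A1 A2 \<longrightarrow>
        (\<forall>x\<in>verts A1 - verts A2. \<forall>y\<in>verts A2 - verts A1. midpoint_ineq \<Phi> f x y)"
      using mid simplex_verts by blast
  next
    assume "L_convex_set \<Phi> D \<and> (\<forall>A1\<in>max_simplices (subcomplex \<Phi> D). \<forall>A2\<in>max_simplices (subcomplex \<Phi> D).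
        adjacent \<Phi> A1 A2 \<longrightarrow> (\<forall>x\<in>verts A1 - verts A2. \<forall>y\<in>verts A2 - verts A1. midpoint_ineq \<Phi> f x y))"
    then have "convex_fun (lovasz \<Phi> f)" by (intro convex_of_local) blast+
    then show "\<forall>x\<in>cvertices \<Phi>. \<forall>y\<in>cvertices \<Phi>. midpoint_ineq \<Phi> f x y" using bc by blast
  qed
qed

end
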